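(* Let $N\ge 2$ and let $n\in(0,2)$ be fixed. Suppose that for some eigenvalue $\alpha_k>0$ the nonlinear eigenvalue problem $$-\frac{1}{y^{N-1}}\Big[y^{N-1}|f|^n\Big(\frac{1}{y^{N-1}}(y^{N-1}f')'\Big)'\Big]'-\beta_k\, y f'+\alpha_k f=0\quad (y>0),\qquad f'(0)=f'''(0)=0,\qquad \beta_k=\frac{1+\alpha_k n}{4},$$ has a nontrivial solution (eigenfunction) $f=f_k(y)$ with the minimal growth $f_k(y)=C y^{\alpha_k/\beta_k}(1+o(1))$ as $y\to+\infty$, $C\in\mathbb{R}\setminus\{0\}$; that is, there exists a radial self-similar focusing solution $u_*(r,t)=(-t)^{\alpha_k}f_k\big(r/(-t)^{\beta_k}\big)$, $t<0$, $r=|x|$, of the thin film equation $u_t=-\nabla\cdot(|u|^n\nabla\Delta u)$ exhibiting the finite-time trace $u_*(r,t)\to u_*(r,0^-)=C r^{\alpha_k/\beta_k}$ as $t\to0^-$, uniformly on compact intervals in $r\ge0$. Put $$\mu_k=\mu_k(n,N)=\frac{\alpha_k}{\beta_k}=\frac{4\alpha_k}{1+n\alpha_k}.$$ Then: (i) For the general Cauchy problem for $u_t=-\nabla\cdot(|u|^n\nabla\Delta u)$ in $\mathbb{R}^N\times\mathbb{R}_+$, $u(x,0)=u_0(x)$, even in the radial setting, the Hölder continuity exponent (in $x$) of solutions cannot exceed $\mu_k$; that is, for no $\gamma>\mu_k$ is it true that all (even all radial) solutions have spatial Hölder regularity $C^{\gamma}_{\rm loc}(\mathbb{R}^N)$.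 (ii) Suppose $\mu_k<1$, i.e. $\alpha_k<\frac{1}{4-n}$. Then $$\nabla u_*(\cdot,0^-)\in L^p_{\rm loc}(\mathbb{R}^N)\quad\text{if and only if}\quad p\in[1,p_* ),\qquad p_*=p_*(n,N)=\frac{N}{1-\mu_k},$$ so that for (even radial) solutions of the Cauchy problem, in general, for any $t>0$, $\nabla u(\cdot,t)\notin L^{p_*}_{\rm loc}(\mathbb{R}^N)$ (i.e. for any $t>0$ membership of $\nabla u(\cdot,t)$ in $L^{p_*}_{\rm loc}(\mathbb{R}^N)$ does not hold for all solutions).
   Context: The equation $u_t=-\nabla\cdot(|u|^n\nabla\Delta u)$ is the fourth-order thin film equation. The ODE for $f$ is what one gets by substituting $u_*(r,t)=(-t)^{\alpha}f(y)$, $y=r/(-t)^{\beta}$, $\beta=(1+\alpha n)/4$, $t<0$, into the thin film equation for radial functions. The focusing time is normalised to $t=0^-$ by translation in time. The class of solutions under consideration includes the time-translates of the self-similar focusing solutions $u_*$. For $\gamma\ge1$, Hölder class $C^\gamma$ means $C^{l+\varepsilon}$ (that is, $C^{l,\varepsilon}$) with $\gamma=l+\varepsilon$, $l$ a nonnegative integer, $\varepsilon\in(0,1]$. *)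

theory Defs
  imports "HOL-Analysis.Analysis"
begin

text \<open>
  The space \<open>\<real>\<^sup>N\<close> is a type \<open>'a::euclidean_space\<close> with \<open>N = DIM('a)\<close>.
\<close>

definition partial :: "('b::euclidean_space \<Rightarrow> real) \<Rightarrow> 'b \<Rightarrow> 'b \<Rightarrow> real" where
  "partial g b x = frechet_derivative g (at x) b"

definition grad :: "('a::euclidean_space \<Rightarrow> real) \<Rightarrow> 'a \<Rightarrow> 'a" where
  "grad g x = (\<Sum>b\<in>Basis. partial g b x *\<^sub>R b)"

definition laplacian :: "('a::euclidean_space \<Rightarrow> real) \<Rightarrow> 'a \<Rightarrow> real" where
  "laplacian g x = (\<Sum>b\<in>Basis. partial (partial g b) b x)"

definition C1 :: "('b::euclidean_space \<Rightarrow> real) \<Rightarrow> bool" where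
  "C1 g \<longleftrightarrow> (\<forall>x. g differentiable at x) \<and> (\<forall>b\<in>Basis. continuous_on UNIV (partial g b))"

definition test_function_on :: "'b::euclidean_space set \<Rightarrow> ('b \<Rightarrow> real) \<Rightarrow> bool" where
  "test_function_on U \<phi> \<longleftrightarrow> C1 \<phi> \<and> (\<exists>K. compact K \<and> K \<subseteq> U \<and> (\<forall>x. x \<notin> K \<longrightarrow> \<phi> x = 0))"

fun holder_deriv_loc :: "nat \<Rightarrow> real \<Rightarrow> ('a::euclidean_space \<Rightarrow> real) \<Rightarrow> bool" where
  "holder_deriv_loc 0 \<epsilon> g \<longleftrightarrow>
     (\<forall>K. compact K \<longrightarrow> (\<exists>M. \<forall>x\<in>K. \<forall>y\<in>K. \<bar>g x - g y\<bar> \<le> M * dist x y powr \<epsilon>))"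
| "holder_deriv_loc (Suc l) \<epsilon> g \<longleftrightarrow>
     (\<forall>x. g differentiable at x) \<and> (\<forall>b\<in>Basis. holder_deriv_loc l \<epsilon> (partial g b))"

text \<open>
  \<open>C\<^sup>\<gamma>\<close> is \<open>C\<^bsup>l,\<epsilon>\<^esup>\<close> with \<open>\<gamma> = l + \<epsilon>\<close> and \<open>0 < \<epsilon> \<le> 1\<close>; in particular \<open>C\<^sup>1\<close> in this
  scale means locally Lipschitz. Meaningful for \<open>\<gamma> > 0\<close>.
\<close>

definition holder_loc :: "real \<Rightarrow> ('a::euclidean_space \<Rightarrow> real) \<Rightarrow> bool" where
  "holder_loc \<gamma> g \<longleftrightarrow> holder_deriv_loc (nat (\<lceil>\<gamma>\<rceil> - 1)) (\<gamma> - (of_int \<lceil>\<gamma>\<rceil> - 1)) g"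

text \<open>The gradient is the distributional one.\<close>

definition grad_in_Lp_loc :: "real \<Rightarrow> ('a::euclidean_space \<Rightarrow> real) \<Rightarrow> bool" where
  "grad_in_Lp_loc p g \<longleftrightarrow>
     (\<forall>K. compact K \<longrightarrow> set_integrable lborel K g) \<and>
     (\<exists>G :: 'a \<Rightarrow> 'a. G \<in> borel_measurable lborel \<and>
        (\<forall>K. compact K \<longrightarrow> set_integrable lborel K (\<lambda>x. norm (G x) powr p)) \<and>
        (\<forall>\<phi>. test_function_on UNIV \<phi> \<longrightarrow>
           (\<forall>b\<in>Basis. (\<integral>x. g x * partial \<phi> b x \<partial>lborel) = - (\<integral>x. (G x \<bullet> b) * \<phi> x \<partial>lborel))))"

text \<open>\<open>0 powr n = 0\<close>, so the flux vanishes wherever \<open>u = 0\<close>.\<close>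

definition thin_film_flux :: "real \<Rightarrow> ('a::euclidean_space \<Rightarrow> real) \<Rightarrow> 'a \<Rightarrow> 'a" where
  "thin_film_flux n v x = (\<bar>v x\<bar> powr n) *\<^sub>R grad (laplacian v) x"

text \<open>
  Solutions of the Cauchy problem for \<open>u\<^sub>t = - div (|u|\<^sup>n grad (laplacian u))\<close> on \<open>\<real>\<^sup>N \<times> [0,T]\<close>,
  possibly of changing sign, in the sense of Bernis and Friedman: \<open>u\<close> is continuous on
  \<open>\<real>\<^sup>N \<times> [0,T]\<close>, in particular up to the time \<open>T\<close>, which may be a time at which regularity is
  lost; it is continuously differentiable in space for \<open>0 < t < T\<close> (zero contact angle);
  the third-order flux is taken classically on the open set where \<open>u\<close> does not vanish; the
  equation holds in the integrated form. Test functions live on the open strip, with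
  \<open>(0,1)\<close> the time direction of \<open>'a \<times> real\<close>.
\<close>

definition thin_film_solution ::
    "real \<Rightarrow> real \<Rightarrow> ('a::euclidean_space \<Rightarrow> real) \<Rightarrow> ('a \<Rightarrow> real \<Rightarrow> real) \<Rightarrow> bool" where
  "thin_film_solution n T u0 u \<longleftrightarrow>
     0 < T \<and>
     continuous_on (UNIV \<times> {0..T}) (\<lambda>(x, t). u x t) \<and>
     (\<forall>x. u x 0 = u0 x) \<and>
     (\<forall>t\<in>{0<..<T}. C1 (\<lambda>x. u x t)) \<and>
     (\<forall>t\<in>{0<..<T}. \<forall>x. u x t \<noteq> 0 \<longrightarrow>
        (\<forall>b\<in>Basis. partial (\<lambda>z. u z t) b differentiable at x) \<and>
        laplacian (\<lambda>z. u z t) differentiable at x) \<and>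
     continuous_on {(x, t). 0 < t \<and> t < T \<and> u x t \<noteq> 0}
       (\<lambda>(x, t). grad (laplacian (\<lambda>z. u z t)) x) \<and>
     (\<forall>K. compact K \<and> K \<subseteq> UNIV \<times> {0<..<T} \<longrightarrow>
        set_integrable lborel K (\<lambda>(x, t). thin_film_flux n (\<lambda>z. u z t) x)) \<and>
     (\<forall>\<phi> :: 'a \<times> real \<Rightarrow> real. test_function_on (UNIV \<times> {0<..<T}) \<phi> \<longrightarrow>
        (\<integral>(x, t). u x t * partial \<phi> (0, 1) (x, t) +
             thin_film_flux n (\<lambda>z. u z t) x \<bullet> grad (\<lambda>z. \<phi> (z, t)) x \<partial>lborel) = 0)"

definition radial_on :: "real \<Rightarrow> ('a::euclidean_space \<Rightarrow> real \<Rightarrow> real) \<Rightarrow> bool" where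
  "radial_on T u \<longleftrightarrow> (\<forall>t\<in>{0..T}. \<forall>x y. norm x = norm y \<longrightarrow> u x t = u y t)"

text \<open>Derivative of a function on the half-line \<open>[0,\<infinity>)\<close>, one-sided at \<open>0\<close>.\<close>

definition hderiv :: "(real \<Rightarrow> real) \<Rightarrow> real \<Rightarrow> real" where
  "hderiv g y = vector_derivative g (at y within {0..})"

definition radial_laplacian :: "nat \<Rightarrow> (real \<Rightarrow> real) \<Rightarrow> real \<Rightarrow> real" where
  "radial_laplacian N f y = hderiv (\<lambda>s. s ^ (N - 1) * hderiv f s) y / y ^ (N - 1)"

definition C3_near_origin :: "(real \<Rightarrow> real) \<Rightarrow> bool" where
  "C3_near_origin f \<longleftrightarrow>
     (\<exists>\<delta>>0. (\<forall>k<3. \<forall>y\<in>{0..<\<delta>}. (hderiv ^^ k) f differentiable (at y within {0..})) \<and>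
            continuous_on {0..<\<delta>} ((hderiv ^^ 3) f))"

text \<open>
  Eigenfunctions may change sign. At a transversal zero the flux
  \<open>y\<^bsup>N-1\<^esup> |f|\<^sup>n (laplacian f)'\<close> has a limit that is in general nonzero, although \<open>f'''\<close> (and for
  \<open>n \<ge> 1\<close> also \<open>f''\<close>) blows up there. The outer derivative in the equation is therefore that of
  the continuous representative \<open>J\<close> of the flux, which agrees with the flux where \<open>f \<noteq> 0\<close> and
  is \<open>0\<close> almost everywhere on the zero set. For a classical solution \<open>J\<close> is the flux itself.
\<close>

definition focusing_eigenfunction :: "nat \<Rightarrow> real \<Rightarrow> real \<Rightarrow> real \<Rightarrow> (real \<Rightarrow> real) \<Rightarrow> bool" where
  "focusing_eigenfunction N n \<alpha> \<beta> f \<longleftrightarrow>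
     (\<exists>y\<ge>0. f y \<noteq> 0) \<and>
     f differentiable_on {0..} \<and> continuous_on {0..} (hderiv f) \<and>
     C3_near_origin f \<and> hderiv f 0 = 0 \<and> (hderiv ^^ 3) f 0 = 0 \<and>
     (\<forall>y>0. f y \<noteq> 0 \<longrightarrow>
        hderiv f differentiable at y \<and> radial_laplacian N f differentiable at y) \<and>
     (\<exists>J. (\<forall>y>0. f y \<noteq> 0 \<longrightarrow>
              J y = y ^ (N - 1) * \<bar>f y\<bar> powr n * hderiv (radial_laplacian N f) y) \<and>
          negligible {y. 0 < y \<and> f y = 0 \<and> J y \<noteq> 0} \<and>
          (\<forall>y>0. J differentiable at y \<and>
              - (1 / y ^ (N - 1)) * hderiv J y - \<beta> * y * hderiv f y + \<alpha> * f y = 0))"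

definition focusing_solution ::
    "real \<Rightarrow> real \<Rightarrow> (real \<Rightarrow> real) \<Rightarrow> 'a::euclidean_space \<Rightarrow> real \<Rightarrow> real" where
  "focusing_solution \<alpha> \<beta> f x t = (- t) powr \<alpha> * f (norm x / (- t) powr \<beta>)"

definition focusing_trace ::
    "real \<Rightarrow> real \<Rightarrow> (real \<Rightarrow> real) \<Rightarrow> 'a::euclidean_space \<Rightarrow> real" where
  "focusing_trace \<alpha> \<beta> f x = Lim (at_left 0) (\<lambda>t. focusing_solution \<alpha> \<beta> f x t)"

end

theory Submission
  imports Defs
begin

text \<open>
  The self-similar solution \<open>u\<^sub>*\<close> itself is the obstruction to regularity: it solves the Cauchy
  problem up to and including its focusing time, where it equals \<open>C |x|\<^bsup>\<mu>\<^esup>\<close>, and the singularity of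
  this power at the origin limits the regularity. Three things have to be shown.

  First, \<open>u\<^sub>*\<close> is a weak solution. Let \<open>J\<close> be the continuous representative of the radial flux of the
  profile. The profile equation says \<open>J' = y\<^bsup>N-1\<^esup> g\<close> with \<open>g = \<alpha> f - \<beta> y f'\<close>, and after rescaling this
  means that the space-time field whose spatial part is, up to a power of \<open>T-t\<close>, the vector
  \<open>J(|z|) |z|\<^bsup>-N\<^esup> z\<close> with \<open>z = x / (T-t)\<^bsup>\<beta>\<^esup>\<close>, and whose time component is \<open>u\<^sub>*\<close>, has divergence zero (lemma \<open>divergence_free\<close>). At the origin
  \<open>f'(0) = f'''(0) = 0\<close> makes the gradient of the Laplacian vanish, hence \<open>J\<close> tends to \<open>0\<close>, there is
  no source at the origin, and the field has continuous directional derivatives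
  everywhere. The field and the classical flux differ only where \<open>f = 0\<close> and \<open>J \<noteq> 0\<close>, which is a
  null set of radii and, by Fubini along time lines, a null set in space-time (lemma
  \<open>defect_null\<close>).

  Secondly, the minimal growth of \<open>f\<close> gives \<open>|f(y) - C y\<^bsup>\<mu>\<^esup>| \<le> M + \<eta> y\<^bsup>\<mu>\<^esup>\<close> for every \<open>\<eta> > 0\<close>. Since
  \<open>\<beta> \<mu> = \<alpha>\<close>, rescaling turns this into \<open>(T-t)\<^bsup>\<alpha>\<^esup> M + \<eta> |x|\<^bsup>\<mu>\<^esup>\<close>, which yields the trace, the uniform
  limit and the continuity up to the focusing time (lemmas \<open>sol_bound\<close>, \<open>sol_trace_cont\<close>).

  Thirdly, the trace is examined. For \<open>\<gamma> \<le> 2\<close> the power \<open>|x|\<^bsup>\<mu>\<^esup>\<close> with \<open>\<mu> < \<gamma>\<close> is not in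
  \<open>C\<^bsup>\<gamma>\<^esup>\<close> (lemma \<open>power_not_holder_loc\<close>). For \<open>\<gamma> > 2\<close> the trace is not always a counterexample:
  \<open>\<mu> = 2\<close> occurs, for the stationary solution \<open>f = y\<^sup>2\<close>, and then the trace is smooth. A second radial
  solution takes its place there, a steady state with free boundary \<open>|x| = 1\<close> that is only
  \<open>C\<^bsup>1,1\<^esup>\<close> (lemma \<open>steady_state_not_holder_loc\<close>). The gradient of \<open>|x|\<^bsup>\<mu>\<^esup>\<close> has size
  \<open>|x|\<^bsup>\<mu>-1\<^esup>\<close>, whose \<open>p\<close>-th power is integrable at the origin iff \<open>(1-\<mu>) p < N\<close>; for a general
  distributional gradient the necessity is obtained by testing with concentrating bumps, so
  that the gradient need not be identified almost everywhere (lemma \<open>power_grad_not_in_Lp_loc\<close>).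
\<close>

section \<open>Partial derivatives and integration by parts\<close>

lemma partial_eqI: "(g has_derivative g') (at x) \<Longrightarrow> partial g b x = g' b"
  unfolding partial_def using frechet_derivative_at by metis

lemma has_derivative_partial:
  "g differentiable at x \<Longrightarrow> (g has_derivative (\<lambda>v. partial g v x)) (at x)"
  unfolding partial_def by (simp add: frechet_derivative_works)

lemma line_derivative:
  fixes g :: "'b::euclidean_space \<Rightarrow> real"
  assumes "(g has_derivative g') (at z)"
  shows "((\<lambda>s. g (z + s *\<^sub>R b)) has_real_derivative g' b) (at 0)"
proof -
  have "((\<lambda>s. g (z + s *\<^sub>R b)) has_derivative (\<lambda>s. g' (s *\<^sub>R b))) (at 0)"
    by (rule has_derivative_compose[where f="\<lambda>s. z + s *\<^sub>R b" and g=g])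
      (use assms in \<open>auto intro!: derivative_eq_intros\<close>)
  moreover have "g' (s *\<^sub>R b) = g' b * s" for s
    using linear_scale[OF has_derivative_linear[OF assms]] by simp
  ultimately show ?thesis by (simp add: has_field_derivative_def)
qed

lemma line_derivative_at:
  fixes P :: "'b::euclidean_space \<Rightarrow> real"
  assumes "\<And>z. ((\<lambda>s. P (z + s *\<^sub>R b)) has_real_derivative Q z) (at 0)"
  shows "((\<lambda>s. P (z + s *\<^sub>R b)) has_real_derivative Q (z + s *\<^sub>R b)) (at s)"
proof -
  have "((\<lambda>r. P ((z + s *\<^sub>R b) + r *\<^sub>R b)) has_real_derivative Q (z + s *\<^sub>R b)) (at 0)"
    by (rule assms)
  then have "((\<lambda>r. P (z + (r + s) *\<^sub>R b)) has_real_derivative Q (z + s *\<^sub>R b)) (at 0)"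
    by (simp add: algebra_simps)
  then show ?thesis using DERIV_shift[of "\<lambda>s. P (z + s *\<^sub>R b)" _ 0 s] by simp
qed

lemma integrable_compact_support:
  fixes P :: "'b::euclidean_space \<Rightarrow> 'c::{banach, second_countable_topology}"
  assumes "continuous_on UNIV P" "compact K" "\<And>z. z \<notin> K \<Longrightarrow> P z = 0"
  shows "integrable lborel P"
proof -
  have "integrable lborel (\<lambda>x. indicator K x *\<^sub>R P x)"
    by (rule borel_integrable_compact) (use assms continuous_on_subset in blast)+
  moreover have "(\<lambda>x. indicator K x *\<^sub>R P x) = P"
    using assms(3) by (auto simp: indicator_def fun_eq_iff)
  ultimately show ?thesis by simp
qed

text \<open>
  The difference quotients of \<open>P\<close> in direction \<open>b\<close> integrate to zero by translation invariance, and
  they converge boundedly to \<open>Q\<close>. The argument sees only one direction, so it needs neither Fubini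
  nor differentiability in the other variables.
\<close>

lemma integral_line_derivative_zero:
  fixes P :: "'b::euclidean_space \<Rightarrow> real"
  assumes der: "\<And>z. ((\<lambda>s. P (z + s *\<^sub>R b)) has_real_derivative Q z) (at 0)"
    and contP: "continuous_on UNIV P" and contQ: "continuous_on UNIV Q"
    and K: "compact K" and PK: "\<And>z. z \<notin> K \<Longrightarrow> P z = 0" and QK: "\<And>z. z \<notin> K \<Longrightarrow> Q z = 0"
  shows "(\<integral>z. Q z \<partial>lborel) = 0"
proof -
  have intP: "integrable lborel P" by (rule integrable_compact_support[OF contP K PK])
  obtain B where B: "\<And>z. z \<in> K \<Longrightarrow> \<bar>Q z\<bar> \<le> B"
    using compact_imp_bounded[OF compact_continuous_image[OF continuous_on_subset[OF contQ] K]]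
    by (auto simp: bounded_iff)
  have B': "\<bar>Q z\<bar> \<le> \<bar>B\<bar>" for z
    using B[of z] QK[of z] by (cases "z \<in> K") auto
  \<comment> \<open>The translates of \<open>K\<close> by \<open>-s b\<close>, \<open>0 \<le> s \<le> 1\<close>, contain the supports of all difference quotients.\<close>
  define K' where "K' = (\<lambda>(z, s). z - s *\<^sub>R b) ` (K \<times> {0..1::real})"
  have K': "compact K'" unfolding K'_def
    by (intro compact_continuous_image compact_Times K)
       (auto intro!: continuous_intros simp: case_prod_unfold)
  define e where "e k = 1 / real (Suc k)" for k
  have e: "0 < e k" "e k \<le> 1" for k by (auto simp: e_def)
  define X where "X k z = (P (z + e k *\<^sub>R b) - P z) / e k" for k z
  have inK': "z \<in> K'" if "z + s *\<^sub>R b \<in> K" "0 \<le> s" "s \<le> 1" for z s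
    unfolding K'_def using that by (intro image_eqI[of _ _ "(z + s *\<^sub>R b, s)"]) auto
  have bound: "\<bar>X k z\<bar> \<le> \<bar>B\<bar> * indicator K' z" for k z
  proof (cases "z \<in> K'")
    case True
    obtain s where "P (z + e k *\<^sub>R b) - P (z + 0 *\<^sub>R b) = (e k - 0) * Q (z + s *\<^sub>R b)"
      using MVT2[OF e(1)[of k], of "\<lambda>s. P (z + s *\<^sub>R b)" "\<lambda>s. Q (z + s *\<^sub>R b)"]
        line_derivative_at[OF der] by blast
    then have "X k z = Q (z + s *\<^sub>R b)" using e(1)[of k] by (simp add: X_def)
    then show ?thesis using True B' by simp
  next
    case False
    then have "z + e k *\<^sub>R b \<notin> K" "z \<notin> K" using inK'[of z "e k"] inK'[of z 0] e[of k] by auto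
    then show ?thesis using False PK by (simp add: X_def)
  qed
  have lim: "(\<lambda>k. X k z) \<longlonglongrightarrow> Q z" for z
  proof -
    have "((\<lambda>h. (P (z + (0 + h) *\<^sub>R b) - P (z + 0 *\<^sub>R b)) / h) \<longlongrightarrow> Q z) (at 0)"
      using der[of z] unfolding DERIV_def by simp
    moreover have "filterlim e (at 0) sequentially"
      unfolding filterlim_at
    proof
      show "e \<longlonglongrightarrow> 0" unfolding e_def using LIMSEQ_inverse_real_of_nat by (simp add: inverse_eq_divide)
      show "\<forall>\<^sub>F x in sequentially. e x \<in> UNIV \<and> e x \<noteq> 0" using e by (auto intro!: always_eventually less_imp_neq[symmetric])
    qed
    ultimately have "(\<lambda>k. (P (z + (0 + e k) *\<^sub>R b) - P (z + 0 *\<^sub>R b)) / e k) \<longlonglongrightarrow> Q z"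
      by (rule filterlim_compose)
    then show ?thesis by (simp add: X_def)
  qed
  have shift: "integrable lborel (\<lambda>z. P (z + c)) \<and> (\<integral>z. P (z + c) \<partial>lborel) = (\<integral>z. P z \<partial>lborel)" for c
  proof -
    have eq: "distr lborel borel ((+) c) = (lborel :: 'b measure)" by (rule lborel_distr_plus)
    have "integrable (distr lborel borel ((+) c)) P" using intP by (simp add: eq)
    then have "integrable lborel (\<lambda>z. P (c + z))"
      by (subst (asm) integrable_distr_eq) (use contP in \<open>auto intro!: borel_measurable_continuous_onI\<close>)
    moreover have "(\<integral>z. P z \<partial>distr lborel borel ((+) c)) = (\<integral>z. P (c + z) \<partial>lborel)"
      by (subst integral_distr) (use contP in \<open>auto intro!: borel_measurable_continuous_onI\<close>)
    ultimately show ?thesis by (simp add: eq add.commute)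
  qed
  have "(\<lambda>k. \<integral>z. X k z \<partial>lborel) \<longlonglongrightarrow> (\<integral>z. Q z \<partial>lborel)"
  proof (rule integral_dominated_convergence)
    show "Q \<in> borel_measurable lborel" using contQ by (auto intro!: borel_measurable_continuous_onI)
    show "X k \<in> borel_measurable lborel" for k
      unfolding X_def using contP
      by (auto intro!: borel_measurable_continuous_onI continuous_intros continuous_on_compose2[OF contP] simp: e_def)
    show "integrable lborel (\<lambda>z. \<bar>B\<bar> * indicator K' z)"
      using K' by (auto intro!: integrable_real_indicator emeasure_compact_finite borel_compact)
    show "AE z in lborel. (\<lambda>k. X k z) \<longlonglongrightarrow> Q z" using lim by simp
    show "AE z in lborel. norm (X k z) \<le> \<bar>B\<bar> * indicator K' z" for k using bound by simp
  qed
  moreover have "(\<integral>z. X k z \<partial>lborel) = 0" for k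
    unfolding X_def using shift[of "e k *\<^sub>R b"] intP by simp
  ultimately show ?thesis by (simp add: LIMSEQ_const_iff)
qed

lemma partial_outside_support:
  assumes "closed K" "\<And>z. z \<notin> K \<Longrightarrow> \<phi> z = 0" "x \<notin> K"
  shows "partial \<phi> b x = 0" "(\<phi> has_derivative (\<lambda>_. 0)) (at x)"
proof -
  show d: "(\<phi> has_derivative (\<lambda>_. 0)) (at x)"
    by (rule has_derivative_transform_within_open[of "\<lambda>_. 0" _ _ UNIV "- K"])
       (use assms in auto)
  then show "partial \<phi> b x = 0" using partial_eqI by fastforce
qed

lemma C1_continuous: "C1 g \<Longrightarrow> continuous_on UNIV g"
  by (auto simp: C1_def intro!: continuous_at_imp_continuous_on differentiable_imp_continuous_within)

lemma continuous_on_extend_by_zero: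
  fixes g \<phi> :: "'b::euclidean_space \<Rightarrow> real"
  assumes "open U" "continuous_on U g" "continuous_on UNIV \<phi>" "compact K" "K \<subseteq> U"
    "\<And>z. z \<notin> K \<Longrightarrow> \<phi> z = 0"
  shows "continuous_on UNIV (\<lambda>z. g z * \<phi> z)"
proof -
  have 1: "continuous_on U (\<lambda>z. g z * \<phi> z)"
    using assms by (auto intro!: continuous_intros elim: continuous_on_subset)
  have 2: "continuous_on (- K) (\<lambda>z. g z * \<phi> z)"
    using assms(6) by (simp cong: continuous_on_cong_simp)
  have "continuous_on (U \<union> - K) (\<lambda>z. g z * \<phi> z)"
    by (rule continuous_on_open_Un) (use assms 1 2 compact_imp_closed in auto)
  moreover have "U \<union> - K = UNIV" using assms by auto
  ultimately show ?thesis by simp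
qed

text \<open>
  Only the derivative of \<open>g\<close> along \<open>b\<close> enters. For the space-time field below, the time component is
  differentiated in time and the spatial components in space, and no joint differentiability has
  to be proved.
\<close>

lemma weak_integration_by_parts:
  fixes g Dg \<phi> :: "'b::euclidean_space \<Rightarrow> real"
  assumes U: "open U" and \<phi>: "test_function_on U \<phi>" and b: "b \<in> Basis"
    and der: "\<And>z. z \<in> U \<Longrightarrow> ((\<lambda>s. g (z + s *\<^sub>R b)) has_real_derivative Dg z) (at 0)"
    and cont: "continuous_on U g" "continuous_on U Dg"
  shows "integrable lborel (\<lambda>z. g z * partial \<phi> b z)" "integrable lborel (\<lambda>z. Dg z * \<phi> z)"
    "(\<integral>z. g z * partial \<phi> b z \<partial>lborel) = - (\<integral>z. Dg z * \<phi> z \<partial>lborel)"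
proof -
  obtain K where K: "compact K" "K \<subseteq> U" "\<And>z. z \<notin> K \<Longrightarrow> \<phi> z = 0" and C1: "C1 \<phi>"
    using \<phi> unfolding test_function_on_def by blast
  have dK: "\<And>z. z \<notin> K \<Longrightarrow> partial \<phi> b z = 0"
    by (rule partial_outside_support(1)[where \<phi>=\<phi>, OF compact_imp_closed[OF K(1)] K(3)])
  have c\<phi>: "continuous_on UNIV \<phi>" by (rule C1_continuous[OF C1])
  have cd: "continuous_on UNIV (partial \<phi> b)" using C1 b by (simp add: C1_def)
  have c0: "continuous_on UNIV (\<lambda>z. g z * \<phi> z)"
    by (rule continuous_on_extend_by_zero[OF U cont(1) c\<phi> K])
  have c1: "continuous_on UNIV (\<lambda>z. g z * partial \<phi> b z)"
    by (rule continuous_on_extend_by_zero[OF U cont(1) cd K(1,2) dK])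
  have c2: "continuous_on UNIV (\<lambda>z. Dg z * \<phi> z)"
    by (rule continuous_on_extend_by_zero[OF U cont(2) c\<phi> K])
  show i1: "integrable lborel (\<lambda>z. g z * partial \<phi> b z)"
    by (rule integrable_compact_support[OF c1 K(1)]) (use dK in auto)
  show i2: "integrable lborel (\<lambda>z. Dg z * \<phi> z)"
    by (rule integrable_compact_support[OF c2 K(1)]) (use K in auto)
  have "(\<integral>z. g z * partial \<phi> b z + Dg z * \<phi> z \<partial>lborel) = 0"
  proof (rule integral_line_derivative_zero[where P="\<lambda>z. g z * \<phi> z" and b=b and K=K])
    fix z
    show "((\<lambda>s. g (z + s *\<^sub>R b) * \<phi> (z + s *\<^sub>R b)) has_real_derivative
            g z * partial \<phi> b z + Dg z * \<phi> z) (at 0)"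
    proof (cases "z \<in> U")
      case True
      have "((\<lambda>s. \<phi> (z + s *\<^sub>R b)) has_real_derivative partial \<phi> b z) (at 0)"
        using line_derivative[OF has_derivative_partial] C1 by (auto simp: C1_def)
      from DERIV_mult[OF der[OF True] this] show ?thesis by (simp add: algebra_simps)
    next
      case False
      then have "z \<notin> K" using K by auto
      have "open ((\<lambda>s. z + s *\<^sub>R b) -` (- K))"
        using K(1) by (intro open_vimage) (auto intro!: continuous_intros compact_imp_closed)
      then have "((\<lambda>s. g (z + s *\<^sub>R b) * \<phi> (z + s *\<^sub>R b)) has_real_derivative 0) (at 0)"
        using \<open>z \<notin> K\<close> K(3)
        by (intro has_field_derivative_transform_within_open[OF DERIV_const[of 0]]) auto
      then show ?thesis using \<open>z \<notin> K\<close> K dK by simp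
    qed
  qed (use c0 c1 c2 K dK in \<open>auto intro!: continuous_on_add\<close>)
  then show "(\<integral>z. g z * partial \<phi> b z \<partial>lborel) = - (\<integral>z. Dg z * \<phi> z \<partial>lborel)"
    using i1 i2 by simp
qed

section \<open>Derivatives of radial functions\<close>

lemma radial_has_derivative:
  fixes x :: "'a::euclidean_space"
  assumes "x \<noteq> 0" "(q has_real_derivative q') (at (norm x))"
  shows "((\<lambda>z. q (norm z)) has_derivative (\<lambda>v. q' / norm x * (x \<bullet> v))) (at x)"
proof -
  have "((\<lambda>z. q (norm z)) has_derivative (\<lambda>v. q' * (v \<bullet> sgn x))) (at x)"
    using has_derivative_compose[OF has_derivative_norm[OF assms(1)] assms(2)[unfolded has_field_derivative_def]]
    by (simp add: mult.commute inner_commute)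
  then show ?thesis by (simp add: sgn_div_norm inner_commute divide_inverse mult_ac)
qed

lemma norm_filterlim_at_0: "filterlim norm (at 0 within {0..}) (at (0::'a::euclidean_space))"
  unfolding filterlim_at
  by (auto intro!: tendsto_eq_intros simp: eventually_at_filter)

lemma norm_filterlim_at_right: "filterlim norm (at_right 0) (at (0::'a::euclidean_space))"
  unfolding filterlim_at
  by (auto intro!: tendsto_eq_intros simp: eventually_at_filter)

lemma radial_has_derivative_0:
  assumes "(q has_real_derivative 0) (at 0 within {0..})"
  shows "((\<lambda>z::'a::euclidean_space. q (norm z)) has_derivative (\<lambda>_. 0)) (at 0)"
proof -
  have "((\<lambda>y. (q y - q 0) / y) \<longlongrightarrow> 0) (at 0 within {0..})"
    using assms by (simp add: has_field_derivative_iff)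
  from filterlim_compose[OF this norm_filterlim_at_0]
  have "((\<lambda>z::'a. (q (norm z) - q 0) / norm z) \<longlongrightarrow> 0) (at 0)" .
  then have "((\<lambda>z::'a. norm ((q (norm z) - q 0) / norm z)) \<longlongrightarrow> 0) (at 0)"
    by (rule tendsto_norm_zero)
  then show ?thesis by (simp add: has_derivative_at)
qed

text \<open>
  The gradient of a radial function and the radial flux are both of the form \<open>h(|z|) z\<close>.
\<close>

lemma radial_component_has_derivative:
  fixes x :: "'a::euclidean_space"
  assumes "x \<noteq> 0" "(h has_real_derivative h') (at (norm x))"
  shows "((\<lambda>z. h (norm z) * (z \<bullet> b)) has_derivative
     (\<lambda>v. h' / norm x * (x \<bullet> v) * (x \<bullet> b) + h (norm x) * (v \<bullet> b))) (at x)"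
  by (rule derivative_eq_intros radial_has_derivative[OF assms] | force)+

text \<open>
  At the origin a limit of \<open>h\<close> is enough, because the factor \<open>z \<bullet> b\<close> already vanishes to first order.
\<close>

lemma radial_component_has_derivative_0:
  assumes "(h \<longlongrightarrow> h0) (at_right 0)"
  shows "((\<lambda>z::'a::euclidean_space. h (norm z) * (z \<bullet> b)) has_derivative (\<lambda>v. h0 * (v \<bullet> b))) (at 0)"
proof -
  have "((\<lambda>z::'a. h (norm z) - h0) \<longlongrightarrow> 0) (at 0)"
    by (rule LIM_zero[OF filterlim_compose[OF assms norm_filterlim_at_right]])
  from tendsto_mult_left_zero[OF tendsto_norm_zero[OF this], of "norm b"]
  have "((\<lambda>z::'a. norm (h (norm z) - h0) * norm b) \<longlongrightarrow> 0) (at 0)" .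
  then have "((\<lambda>z::'a. norm (h (norm z) * (z \<bullet> b) - h (norm 0) * (0 \<bullet> b) - h0 * (z \<bullet> b)) / norm z) \<longlongrightarrow> 0) (at 0)"
  proof (rule Lim_null_comparison[rotated], intro always_eventually allI)
    fix z :: 'a
    have "\<bar>h (norm z) - h0\<bar> * \<bar>z \<bullet> b\<bar> \<le> \<bar>h (norm z) - h0\<bar> * (norm z * norm b)"
      by (intro mult_left_mono Cauchy_Schwarz_ineq2) auto
    moreover have "h (norm z) * (z \<bullet> b) - h0 * (z \<bullet> b) = (h (norm z) - h0) * (z \<bullet> b)"
      by (simp add: algebra_simps)
    ultimately show "norm (norm (h (norm z) * (z \<bullet> b) - h (norm 0) * (0 \<bullet> b) - h0 * (z \<bullet> b)) / norm z)
        \<le> norm (h (norm z) - h0) * norm b"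
      by (cases "z = 0") (auto simp: abs_mult divide_simps mult_ac)
  qed
  moreover have "bounded_linear (\<lambda>v::'a. h0 * (v \<bullet> b))"
    by (intro bounded_linear_intros)
  ultimately show ?thesis by (simp add: has_derivative_at)
qed

lemma sum_Basis_square: "(\<Sum>b\<in>Basis. (x \<bullet> b)\<^sup>2) = (norm (x::'a::euclidean_space))\<^sup>2"
  unfolding power2_norm_eq_inner by (subst (2) euclidean_inner) (simp add: power2_eq_square)

lemma continuous_on_radial_component:
  fixes S :: "'a::euclidean_space set"
  assumes S: "open S" and h: "\<And>x. x \<in> S \<Longrightarrow> x \<noteq> 0 \<Longrightarrow> isCont h (norm x)"
    and 0: "0 \<in> S \<Longrightarrow> ((\<lambda>y. y * h y) \<longlongrightarrow> 0) (at_right 0)"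
  shows "continuous_on S (\<lambda>x. h (norm x) *\<^sub>R x)"
proof (rule continuous_at_imp_continuous_on, rule ballI)
  fix x assume x: "x \<in> S"
  show "isCont (\<lambda>x. h (norm x) *\<^sub>R x) x"
  proof (cases "x = 0")
    case False
    have "isCont (\<lambda>x. h (norm x)) x"
      by (rule isCont_o2[where f=norm and g=h, OF _ h[OF x False]]) (auto intro!: continuous_intros)
    then show ?thesis by (intro continuous_intros)
  next
    case True
    have "((\<lambda>z::'a. norm z * h (norm z)) \<longlongrightarrow> 0) (at 0)"
      using filterlim_compose[OF 0 norm_filterlim_at_right] x True by simp
    then have "((\<lambda>z::'a. norm (norm z * h (norm z))) \<longlongrightarrow> 0) (at 0)"
      by (rule tendsto_norm_zero)
    then have "((\<lambda>z::'a. h (norm z) *\<^sub>R z) \<longlongrightarrow> 0) (at 0)"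
      by (intro tendsto_norm_zero_cancel[of "\<lambda>z::'a. h (norm z) *\<^sub>R z"]) (simp add: abs_mult mult.commute)
    then show ?thesis by (simp add: True isCont_def)
  qed
qed

section \<open>The profile of a self-similar solution\<close>

lemma at_within_nonneg: "0 < (y::real) \<Longrightarrow> at y within {0..} = at y"
  by (rule at_within_interior) simp

lemma hderiv_eqI:
  assumes "0 \<le> y" "(q has_real_derivative D) (at y within {0..})"
  shows "hderiv q y = D"
  unfolding hderiv_def
proof (rule vector_derivative_within)
  show "at y within {0..} \<noteq> bot"
    using assms(1) by (cases "y = 0") (auto simp: at_within_nonneg at_within_Ici_at_right)
  show "(q has_vector_derivative D) (at y within {0..})"
    using assms(2) by (simp add: has_real_derivative_iff_has_vector_derivative)
qed

lemma has_hderiv: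
  assumes "0 \<le> y" "q differentiable (at y within {0..})"
  shows "(q has_real_derivative hderiv q y) (at y within {0..})"
proof -
  obtain D where "(q has_real_derivative D) (at y within {0..})"
    using assms(2) by (auto simp: real_differentiable_def)
  then show ?thesis using hderiv_eqI[OF assms(1)] by simp
qed

lemma has_hderiv_at:
  "0 < y \<Longrightarrow> q differentiable at y \<Longrightarrow> (q has_real_derivative hderiv q y) (at y)"
  using has_hderiv[of y q] by (simp add: at_within_nonneg)

text \<open>
  The eigenfunction conditions with the flux representative \<open>J\<close> and the radius \<open>\<delta>\<close> of smoothness fixed.
\<close>

locale focusing_profile =
  fixes N :: nat and n \<alpha> \<beta> :: real and f J :: "real \<Rightarrow> real" and \<delta> :: real
  assumes N: "2 \<le> N" and n: "0 < n" and \<alpha>: "0 < \<alpha>" and \<beta>_def: "\<beta> = (1 + \<alpha> * n) / 4"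
    and f_diff: "f differentiable_on {0..}" and f1_cont: "continuous_on {0..} (hderiv f)"
    and \<delta>: "0 < \<delta>"
    and f1_diff_0: "\<And>y. 0 \<le> y \<Longrightarrow> y < \<delta> \<Longrightarrow> hderiv f differentiable (at y within {0..})"
    and f2_diff_0: "\<And>y. 0 \<le> y \<Longrightarrow> y < \<delta> \<Longrightarrow> hderiv (hderiv f) differentiable (at y within {0..})"
    and f3_cont: "continuous_on {0..<\<delta>} (hderiv (hderiv (hderiv f)))"
    and f1_0: "hderiv f 0 = 0" and f3_0: "hderiv (hderiv (hderiv f)) 0 = 0"
    and f1_diff: "\<And>y. 0 < y \<Longrightarrow> f y \<noteq> 0 \<Longrightarrow> hderiv f differentiable at y"
    and L_diff: "\<And>y. 0 < y \<Longrightarrow> f y \<noteq> 0 \<Longrightarrow> radial_laplacian N f differentiable at y"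
    and J_flux: "\<And>y. 0 < y \<Longrightarrow> f y \<noteq> 0 \<Longrightarrow>
        J y = y ^ (N - 1) * \<bar>f y\<bar> powr n * hderiv (radial_laplacian N f) y"
    and J_null: "negligible {y. 0 < y \<and> f y = 0 \<and> J y \<noteq> 0}"
    and J_diff: "\<And>y. 0 < y \<Longrightarrow> J differentiable at y"
    and J_ode: "\<And>y. 0 < y \<Longrightarrow>
        - (1 / y ^ (N - 1)) * hderiv J y - \<beta> * y * hderiv f y + \<alpha> * f y = 0"
begin

abbreviation "f1 \<equiv> hderiv f"
abbreviation "f2 \<equiv> hderiv f1"
abbreviation "f3 \<equiv> hderiv f2"
abbreviation "L \<equiv> radial_laplacian N f"

definition g where "g y = \<alpha> * f y - \<beta> * y * f1 y"
definition H where "H y = J y / y ^ N"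

lemma \<beta>: "0 < \<beta>"
proof -
  have "0 < \<alpha> * n" using n \<alpha> by simp
  then show ?thesis by (simp add: \<beta>_def)
qed

lemma f_der: "0 \<le> y \<Longrightarrow> (f has_real_derivative f1 y) (at y within {0..})"
  using f_diff by (intro has_hderiv) (auto simp: differentiable_on_def)

lemma f_der_at: "0 < y \<Longrightarrow> (f has_real_derivative f1 y) (at y)"
  using f_der[of y] by (simp add: at_within_nonneg)

lemma f_cont: "continuous_on {0..} f"
  using f_diff by (rule differentiable_imp_continuous_on)

lemma f_der0: "(f has_real_derivative 0) (at 0 within {0..})"
  using f_der[of 0] f1_0 by simp

lemma f1_der_0: "0 \<le> y \<Longrightarrow> y < \<delta> \<Longrightarrow> (f1 has_real_derivative f2 y) (at y within {0..})"
  using has_hderiv f1_diff_0 by blast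

lemma f2_der_0: "0 \<le> y \<Longrightarrow> y < \<delta> \<Longrightarrow> (f2 has_real_derivative f3 y) (at y within {0..})"
  using has_hderiv f2_diff_0 by blast

lemma isCont_f: "0 < y \<Longrightarrow> isCont f y"
  using f_der_at DERIV_isCont by blast

lemma isCont_f1: "0 < y \<Longrightarrow> isCont f1 y"
  using f1_cont[unfolded continuous_on_eq_continuous_within, rule_format, of y]
  by (simp add: at_within_nonneg)

lemma isCont_J: "0 < y \<Longrightarrow> isCont J y"
  using J_diff has_hderiv_at DERIV_isCont by blast

lemma f1_over_y: "((\<lambda>y. f1 y / y) \<longlongrightarrow> f2 0) (at_right 0)"
  using f1_der_0[of 0] \<delta> f1_0 by (simp add: has_field_derivative_iff at_within_Ici_at_right)

lemma f2_tendsto: "(f2 \<longlongrightarrow> f2 0) (at_right 0)"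
  using f2_der_0[of 0] \<delta> DERIV_continuous[of f2 "f3 0" 0 "{0..}"]
  by (auto simp: continuous_within at_within_Ici_at_right)

lemma f1_tendsto: "(f1 \<longlongrightarrow> 0) (at_right 0)"
  using f1_cont f1_0 by (force simp: continuous_on_def at_within_Ici_at_right)

lemma f_tendsto: "(f \<longlongrightarrow> f 0) (at_right 0)"
  using f_cont by (force simp: continuous_on_def at_within_Ici_at_right)

text \<open>
  Stated pointwise, since \<open>f''\<close> may fail to exist at the zeros of \<open>f\<close>.
\<close>

lemma L_eq:
  assumes "0 < y" "(f1 has_real_derivative f2 y) (at y)"
  shows "L y = f2 y + (real N - 1) * (f1 y / y)"
proof -
  obtain m where m: "N = Suc (Suc m)" using N by (metis add_2_eq_Suc le_Suc_ex)
  have "((\<lambda>s. s ^ (N - 1) * f1 s) has_real_derivative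
      real (Suc m) * y ^ m * f1 y + y ^ Suc m * f2 y) (at y within {0..})"
    unfolding at_within_nonneg[OF assms(1)]
    by (rule derivative_eq_intros assms(2) refl)+ (simp add: m)
  from hderiv_eqI[OF _ this] assms(1) show ?thesis
    unfolding radial_laplacian_def by (simp add: m field_simps)
qed

lemma L_eq_0: "0 < y \<Longrightarrow> y < \<delta> \<Longrightarrow> L y = f2 y + (real N - 1) * (f1 y / y)"
  using f1_der_0[of y] by (intro L_eq) (auto simp: at_within_nonneg)

lemma L_eq_nz: "0 < y \<Longrightarrow> f y \<noteq> 0 \<Longrightarrow> L y = f2 y + (real N - 1) * (f1 y / y)"
  using f1_diff by (intro L_eq has_hderiv_at) auto

lemma L_der_0:
  assumes "0 < y" "y < \<delta>"
  shows "(L has_real_derivative f3 y + (real N - 1) * ((y * f2 y - f1 y) / y\<^sup>2)) (at y)"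
proof (rule has_field_derivative_transform_within_open)
  have "(f1 has_real_derivative f2 y) (at y)" "(f2 has_real_derivative f3 y) (at y)"
    using f1_der_0[of y] f2_der_0[of y] assms by (auto simp: at_within_nonneg)
  then show "((\<lambda>y. f2 y + (real N - 1) * (f1 y / y)) has_real_derivative
      f3 y + (real N - 1) * ((y * f2 y - f1 y) / y\<^sup>2)) (at y)"
    using assms by (auto intro!: derivative_eq_intros simp: power2_eq_square field_simps)
  show "open {0<..<\<delta>}" "y \<in> {0<..<\<delta>}" using assms by auto
qed (use L_eq_0 in auto)

text \<open>
  The singular part of \<open>(\<Delta>f)' = f''' + (N-1) (y f'' - f') / y\<^sup>2\<close> is controlled by \<open>f'''\<close> alone:
  \<open>(y f'' - f')' = y f'''\<close>, so the mean value theorem bounds it by the supremum of \<open>|f'''|\<close> near the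
  origin, which is small because \<open>f'''(0) = 0\<close>.
\<close>

lemma L'_small:
  assumes "0 < e"
  obtains d where "0 < d" "d \<le> \<delta>"
    "\<And>y. 0 < y \<Longrightarrow> y < d \<Longrightarrow> \<bar>hderiv L y\<bar> \<le> real N * e"
proof -
  have "\<exists>d>0. \<forall>y\<in>{0..<\<delta>}. \<bar>y - 0\<bar> < d \<longrightarrow> \<bar>f3 y - f3 0\<bar> < e"
    using f3_cont[unfolded continuous_on_iff, rule_format, of 0 e] \<delta> assms by (auto simp: dist_real_def)
  then obtain d0 where d0: "0 < d0" "\<And>y. 0 \<le> y \<Longrightarrow> y < \<delta> \<Longrightarrow> y < d0 \<Longrightarrow> \<bar>f3 y\<bar> \<le> e"
    using f3_0 by force
  define d where "d = min d0 \<delta>"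
  have r: "\<bar>y * f2 y - f1 y\<bar> \<le> e * y\<^sup>2" if y: "0 < y" "y < d" for y
  proof -
    have "\<exists>z\<in>{0<..<y}. (y * f2 y - f1 y) - (0 * f2 0 - f1 0) = (z * f3 z) * (y - 0)"
    proof (rule mvt_simple[OF y(1)])
      fix z assume z: "0 \<le> z" "z \<le> y"
      then have z': "0 \<le> z" "z < \<delta>" using y by (auto simp: d_def)
      have "((\<lambda>z. z * f2 z - f1 z) has_real_derivative z * f3 z) (at z within {0..})"
        by (rule derivative_eq_intros f1_der_0 f2_der_0 z' refl)+ (simp add: algebra_simps)
      then have "((\<lambda>z. z * f2 z - f1 z) has_real_derivative z * f3 z) (at z within {0..y})"
        by (rule DERIV_subset) auto
      then show "((\<lambda>z. z * f2 z - f1 z) has_derivative (*) (z * f3 z)) (at z within {0..y})"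
        by (simp add: has_field_derivative_def)
    qed
    then obtain z where z: "0 < z" "z < y" "y * f2 y - f1 y = y * (z * f3 z)"
      using f1_0 by (auto simp: mult_ac)
    have "\<bar>z * f3 z\<bar> \<le> y * e"
      unfolding abs_mult using z y d0(2)[of z] by (intro mult_mono) (auto simp: d_def)
    then have "y * \<bar>z * f3 z\<bar> \<le> y * (y * e)" using y by (intro mult_left_mono) auto
    then show ?thesis using z y by (simp add: abs_mult power2_eq_square mult_ac)
  qed
  show ?thesis
  proof
    show "0 < d" "d \<le> \<delta>" using d0 \<delta> by (auto simp: d_def)
    fix y assume y: "0 < y" "y < d"
    have "hderiv L y = f3 y + (real N - 1) * ((y * f2 y - f1 y) / y\<^sup>2)"
      using y L_der_0[of y] by (intro hderiv_eqI) (auto simp: d_def at_within_nonneg)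
    also have "\<bar>\<dots>\<bar> \<le> e + (real N - 1) * e"
    proof (rule order_trans[OF abs_triangle_ineq add_mono])
      show "\<bar>f3 y\<bar> \<le> e" using d0(2)[of y] y by (auto simp: d_def)
      have "\<bar>(y * f2 y - f1 y) / y\<^sup>2\<bar> \<le> e" using r[OF y] y by (simp add: abs_divide field_simps)
      then show "\<bar>(real N - 1) * ((y * f2 y - f1 y) / y\<^sup>2)\<bar> \<le> (real N - 1) * e"
        unfolding abs_mult using N by (intro mult_mono) auto
    qed
    finally show "\<bar>hderiv L y\<bar> \<le> real N * e" by (simp add: algebra_simps)
  qed
qed

lemma L'_tendsto: "(hderiv L \<longlongrightarrow> 0) (at_right 0)"
proof (rule tendstoI)
  fix e :: real assume "0 < e"
  then have "0 < e / (2 * real N)" using N by simp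
  then obtain d where "0 < d" and *: "\<And>y. 0 < y \<Longrightarrow> y < d \<Longrightarrow> \<bar>hderiv L y\<bar> \<le> real N * (e / (2 * real N))"
    using L'_small by metis
  have "dist (hderiv L y) 0 < e" if "0 < y" "y < d" for y
    using *[OF that] N \<open>0 < e\<close> by simp
  then show "\<forall>\<^sub>F y in at_right 0. dist (hderiv L y) 0 < e"
    using \<open>0 < d\<close> by (auto simp: eventually_at_right_field)
qed

lemma L_tendsto: "(L \<longlongrightarrow> real N * f2 0) (at_right 0)"
proof -
  have "((\<lambda>y. f2 y + (real N - 1) * (f1 y / y)) \<longlongrightarrow> f2 0 + (real N - 1) * f2 0) (at_right 0)"
    by (intro tendsto_intros f2_tendsto f1_over_y)
  then have "((\<lambda>y. f2 y + (real N - 1) * (f1 y / y)) \<longlongrightarrow> real N * f2 0) (at_right 0)"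
    by (simp add: algebra_simps)
  then show ?thesis
    by (rule Lim_transform_eventually)
       (use L_eq_0 \<delta> in \<open>auto simp: eventually_at_right_field\<close>)
qed

lemma L_mvt:
  assumes "0 < s" "s < y" "y < d" "d \<le> \<delta>" "\<And>y. 0 < y \<Longrightarrow> y < d \<Longrightarrow> \<bar>hderiv L y\<bar> \<le> e"
  shows "\<bar>L y - L s\<bar> \<le> y * e"
proof -
  have "\<exists>z. s < z \<and> z < y \<and> L y - L s = (y - s) * hderiv L z"
  proof (rule MVT2[OF assms(2)])
    fix z assume "s \<le> z" "z \<le> y"
    then have z: "0 < z" "z < \<delta>" using assms by auto
    have "L differentiable at z" using L_der_0[OF z] real_differentiable_def by blast
    then show "(L has_real_derivative hderiv L z) (at z)" by (rule has_hderiv_at[OF z(1)])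
  qed
  then obtain z where z: "s < z" "z < y" "L y - L s = (y - s) * hderiv L z" by blast
  show ?thesis unfolding z(3) abs_mult
    using assms(5)[of z] assms(1-3) z by (intro mult_mono) auto
qed

text \<open>
  The extension by \<open>N f''(0)\<close> is the value of the Laplacian of \<open>f(|x|)\<close> at the origin. Its derivative
  zero makes that Laplacian differentiable there as a function on \<open>\<real>\<^sup>N\<close>.
\<close>

lemma L_der_origin:
  "((\<lambda>y. if y = 0 then real N * f2 0 else L y) has_real_derivative 0) (at 0 within {0..})"
proof -
  have "((\<lambda>y. (L y - real N * f2 0) / y) \<longlongrightarrow> 0) (at_right 0)"
  proof (rule tendstoI)
    fix e :: real assume "0 < e"
    then have "0 < e / (2 * real N)" using N by simp
    then obtain d where d: "0 < d" "d \<le> \<delta>"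
      and *: "\<And>y. 0 < y \<Longrightarrow> y < d \<Longrightarrow> \<bar>hderiv L y\<bar> \<le> real N * (e / (2 * real N))"
      using L'_small by metis
    have "dist ((L y - real N * f2 0) / y) 0 < e" if y: "0 < y" "y < d" for y
    proof -
      have "\<bar>L y - real N * f2 0\<bar> \<le> y * (e / 2)"
      proof (rule tendsto_upperbound)
        show "((\<lambda>s. \<bar>L y - L s\<bar>) \<longlongrightarrow> \<bar>L y - real N * f2 0\<bar>) (at_right 0)"
          by (intro tendsto_intros L_tendsto)
        have "\<bar>L y - L s\<bar> \<le> y * (e / 2)" if "0 < s" "s < y" for s
          using L_mvt[OF that y(2) d(2), of "e / 2"] * N by simp
        then show "\<forall>\<^sub>F s in at_right 0. \<bar>L y - L s\<bar> \<le> y * (e / 2)"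
          using y by (auto simp: eventually_at_right_field)
      qed simp
      then have "\<bar>(L y - real N * f2 0) / y\<bar> \<le> e / 2" using y by (simp add: abs_divide field_simps)
      then have "\<bar>(L y - real N * f2 0) / y\<bar> < e" by (rule le_less_trans) (use \<open>0 < e\<close> in simp)
      then show ?thesis using \<open>0 < e\<close> by simp
    qed
    then show "\<forall>\<^sub>F y in at_right 0. dist ((L y - real N * f2 0) / y) 0 < e"
      using \<open>0 < d\<close> by (auto simp: eventually_at_right_field)
  qed
  then have "((\<lambda>y. ((if y = 0 then real N * f2 0 else L y) - real N * f2 0) / y) \<longlongrightarrow> 0) (at_right 0)"
    by (rule Lim_transform_eventually) (auto simp: eventually_at_filter)
  then show ?thesis by (simp add: has_field_derivative_iff at_within_Ici_at_right)
qed

text \<open>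
  The flux formula controls \<open>J\<close> only where \<open>f \<noteq> 0\<close>. The bound extends to the zeros of \<open>f\<close>, since a
  violation would persist on an open interval contained in the null set \<open>{f = 0, J \<noteq> 0}\<close>.
\<close>

lemma J_bound:
  assumes "0 < y" "y < d" "\<And>y. 0 < y \<Longrightarrow> y < d \<Longrightarrow> f y \<noteq> 0 \<Longrightarrow> \<bar>J y\<bar> \<le> c" "0 \<le> c"
  shows "\<bar>J y\<bar> \<le> c"
proof (rule ccontr)
  assume *: "\<not> \<bar>J y\<bar> \<le> c"
  have "isCont (\<lambda>y. \<bar>J y\<bar>) y" using isCont_J[OF assms(1)] by (intro continuous_intros)
  moreover have "open {c<..}" "\<bar>J y\<bar> \<in> {c<..}" using * by auto
  ultimately obtain A where A: "open A" "y \<in> A" "\<And>z. z \<in> A \<Longrightarrow> \<bar>J z\<bar> \<in> {c<..}"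
    unfolding continuous_at_open by metis
  \<comment> \<open>On this open set the bound fails, so \<open>f\<close> must vanish on it.\<close>
  have "A \<inter> {0<..<d} \<subseteq> {y. 0 < y \<and> f y = 0 \<and> J y \<noteq> 0}"
    using A(3) assms(3,4) by force
  then have "negligible (A \<inter> {0<..<d})" using J_null negligible_subset by blast
  moreover have "open (A \<inter> {0<..<d})" "A \<inter> {0<..<d} \<noteq> {}" using A assms by auto
  ultimately show False using open_not_negligible by blast
qed

text \<open>
  The flux through small spheres vanishes: the equation has no source at the origin.
\<close>

lemma J_tendsto: "(J \<longlongrightarrow> 0) (at_right 0)"
proof (rule tendstoI)
  fix e :: real assume "0 < e"
  have "((\<lambda>y. y ^ (N - 1) * (\<bar>f y\<bar> powr n * \<bar>hderiv L y\<bar>)) \<longlongrightarrow> 0 ^ (N - 1) * (\<bar>f 0\<bar> powr n * \<bar>0\<bar>)) (at_right 0)"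
    using n by (intro tendsto_intros f_tendsto L'_tendsto tendsto_powr') auto
  then have "\<forall>\<^sub>F y in at_right 0. y ^ (N - 1) * (\<bar>f y\<bar> powr n * \<bar>hderiv L y\<bar>) < e / 2"
    using \<open>0 < e\<close> N by (intro order_tendstoD(2)) auto
  then obtain d where d: "0 < d" "\<And>y. 0 < y \<Longrightarrow> y < d \<Longrightarrow> y ^ (N - 1) * (\<bar>f y\<bar> powr n * \<bar>hderiv L y\<bar>) < e / 2"
    by (auto simp: eventually_at_right_field)
  have "\<bar>J y\<bar> \<le> e / 2" if "0 < y" "y < d" for y
    by (rule J_bound[OF that]) (use d J_flux \<open>0 < e\<close> in \<open>auto simp: abs_mult mult.assoc less_imp_le\<close>)
  then have "dist (J y) 0 < e" if "0 < y" "y < d" for y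
    using that \<open>0 < e\<close> by fastforce
  then show "\<forall>\<^sub>F y in at_right 0. dist (J y) 0 < e"
    using d(1) by (auto simp: eventually_at_right_field)
qed

lemma J_der: "0 < y \<Longrightarrow> (J has_real_derivative y ^ (N - 1) * g y) (at y)"
proof -
  assume y: "0 < y"
  have "hderiv J y = y ^ (N - 1) * g y"
    using J_ode[OF y] y unfolding g_def by (simp add: field_simps)
  then show ?thesis using has_hderiv_at[OF y J_diff[OF y]] by simp
qed

lemma g_tendsto: "(g \<longlongrightarrow> g 0) (at_right 0)"
  unfolding g_def by (auto intro!: tendsto_eq_intros f_tendsto f1_tendsto)

lemma isCont_g: "0 < y \<Longrightarrow> isCont g y"
  unfolding g_def by (intro continuous_intros isCont_f isCont_f1)

text \<open>
  By \<open>J' = y\<^bsup>N-1\<^esup> g\<close> and \<open>J(0+) = 0\<close>, the function \<open>J - g(0) y\<^sup>N / N\<close> is bounded by \<open>o(1) y\<^sup>N\<close>.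
\<close>

lemma H_tendsto: "(H \<longlongrightarrow> g 0 / real N) (at_right 0)"
proof (rule tendstoI)
  fix e :: real assume "0 < e"
  then have "\<forall>\<^sub>F y in at_right 0. dist (g y) (g 0) < e / 2"
    using g_tendsto by (intro tendstoD) auto
  then obtain d where d: "0 < d" "\<And>y. 0 < y \<Longrightarrow> y < d \<Longrightarrow> \<bar>g y - g 0\<bar> < e / 2"
    by (auto simp: eventually_at_right_field dist_real_def)
  define \<psi> where "\<psi> y = J y - g 0 / real N * y ^ N" for y
  have \<psi>_der: "(\<psi> has_real_derivative y ^ (N - 1) * (g y - g 0)) (at y)" if "0 < y" for y
    unfolding \<psi>_def by (rule derivative_eq_intros J_der that refl)+ (use N in \<open>simp add: field_simps\<close>)
  have "0 ^ N = (0::real)" using N by simp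
  then have \<psi>_lim: "(\<psi> \<longlongrightarrow> 0) (at_right 0)"
    unfolding \<psi>_def by (auto intro!: tendsto_eq_intros J_tendsto)
  have "dist (H y) (g 0 / real N) < e" if y: "0 < y" "y < d" for y
  proof -
    have "\<bar>\<psi> y - 0\<bar> \<le> y ^ N * (e / 2)"
    proof (rule tendsto_upperbound)
      show "((\<lambda>s. \<bar>\<psi> y - \<psi> s\<bar>) \<longlongrightarrow> \<bar>\<psi> y - 0\<bar>) (at_right 0)"
        by (intro tendsto_intros \<psi>_lim)
      have "\<bar>\<psi> y - \<psi> s\<bar> \<le> y ^ N * (e / 2)" if s: "0 < s" "s < y" for s
      proof -
        have "\<exists>z. s < z \<and> z < y \<and> \<psi> y - \<psi> s = (y - s) * (z ^ (N - 1) * (g z - g 0))"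
          using s \<psi>_der by (intro MVT2) auto
        then obtain z where z: "s < z" "z < y" "\<psi> y - \<psi> s = (y - s) * (z ^ (N - 1) * (g z - g 0))" by blast
        have "\<bar>\<psi> y - \<psi> s\<bar> \<le> y * (y ^ (N - 1) * (e / 2))"
          unfolding z(3) abs_mult power_abs using d(2)[of z] s z y
          by (intro mult_mono power_mono) auto
        then show ?thesis using N by (simp add: power_eq_if)
      qed
      then show "\<forall>\<^sub>F s in at_right 0. \<bar>\<psi> y - \<psi> s\<bar> \<le> y ^ N * (e / 2)"
        using y by (auto simp: eventually_at_right_field)
    qed simp
    moreover have "H y - g 0 / real N = \<psi> y / y ^ N"
      using y by (simp add: H_def \<psi>_def diff_divide_distrib)
    ultimately have "\<bar>H y - g 0 / real N\<bar> \<le> e / 2"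
      using y by (simp add: abs_divide pos_divide_le_eq mult.commute)
    then show ?thesis using \<open>0 < e\<close> by (simp add: dist_real_def)
  qed
  then show "\<forall>\<^sub>F y in at_right 0. dist (H y) (g 0 / real N) < e"
    using d(1) by (auto simp: eventually_at_right_field)
qed

lemma H_der:
  assumes y: "0 < y"
  shows "(H has_real_derivative (g y - real N * H y) / y) (at y)"
proof -
  obtain m where m: "N = Suc m" using N by (cases N) auto
  show ?thesis unfolding H_def
    by (rule derivative_eq_intros J_der y refl)+ (use y in \<open>auto simp: m field_simps\<close>)
qed

lemma isCont_H: "0 < y \<Longrightarrow> isCont H y"
  using H_der DERIV_isCont by blast

text \<open>
  This expression is \<open>y H'(y)\<close>; its limit makes the derivatives of \<open>H(|z|) z\<close> continuous at the origin.
\<close>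

lemma H'_tendsto: "((\<lambda>y. g y - real N * H y) \<longlongrightarrow> 0) (at_right 0)"
proof -
  have "((\<lambda>y. g y - real N * H y) \<longlongrightarrow> g 0 - real N * (g 0 / real N)) (at_right 0)"
    by (intro tendsto_intros g_tendsto H_tendsto)
  then show ?thesis using N by simp
qed

text \<open>
  The continuity comes from the flux: it is differentiable, and where \<open>f \<noteq> 0\<close> it can be divided by
  \<open>y\<^bsup>N-1\<^esup> |f|\<^sup>n\<close>.
\<close>

lemma isCont_L':
  assumes y: "0 < y" "f y \<noteq> 0"
  shows "isCont (hderiv L) y"
proof -
  have "isCont (\<lambda>y. J y / (y ^ (N - 1) * \<bar>f y\<bar> powr n)) y"
    using y by (intro continuous_intros isCont_J isCont_f) auto
  moreover have "open {y. 0 < y \<and> f y \<noteq> 0}"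
  proof -
    have "continuous_on {0<..} f" using f_cont by (rule continuous_on_subset) auto
    then have "open ({0<..} \<inter> f -` (- {0}))"
      by (intro continuous_open_preimage) auto
    then show ?thesis by (simp add: vimage_def Int_def)
  qed
  then have "\<forall>\<^sub>F z in nhds y. z \<in> {y. 0 < y \<and> f y \<noteq> 0}"
    using y by (intro eventually_nhds_in_open) auto
  then have "\<forall>\<^sub>F z in nhds y. J z / (z ^ (N - 1) * \<bar>f z\<bar> powr n) = hderiv L z"
    by eventually_elim (auto simp: J_flux)
  ultimately show ?thesis by (simp add: isCont_cong)
qed

end

section \<open>Spatial derivatives of the radial profile\<close>

lemma scale_has_derivative:
  fixes x :: "'a::euclidean_space" and G :: "'a \<Rightarrow> real"
  assumes "(G has_derivative G') (at (k *\<^sub>R x))"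
  shows "((\<lambda>z. c * G (k *\<^sub>R z)) has_derivative (\<lambda>v. c * k * G' v)) (at x)"
proof -
  have "((\<lambda>z. G (k *\<^sub>R z)) has_derivative (\<lambda>v. G' (k *\<^sub>R v))) (at x)"
    by (rule has_derivative_compose[where f="\<lambda>z. k *\<^sub>R z" and g=G])
       (use assms in \<open>auto intro!: derivative_eq_intros\<close>)
  then have "((\<lambda>z. c * G (k *\<^sub>R z)) has_derivative (\<lambda>v. c * G' (k *\<^sub>R v))) (at x)"
    by (rule has_derivative_mult_right)
  then show ?thesis using linear_scale[OF has_derivative_linear[OF assms]] by (simp add: mult_ac)
qed

lemma partial_scale:
  fixes x :: "'a::euclidean_space" and G :: "'a \<Rightarrow> real"
  assumes "G differentiable at (k *\<^sub>R x)"
  shows "partial (\<lambda>z. c * G (k *\<^sub>R z)) b x = c * k * partial G b (k *\<^sub>R x)"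
    "(\<lambda>z. c * G (k *\<^sub>R z)) differentiable at x"
  using scale_has_derivative[OF has_derivative_partial[OF assms], of c]
  by (auto intro!: partial_eqI simp: differentiable_def)

lemma has_derivative_transform_open:
  assumes "(p has_derivative p') (at x)" "open S" "x \<in> S" "\<And>z. z \<in> S \<Longrightarrow> q z = p z"
  shows "(q has_derivative p') (at x)"
  by (rule has_derivative_transform_within_open[OF assms(1-3)]) (simp add: assms(4))

lemma grad_radial:
  fixes x :: "'a::euclidean_space"
  assumes "(G has_derivative (\<lambda>v. c * (x \<bullet> v))) (at x)"
  shows "grad G x = c *\<^sub>R x"
proof -
  have "grad G x = c *\<^sub>R (\<Sum>b\<in>Basis. (x \<bullet> b) *\<^sub>R b)"
    unfolding grad_def by (simp add: partial_eqI[OF assms] scaleR_sum_right)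
  then show ?thesis by (simp add: euclidean_representation)
qed

context focusing_profile
begin

definition V :: "'a::euclidean_space \<Rightarrow> real" where "V x = f (norm x)"

definition L_ext :: "real \<Rightarrow> real" where "L_ext y = (if y = 0 then real N * f2 0 else L y)"

lemma V_der:
  "(V has_derivative (\<lambda>v. f1 (norm x) / norm x * (x \<bullet> v))) (at (x::'a::euclidean_space))"
proof (cases "x = 0")
  case True
  then show ?thesis unfolding V_def
    using radial_has_derivative_0[OF f_der0, where 'a='a] by simp
next
  case False
  then show ?thesis unfolding V_def by (intro radial_has_derivative f_der_at) auto
qed

lemma V_partial: "partial V b x = f1 (norm x) / norm x * (x \<bullet> b)"
  using V_der by (rule partial_eqI)

lemma V_cont: "continuous_on UNIV (V :: 'a::euclidean_space \<Rightarrow> real)"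
  using V_der by (auto intro!: continuous_at_imp_continuous_on has_derivative_continuous)

lemma f1_radial_cont:
  "continuous_on UNIV (\<lambda>x::'a::euclidean_space. (f1 (norm x) / norm x) *\<^sub>R x)"
proof (rule continuous_on_radial_component[where h="\<lambda>y. f1 y / y"])
  show "isCont (\<lambda>y. f1 y / y) (norm x)" if "x \<noteq> 0" for x :: 'a
    using that by (intro continuous_intros isCont_f1) auto
  show "((\<lambda>y. y * (f1 y / y)) \<longlongrightarrow> 0) (at_right 0)"
    by (rule Lim_transform_eventually[OF f1_tendsto]) (auto simp: eventually_at_filter)
qed simp

lemma V_C1: "C1 (V :: 'a::euclidean_space \<Rightarrow> real)"
proof -
  have "continuous_on UNIV (partial (V :: 'a \<Rightarrow> real) b)" for b
  proof -
    have "partial (V :: 'a \<Rightarrow> real) b = (\<lambda>x. (f1 (norm x) / norm x) *\<^sub>R x \<bullet> b)"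
      by (simp add: V_partial fun_eq_iff)
    then show ?thesis using continuous_on_inner[OF f1_radial_cont continuous_on_const, of b] by simp
  qed
  then show ?thesis using V_der by (auto simp: C1_def differentiable_def)
qed

lemma open_V: "open {x::'a::euclidean_space. V x \<noteq> 0}"
  using V_cont by (intro open_Collect_neq) auto

lemma V_second:
  fixes x :: "'a::euclidean_space"
  assumes "V x \<noteq> 0"
  shows "partial V b differentiable at x"
    "partial (partial V b) b x =
      (if x = 0 then f2 0 * (b \<bullet> b) else (f2 (norm x) - f1 (norm x) / norm x) / (norm x)\<^sup>2 * (x \<bullet> b)\<^sup>2
          + f1 (norm x) / norm x * (b \<bullet> b))"
proof -
  have "\<exists>D. ((\<lambda>x. f1 (norm x) / norm x * (x \<bullet> b)) has_derivative D) (at x) \<and> D b =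
    (if x = 0 then f2 0 * (b \<bullet> b) else (f2 (norm x) - f1 (norm x) / norm x) / (norm x)\<^sup>2 * (x \<bullet> b)\<^sup>2
          + f1 (norm x) / norm x * (b \<bullet> b))"
  proof (cases "x = 0")
    case True
    then show ?thesis using radial_component_has_derivative_0[OF f1_over_y, of b] by auto
  next
    case False
    let ?r = "norm x"
    have "(f1 has_real_derivative f2 ?r) (at ?r)"
      using False assms by (intro has_hderiv_at f1_diff) (auto simp: V_def)
    then have h: "((\<lambda>y. f1 y / y) has_real_derivative (f2 ?r - f1 ?r / ?r) / ?r) (at ?r)"
      using False by (auto intro!: derivative_eq_intros simp: field_simps)
    show ?thesis
      by (rule exI, rule conjI, rule radial_component_has_derivative[OF False h])
         (use False in \<open>simp add: power2_eq_square\<close>)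
  qed
  then obtain D where D: "(partial V b has_derivative D) (at x)" and Db: "D b =
    (if x = 0 then f2 0 * (b \<bullet> b) else (f2 (norm x) - f1 (norm x) / norm x) / (norm x)\<^sup>2 * (x \<bullet> b)\<^sup>2
          + f1 (norm x) / norm x * (b \<bullet> b))"
    by (auto simp: V_partial[abs_def])
  show "partial V b differentiable at x" using D by (auto simp: differentiable_def)
  show "partial (partial V b) b x =
      (if x = 0 then f2 0 * (b \<bullet> b) else (f2 (norm x) - f1 (norm x) / norm x) / (norm x)\<^sup>2 * (x \<bullet> b)\<^sup>2
          + f1 (norm x) / norm x * (b \<bullet> b))"
    using partial_eqI[OF D] Db by simp
qed

lemma V_laplacian:
  fixes x :: "'a::euclidean_space"
  assumes dim: "DIM('a) = N" and "V x \<noteq> 0"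
  shows "laplacian V x = L_ext (norm x)"
proof (cases "x = 0")
  case True
  then show ?thesis using assms by (simp add: laplacian_def V_second L_ext_def mult.commute)
next
  case False
  have "laplacian V x = (f2 (norm x) - f1 (norm x) / norm x) / (norm x)\<^sup>2 * (\<Sum>b\<in>Basis. (x \<bullet> b)\<^sup>2)
      + real N * (f1 (norm x) / norm x)"
    using assms False
    by (simp add: laplacian_def V_second sum.distrib sum_distrib_left)
  also have "\<dots> = f2 (norm x) + (real N - 1) * (f1 (norm x) / norm x)"
    using False by (simp add: sum_Basis_square left_diff_distrib diff_divide_distrib)
  also have "\<dots> = L_ext (norm x)" using False assms(2) L_eq_nz[of "norm x"] by (simp add: L_ext_def V_def)
  finally show ?thesis .
qed

text \<open>
  The quotient by \<open>norm x\<close> is zero at the origin by the convention \<open>c / 0 = 0\<close>, which is the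
  correct value of the derivative there.
\<close>

lemma V_laplacian_der:
  fixes x :: "'a::euclidean_space"
  assumes dim: "DIM('a) = N" and nz: "V x \<noteq> 0"
  shows "(laplacian V has_derivative (\<lambda>v. hderiv L (norm x) / norm x * (x \<bullet> v))) (at x)"
proof (rule has_derivative_transform_open[OF _ open_V])
  show "((\<lambda>x. L_ext (norm x)) has_derivative (\<lambda>v. hderiv L (norm x) / norm x * (x \<bullet> v))) (at x)"
  proof (cases "x = 0")
    case True
    then show ?thesis using radial_has_derivative_0[OF L_der_origin, where 'a='a]
      by (simp add: L_ext_def[abs_def])
  next
    case False
    have "(L has_real_derivative hderiv L (norm x)) (at (norm x))"
      using False nz by (intro has_hderiv_at L_diff) (auto simp: V_def)
    then have "(L_ext has_real_derivative hderiv L (norm x)) (at (norm x))"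
      by (rule has_field_derivative_transform_within_open[where S="{0<..}"])
         (use False in \<open>auto simp: L_ext_def\<close>)
    then show ?thesis using False by (intro radial_has_derivative) auto
  qed
qed (use nz V_laplacian[OF dim] in auto)

lemma L'_radial_cont:
  "continuous_on {x::'a::euclidean_space. V x \<noteq> 0} (\<lambda>x. (hderiv L (norm x) / norm x) *\<^sub>R x)"
proof (rule continuous_on_radial_component[where h="\<lambda>y. hderiv L y / y", OF open_V])
  show "isCont (\<lambda>y. hderiv L y / y) (norm x)" if "x \<in> {x. V x \<noteq> 0}" "x \<noteq> 0" for x :: 'a
    using that by (intro continuous_intros isCont_L') (auto simp: V_def)
  show "((\<lambda>y. y * (hderiv L y / y)) \<longlongrightarrow> 0) (at_right 0)"
    by (rule Lim_transform_eventually[OF L'_tendsto]) (auto simp: eventually_at_filter)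
qed

lemma rescaled_profile_regularity:
  fixes x :: "'a::euclidean_space"
  assumes dim: "DIM('a) = N" and ck: "c \<noteq> 0" "k \<noteq> 0"
  defines "W \<equiv> \<lambda>z::'a. c * V (k *\<^sub>R z)"
  shows "C1 W"
    and "W x \<noteq> 0 \<Longrightarrow> partial W b differentiable at x"
    and "W x \<noteq> 0 \<Longrightarrow> laplacian W differentiable at x"
    and "W x \<noteq> 0 \<Longrightarrow> grad (laplacian W) x =
       (c * k ^ 3) *\<^sub>R ((hderiv L (norm (k *\<^sub>R x)) / norm (k *\<^sub>R x)) *\<^sub>R (k *\<^sub>R x))"
proof -
  have Vd: "V differentiable at z" for z :: 'a using V_der by (auto simp: differentiable_def)
  have pW: "partial W b = (\<lambda>z. (c * k) * partial V b (k *\<^sub>R z))" for b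
    unfolding W_def using partial_scale(1)[OF Vd] by auto
  show "C1 W"
    unfolding C1_def pW using V_C1[where 'a='a] partial_scale(2)[OF Vd]
    by (auto simp: C1_def W_def intro!: continuous_intros elim!: continuous_on_compose2)
  have Vk: "V (k *\<^sub>R z) \<noteq> 0" if "W z \<noteq> 0" for z using that by (simp add: W_def)
  show "W x \<noteq> 0 \<Longrightarrow> partial W b differentiable at x"
    unfolding pW by (rule partial_scale(2)[OF V_second(1)[OF Vk]])
  have oW: "open {z. W z \<noteq> 0}" unfolding W_def
    by (intro open_Collect_neq continuous_intros continuous_on_compose2[OF V_cont]) auto
  have lap: "laplacian W z = (c * k\<^sup>2) * laplacian V (k *\<^sub>R z)" if "W z \<noteq> 0" for z
    unfolding laplacian_def pW using partial_scale(1)[OF V_second(1)[OF Vk[OF that]], of "c * k"]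
    by (simp add: sum_distrib_left power2_eq_square mult_ac)
  have "(laplacian W has_derivative (\<lambda>v. c * k\<^sup>2 * k *
      (hderiv L (norm (k *\<^sub>R x)) / norm (k *\<^sub>R x) * ((k *\<^sub>R x) \<bullet> v)))) (at x)"
    if nz: "W x \<noteq> 0"
    by (rule has_derivative_transform_open[OF
        scale_has_derivative[OF V_laplacian_der[OF dim Vk[OF nz]], of "c * k\<^sup>2"] oW]) (use nz lap in auto)
  then have D: "(laplacian W has_derivative (\<lambda>v. (c * k ^ 3 *
      (hderiv L (norm (k *\<^sub>R x)) / norm (k *\<^sub>R x)) * k) * (x \<bullet> v))) (at x)"
    if nz: "W x \<noteq> 0" using that by (simp add: power3_eq_cube power2_eq_square mult_ac)
  then show "W x \<noteq> 0 \<Longrightarrow> laplacian W differentiable at x"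
    by (auto simp: differentiable_def)
  show "W x \<noteq> 0 \<Longrightarrow> grad (laplacian W) x =
       (c * k ^ 3) *\<^sub>R ((hderiv L (norm (k *\<^sub>R x)) / norm (k *\<^sub>R x)) *\<^sub>R (k *\<^sub>R x))"
    using grad_radial[OF D] by simp
qed

end

section \<open>The self-similar solution as a divergence-free field in space-time\<close>

lemma AE_negligible: "negligible S \<Longrightarrow> AE x in lborel. x \<notin> S"
  using AE_not_in[of S lebesgue] by (simp add: negligible_iff_null_sets AE_completion_iff)

context focusing_profile
begin

definition H_ext :: "real \<Rightarrow> real" where "H_ext r = (if r = 0 then g 0 / real N else H r)"

text \<open>
  The derivative in direction \<open>b\<close> of the component \<open>b\<close> of the field \<open>H(|z|) z\<close>. At \<open>z = 0\<close> the
  first summand is zero by the convention \<open>c / 0 = 0\<close>.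
\<close>

definition dH :: "'a::euclidean_space \<Rightarrow> 'a \<Rightarrow> real" where
  "dH b z = (g (norm z) - real N * H (norm z)) / (norm z)\<^sup>2 * (z \<bullet> b)\<^sup>2 + H_ext (norm z) * (b \<bullet> b)"

lemma dH_line:
  fixes z :: "'a::euclidean_space"
  shows "((\<lambda>s. H (norm (z + s *\<^sub>R b)) * ((z + s *\<^sub>R b) \<bullet> b)) has_real_derivative dH b z) (at 0)"
proof -
  have "\<exists>D. ((\<lambda>z. H (norm z) * (z \<bullet> b)) has_derivative D) (at z) \<and> D b = dH b z"
  proof (cases "z = 0")
    case True
    then show ?thesis using radial_component_has_derivative_0[OF H_tendsto, of b]
      by (intro exI conjI, simp) (simp add: dH_def H_ext_def)
  next
    case False
    then have h: "0 < norm z" by simp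
    show ?thesis
      by (rule exI, rule conjI, rule radial_component_has_derivative[OF False H_der[OF h]])
         (use False in \<open>simp add: dH_def H_ext_def power2_eq_square\<close>)
  qed
  then obtain D where D: "((\<lambda>z. H (norm z) * (z \<bullet> b)) has_derivative D) (at z)" "D b = dH b z"
    by blast
  show ?thesis using line_derivative[OF D(1), of b] D(2) by simp
qed

text \<open>
  The divergence of \<open>H(|z|) z\<close> is \<open>r H' + N H = r\<^bsup>1-N\<^esup> J' = g\<close>.
\<close>

lemma dH_sum:
  assumes "DIM('a::euclidean_space) = N"
  shows "(\<Sum>b\<in>Basis. dH b (z::'a)) = g (norm z)"
proof -
  define A where "A = (g (norm z) - real N * H (norm z)) / (norm z)\<^sup>2"
  have "(\<Sum>b\<in>Basis. dH b z) = A * (\<Sum>b\<in>Basis. (z \<bullet> b)\<^sup>2) + real N * H_ext (norm z)"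
    using assms by (simp add: dH_def A_def[symmetric] sum.distrib sum_distrib_left)
  then have "(\<Sum>b\<in>Basis. dH b z) = A * (norm z)\<^sup>2 + real N * H_ext (norm z)"
    by (simp only: sum_Basis_square)
  then show ?thesis using N by (cases "z = 0") (auto simp: H_ext_def A_def)
qed

lemma isCont_H_ext_norm: "isCont (\<lambda>z. H_ext (norm z)) (z::'a::euclidean_space)"
proof (cases "z = 0")
  case True
  have "(H_ext \<longlongrightarrow> g 0 / real N) (at_right 0)"
    by (rule Lim_transform_eventually[OF H_tendsto]) (auto simp: eventually_at_filter H_ext_def)
  from filterlim_compose[OF this norm_filterlim_at_right[where 'a='a]]
  show ?thesis using True by (simp add: isCont_def H_ext_def)
next
  case False
  have "isCont (\<lambda>z. H (norm z)) z"
    by (rule isCont_o2[where f=norm and g=H, OF _ isCont_H]) (use False in \<open>auto intro!: continuous_intros\<close>)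
  moreover have "\<forall>\<^sub>F w in nhds z. w \<in> - {0}" using False by (intro eventually_nhds_in_open) auto
  then have "\<forall>\<^sub>F w in nhds z. H (norm w) = H_ext (norm w)" by eventually_elim (auto simp: H_ext_def)
  ultimately show ?thesis by (simp add: isCont_cong)
qed

lemma dH_cont: "continuous_on UNIV (dH b :: 'a::euclidean_space \<Rightarrow> real)"
proof (rule continuous_at_imp_continuous_on, rule ballI)
  fix z :: 'a
  have c1: "isCont (\<lambda>z. (g (norm z) - real N * H (norm z)) / (norm z)\<^sup>2 * (z \<bullet> b)\<^sup>2) z"
  proof (cases "z = 0")
    case False
    have "isCont (\<lambda>z. H (norm z)) z" "isCont (\<lambda>z. g (norm z)) z"
      by (rule isCont_o2[where f=norm, OF _ isCont_H] isCont_o2[where f=norm, OF _ isCont_g],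
          use False in \<open>auto intro!: continuous_intros\<close>)+
    then show ?thesis using False by (intro continuous_intros) auto
  next
    case True
    have "((\<lambda>z::'a. norm (g (norm z) - real N * H (norm z)) * (norm b)\<^sup>2) \<longlongrightarrow> 0) (at 0)"
      using filterlim_compose[OF H'_tendsto norm_filterlim_at_right[where 'a='a]]
      by (intro tendsto_mult_left_zero tendsto_norm_zero)
    then have "((\<lambda>z::'a. (g (norm z) - real N * H (norm z)) / (norm z)\<^sup>2 * (z \<bullet> b)\<^sup>2) \<longlongrightarrow> 0) (at 0)"
    proof (rule Lim_null_comparison[rotated], intro always_eventually allI)
      fix z :: 'a
      have "(z \<bullet> b)\<^sup>2 \<le> (norm z * norm b)\<^sup>2"
        using Cauchy_Schwarz_ineq2[of z b] by (metis abs_ge_zero power2_abs power_mono)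
      then have "(z \<bullet> b)\<^sup>2 / (norm z)\<^sup>2 \<le> (norm b)\<^sup>2"
        by (cases "z = 0") (auto simp: field_simps)
      then have "\<bar>g (norm z) - real N * H (norm z)\<bar> * ((z \<bullet> b)\<^sup>2 / (norm z)\<^sup>2)
          \<le> \<bar>g (norm z) - real N * H (norm z)\<bar> * (norm b)\<^sup>2"
        by (intro mult_left_mono) auto
      then show "norm ((g (norm z) - real N * H (norm z)) / (norm z)\<^sup>2 * (z \<bullet> b)\<^sup>2)
          \<le> norm (g (norm z) - real N * H (norm z)) * (norm b)\<^sup>2"
        by (simp add: abs_mult abs_divide)
    qed
    then show ?thesis by (simp add: True isCont_def)
  qed
  show "isCont (dH b) z" unfolding dH_def[abs_def]
    by (intro continuous_add c1 continuous_mult isCont_H_ext_norm continuous_const)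
qed

lemma Hx_cont: "continuous_on UNIV (\<lambda>z::'a::euclidean_space. H (norm z) *\<^sub>R z)"
proof (rule continuous_on_radial_component)
  show "isCont H (norm x)" if "x \<noteq> 0" for x :: 'a using that by (intro isCont_H) auto
  have "((\<lambda>y. y * H y) \<longlongrightarrow> 0 * (g 0 / real N)) (at_right 0)"
    by (intro tendsto_intros H_tendsto)
  then show "((\<lambda>y. y * H y) \<longlongrightarrow> 0) (at_right 0)" by simp
qed simp

text \<open>
  The similarity variable, for focusing at time \<open>T\<close>.
\<close>

definition simvar :: "real \<Rightarrow> 'a::euclidean_space \<times> real \<Rightarrow> 'a" where
  "simvar T z = ((T - snd z) powr (- \<beta>)) *\<^sub>R fst z"

definition sol :: "real \<Rightarrow> 'a::euclidean_space \<times> real \<Rightarrow> real" where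
  "sol T z = (T - snd z) powr \<alpha> * V (simvar T z)"

text \<open>
  The flux computed from the representative \<open>J\<close>. It is continuous, also across zeros of the solution.
\<close>

definition cont_flux :: "real \<Rightarrow> 'a::euclidean_space \<times> real \<Rightarrow> 'a" where
  "cont_flux T z = ((T - snd z) powr (\<alpha> - 1 + \<beta>)) *\<^sub>R (H (norm (simvar T z)) *\<^sub>R simvar T z)"

lemma focusing_solution_sol:
  "t < T \<Longrightarrow> focusing_solution \<alpha> \<beta> f x (t - T) = sol T (x, t)"
  by (simp add: focusing_solution_def sol_def simvar_def V_def powr_minus divide_inverse mult.commute)

lemma simvar_cont: "continuous_on {z. snd z < T} (simvar T :: 'a::euclidean_space \<times> real \<Rightarrow> 'a)"
  unfolding simvar_def[abs_def] by (intro continuous_intros) auto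

lemma sol_cont: "continuous_on {z. snd z < T} (sol T :: 'a::euclidean_space \<times> real \<Rightarrow> real)"
  unfolding sol_def[abs_def]
  by (intro continuous_intros continuous_on_compose2[OF V_cont simvar_cont]) auto

lemma cont_flux_cont: "continuous_on {z. snd z < T} (cont_flux T :: 'a::euclidean_space \<times> real \<Rightarrow> 'a)"
  unfolding cont_flux_def[abs_def]
  by (intro continuous_intros continuous_on_compose2[OF Hx_cont simvar_cont]) auto

lemma sol_time_line:
  fixes z :: "'a::euclidean_space \<times> real"
  assumes "snd z < T"
  shows "((\<lambda>s. sol T (z + s *\<^sub>R (0, 1))) has_real_derivative
      - ((T - snd z) powr (\<alpha> - 1) * g (norm (simvar T z)))) (at 0)"
proof (cases "fst z = 0")
  case True
  have "((\<lambda>s. (T - (snd z + s)) powr \<alpha> * f 0) has_real_derivative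
      - ((T - snd z) powr (\<alpha> - 1) * (\<alpha> * f 0))) (at 0)"
    using assms by (auto intro!: derivative_eq_intros)
  then show ?thesis using True by (simp add: sol_def simvar_def V_def g_def)
next
  case False
  define r where "r = norm (fst z)"
  define y where "y = (T - snd z) powr (- \<beta>) * r"
  have r: "0 < r" using False by (simp add: r_def)
  have y: "0 < y" using r assms by (simp add: y_def)
  have inner: "((\<lambda>s. (T - (snd z + s)) powr (- \<beta>) * r) has_real_derivative
      \<beta> * (T - snd z) powr (- \<beta> - 1) * r) (at 0)"
    using assms by (auto intro!: derivative_eq_intros)
  have 1: "((\<lambda>s. f ((T - (snd z + s)) powr (- \<beta>) * r)) has_real_derivative
      f1 y * (\<beta> * (T - snd z) powr (- \<beta> - 1) * r)) (at 0)"
    by (rule DERIV_chain2[OF _ inner]) (use f_der_at[OF y] in \<open>simp add: y_def\<close>)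
  have 2: "((\<lambda>s. (T - (snd z + s)) powr \<alpha>) has_real_derivative - (\<alpha> * (T - snd z) powr (\<alpha> - 1))) (at 0)"
    using assms by (auto intro!: derivative_eq_intros)
  have "(T - snd z) powr \<alpha> = (T - snd z) powr (\<alpha> - 1) * (T - snd z)"
    using assms by (simp add: powr_diff)
  moreover have "(T - snd z) powr (- \<beta> - 1) * (T - snd z) = (T - snd z) powr (- \<beta>)"
    using assms by (simp add: powr_diff)
  ultimately have "(f1 y * (\<beta> * (T - snd z) powr (- \<beta> - 1) * r)) * (T - snd z) powr \<alpha>
      = (T - snd z) powr (\<alpha> - 1) * (\<beta> * y * f1 y)"
    by (simp add: y_def mult_ac)
  then have e: "- (\<alpha> * (T - snd z) powr (\<alpha> - 1)) * f y
      + (f1 y * (\<beta> * (T - snd z) powr (- \<beta> - 1) * r)) * (T - snd z) powr \<alpha>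
      = - ((T - snd z) powr (\<alpha> - 1) * g y)"
    unfolding g_def right_diff_distrib by (simp only:) simp
  have "((\<lambda>s. (T - (snd z + s)) powr \<alpha> * f ((T - (snd z + s)) powr (- \<beta>) * r)) has_real_derivative
      - ((T - snd z) powr (\<alpha> - 1) * g y)) (at 0)"
    by (rule DERIV_cong[OF DERIV_mult[OF 2 1]]) (use e in \<open>simp add: y_def\<close>)
  then show ?thesis by (simp add: sol_def simvar_def V_def r_def y_def)
qed

lemma cont_flux_space_line:
  fixes z :: "'a::euclidean_space \<times> real"
  assumes "snd z < T"
  shows "((\<lambda>s. cont_flux T (z + s *\<^sub>R (b, 0)) \<bullet> b) has_real_derivative
      (T - snd z) powr (\<alpha> - 1) * dH b (simvar T z)) (at 0)"
proof -
  let ?k = "(T - snd z) powr (- \<beta>)"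
  have "((\<lambda>s. (\<lambda>s. H (norm (simvar T z + s *\<^sub>R b)) * ((simvar T z + s *\<^sub>R b) \<bullet> b)) (?k * s)) has_real_derivative
     dH b (simvar T z) * ?k) (at 0)"
    by (rule DERIV_chain2[where g="\<lambda>s. ?k * s" and s=UNIV])
       (use dH_line[of "simvar T z" b] in \<open>auto intro!: derivative_eq_intros\<close>)
  from DERIV_cmult[OF this, of "(T - snd z) powr (\<alpha> - 1 + \<beta>)"]
  have "((\<lambda>s. (T - snd z) powr (\<alpha> - 1 + \<beta>) *
      (H (norm (simvar T z + (?k * s) *\<^sub>R b)) * ((simvar T z + (?k * s) *\<^sub>R b) \<bullet> b))) has_real_derivative
     (T - snd z) powr (\<alpha> - 1) * dH b (simvar T z)) (at 0)"
  proof (rule DERIV_cong)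
    have "(T - snd z) powr (\<alpha> - 1 + \<beta>) * ?k = (T - snd z) powr (\<alpha> - 1)"
      by (simp flip: powr_add)
    then show "(T - snd z) powr (\<alpha> - 1 + \<beta>) * (dH b (simvar T z) * ?k) =
        (T - snd z) powr (\<alpha> - 1) * dH b (simvar T z)"
      by (simp flip: mult.assoc)
  qed
  moreover have "simvar T (z + s *\<^sub>R (b, 0)) = simvar T z + (?k * s) *\<^sub>R b" for s
    by (simp add: simvar_def scaleR_add_right)
  ultimately show ?thesis by (simp add: cont_flux_def mult_ac)
qed

text \<open>
  The time derivative of the solution is \<open>-(T-t)\<^bsup>\<alpha>-1\<^esup> g\<close> and the divergence of the flux is
  \<open>(T-t)\<^bsup>\<alpha>-1\<^esup> g\<close>, both evaluated at the similarity variable.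
\<close>

lemma divergence_free:
  fixes \<phi> :: "'a::euclidean_space \<times> real \<Rightarrow> real"
  assumes dim: "DIM('a) = N" and \<phi>: "test_function_on (UNIV \<times> {0<..<T}) \<phi>"
  shows "integrable lborel (\<lambda>z. sol T z * partial \<phi> (0, 1) z)"
    "integrable lborel (\<lambda>z. \<Sum>b\<in>Basis. (cont_flux T z \<bullet> b) * partial \<phi> (b, 0) z)"
    "(\<integral>z. sol T z * partial \<phi> (0, 1) z + (\<Sum>b\<in>Basis. (cont_flux T z \<bullet> b) * partial \<phi> (b, 0) z) \<partial>lborel) = 0"
proof -
  define U where "U = (UNIV :: 'a set) \<times> {0<..<T}"
  have U: "open U" "U \<subseteq> {z. snd z < T}" by (auto simp: U_def open_Times)
  have \<phi>: "test_function_on U \<phi>" using \<phi> by (simp add: U_def)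
  have B: "(0, 1) \<in> (Basis :: ('a \<times> real) set)" "\<And>b::'a. b \<in> Basis \<Longrightarrow> (b, 0) \<in> (Basis :: ('a \<times> real) set)"
    by (auto simp: Basis_prod_def)
  define Dt where "Dt z = - ((T - snd z) powr (\<alpha> - 1) * g (norm (simvar T z)))" for z :: "'a \<times> real"
  define Dx where "Dx b z = (T - snd z) powr (\<alpha> - 1) * dH b (simvar T z)" for b :: 'a and z :: "'a \<times> real"
  have dt: "((\<lambda>s. sol T (z + s *\<^sub>R (0, 1))) has_real_derivative Dt z) (at 0)" if "z \<in> U" for z
    unfolding Dt_def by (rule sol_time_line) (use that U(2) in auto)
  have dx: "((\<lambda>s. cont_flux T (z + s *\<^sub>R (b, 0)) \<bullet> b) has_real_derivative Dx b z) (at 0)" if "z \<in> U" for z b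
    unfolding Dx_def by (rule cont_flux_space_line) (use that U(2) in auto)
  have Dx_cont: "continuous_on U (Dx b)" for b
    unfolding Dx_def[abs_def] using U
    by (intro continuous_intros continuous_on_compose2[OF dH_cont continuous_on_subset[OF simvar_cont]]) auto
  have sum0: "Dt z + (\<Sum>b\<in>Basis. Dx b z) = 0" for z
    using dH_sum[OF dim, of "simvar T z"] by (simp add: Dt_def Dx_def flip: sum_distrib_left)
  have "Dt = (\<lambda>z. - (\<Sum>b\<in>Basis. Dx b z))" using sum0 by (force simp: fun_eq_iff eq_neg_iff_add_eq_0)
  then have Dt_cont: "continuous_on U Dt" using Dx_cont by (auto intro!: continuous_intros)
  have t: "integrable lborel (\<lambda>z. sol T z * partial \<phi> (0, 1) z)"
    "integrable lborel (\<lambda>z. Dt z * \<phi> z)"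
    "(\<integral>z. sol T z * partial \<phi> (0, 1) z \<partial>lborel) = - (\<integral>z. Dt z * \<phi> z \<partial>lborel)"
    using weak_integration_by_parts[OF U(1) \<phi> B(1) dt continuous_on_subset[OF sol_cont U(2)] Dt_cont]
    by auto
  have fc: "continuous_on U (\<lambda>z. cont_flux T z \<bullet> b)" for b
    by (intro continuous_intros continuous_on_subset[OF cont_flux_cont U(2)])
  have x: "integrable lborel (\<lambda>z. (cont_flux T z \<bullet> b) * partial \<phi> (b, 0) z)"
    "integrable lborel (\<lambda>z. Dx b z * \<phi> z)"
    "(\<integral>z. (cont_flux T z \<bullet> b) * partial \<phi> (b, 0) z \<partial>lborel) = - (\<integral>z. Dx b z * \<phi> z \<partial>lborel)"
    if "b \<in> Basis" for b
    using weak_integration_by_parts[OF U(1) \<phi> B(2)[OF that] dx fc Dx_cont] by auto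
  show "integrable lborel (\<lambda>z. sol T z * partial \<phi> (0, 1) z)"
    "integrable lborel (\<lambda>z. \<Sum>b\<in>Basis. (cont_flux T z \<bullet> b) * partial \<phi> (b, 0) z)"
    using t x by auto
  have "(\<integral>z. sol T z * partial \<phi> (0, 1) z + (\<Sum>b\<in>Basis. (cont_flux T z \<bullet> b) * partial \<phi> (b, 0) z) \<partial>lborel)
     = (\<integral>z. sol T z * partial \<phi> (0, 1) z \<partial>lborel)
       + (\<Sum>b\<in>Basis. \<integral>z. (cont_flux T z \<bullet> b) * partial \<phi> (b, 0) z \<partial>lborel)"
    using t x by (subst Bochner_Integration.integral_add) (auto simp: Bochner_Integration.integral_sum)
  also have "\<dots> = - ((\<integral>z. Dt z * \<phi> z \<partial>lborel) + (\<Sum>b\<in>Basis. \<integral>z. Dx b z * \<phi> z \<partial>lborel))"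
    using t x by (simp add: sum_negf)
  also have "(\<integral>z. Dt z * \<phi> z \<partial>lborel) + (\<Sum>b\<in>Basis. \<integral>z. Dx b z * \<phi> z \<partial>lborel)
      = (\<integral>z. Dt z * \<phi> z + (\<Sum>b\<in>Basis. Dx b z * \<phi> z) \<partial>lborel)"
    using t x by (subst Bochner_Integration.integral_add) (auto simp: Bochner_Integration.integral_sum)
  also have "\<dots> = (\<integral>z. (Dt z + (\<Sum>b\<in>Basis. Dx b z)) * \<phi> z \<partial>lborel)"
    by (simp add: distrib_right sum_distrib_right)
  also have "\<dots> = 0" by (simp add: sum0)
  finally show "(\<integral>z. sol T z * partial \<phi> (0, 1) z
      + (\<Sum>b\<in>Basis. (cont_flux T z \<bullet> b) * partial \<phi> (b, 0) z) \<partial>lborel) = 0" by simp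
qed

end

section \<open>The weak formulation\<close>

lemma grad_slice:
  fixes \<phi> :: "'a::euclidean_space \<times> real \<Rightarrow> real"
  assumes "\<phi> differentiable at (x, t)"
  shows "grad (\<lambda>z. \<phi> (z, t)) x = (\<Sum>b\<in>Basis. partial \<phi> (b, 0) (x, t) *\<^sub>R b)"
proof -
  have "((\<lambda>z. \<phi> (z, t)) has_derivative (\<lambda>v. partial \<phi> (v, 0) (x, t))) (at x)"
    by (rule has_derivative_compose[where f="\<lambda>z. (z, t)" and g=\<phi>])
       (use has_derivative_partial[OF assms] in \<open>auto intro!: derivative_eq_intros\<close>)
  from partial_eqI[OF this] show ?thesis by (simp add: grad_def)
qed

context focusing_profile
begin

lemma sol_rescaled: "(\<lambda>z. sol T (z, t)) = (\<lambda>z. (T - t) powr \<alpha> * V (((T - t) powr (- \<beta>)) *\<^sub>R z))"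
  by (simp add: sol_def simvar_def)

text \<open>
  Three space derivatives and the factor \<open>|u|\<^sup>n\<close> produce the power \<open>\<alpha> n + \<alpha> - 3 \<beta>\<close> of \<open>T - t\<close>. It equals
  \<open>\<alpha> - 1 + \<beta>\<close> precisely because \<open>4 \<beta> = 1 + \<alpha> n\<close>.
\<close>

lemma flux_sol:
  fixes x :: "'a::euclidean_space"
  assumes dim: "DIM('a) = N" and t: "t < T" and nz: "sol T (x, t) \<noteq> 0"
  shows "thin_film_flux n (\<lambda>z. sol T (z, t)) x = cont_flux T (x, t)"
proof -
  define c where "c = (T - t) powr \<alpha>"
  define k where "k = (T - t) powr (- \<beta>)"
  have ck: "0 < c" "0 < k" using t by (auto simp: c_def k_def)
  define z where "z = k *\<^sub>R x"
  have W: "(\<lambda>z. sol T (z, t)) = (\<lambda>z. c * V (k *\<^sub>R z))" by (simp add: sol_rescaled c_def k_def)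
  have nz': "c * V z \<noteq> 0" using fun_cong[OF W, of x] nz by (simp add: z_def)
  have "grad (laplacian (\<lambda>z. sol T (z, t))) x = (c * k ^ 3) *\<^sub>R ((hderiv L (norm z) / norm z) *\<^sub>R z)"
    unfolding W z_def by (rule rescaled_profile_regularity(4)[OF dim]) (use ck nz' in \<open>auto simp: z_def\<close>)
  then have "thin_film_flux n (\<lambda>z. sol T (z, t)) x =
      (\<bar>c * V z\<bar> powr n * (c * k ^ 3) * (hderiv L (norm z) / norm z)) *\<^sub>R z"
    using fun_cong[OF W, of x] by (simp add: thin_film_flux_def z_def)
  also have "\<dots> = ((T - t) powr (\<alpha> - 1 + \<beta>) * H (norm z)) *\<^sub>R z"
  proof (cases "z = 0")
    case False
    have p: "norm z ^ N = norm z ^ (N - 1) * norm z" using N by (simp add: power_eq_if)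
    have H: "H (norm z) = \<bar>V z\<bar> powr n * (hderiv L (norm z) / norm z)"
      using False nz' unfolding H_def p by (subst J_flux) (auto simp: V_def)
    have e: "\<alpha> * n + \<alpha> - 3 * \<beta> = \<alpha> - 1 + \<beta>" by (simp add: \<beta>_def field_simps)
    have "k ^ 3 = (T - t) powr (- 3 * \<beta>)"
      using t by (simp add: k_def powr_power)
    moreover have "c powr n = (T - t) powr (\<alpha> * n)" by (simp add: c_def powr_powr)
    ultimately have "c powr n * (c * k ^ 3) = (T - t) powr (\<alpha> * n + (\<alpha> + - 3 * \<beta>))"
      by (simp only: c_def powr_add)
    also have "\<dots> = (T - t) powr (\<alpha> - 1 + \<beta>)" by (rule arg_cong[where f="\<lambda>a. (T - t) powr a"]) (use e in simp)
    finally have "c powr n * (c * k ^ 3) = (T - t) powr (\<alpha> - 1 + \<beta>)" .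
    moreover have "\<bar>c * V z\<bar> powr n = c powr n * \<bar>V z\<bar> powr n"
      using ck by (simp add: abs_mult powr_mult)
    ultimately have "\<bar>c * V z\<bar> powr n * (c * k ^ 3) = (T - t) powr (\<alpha> - 1 + \<beta>) * \<bar>V z\<bar> powr n"
      by (simp add: mult_ac)
    then show ?thesis by (simp add: H)
  qed simp
  also have "\<dots> = cont_flux T (x, t)" by (simp add: cont_flux_def simvar_def z_def k_def)
  finally show ?thesis .
qed

text \<open>
  The points where the flux convention \<open>0\<close> on the zero set of the solution disagrees with the
  continuous flux.
\<close>

definition defect :: "real \<Rightarrow> ('a::euclidean_space \<times> real) set" where
  "defect T = {z \<in> UNIV \<times> {0<..<T}. sol T z = 0 \<and> cont_flux T z \<noteq> 0}"

text \<open>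
  An exact identity rather than one almost everywhere: it makes the flux Borel measurable.
\<close>

lemma flux_sol_indicator:
  fixes x :: "'a::euclidean_space"
  assumes dim: "DIM('a) = N" and t: "0 < t" "t < T"
  shows "thin_film_flux n (\<lambda>z. sol T (z, t)) x = indicator (- defect T) (x, t) *\<^sub>R cont_flux T (x, t)"
  using flux_sol[OF dim t(2), of x] t
  by (cases "sol T (x, t) = 0") (auto simp: defect_def thin_film_flux_def indicator_def)

lemma open_strip: "open ((UNIV :: 'a::euclidean_space set) \<times> {0<..<T::real})"
  by (simp add: open_Times)

lemma strip_sub: "(UNIV :: 'a::euclidean_space set) \<times> {0<..<T::real} \<subseteq> {z. snd z < T}"
  by auto

lemma sol_nz_open: "open {z \<in> (UNIV :: 'a::euclidean_space set) \<times> {0<..<T}. sol T z \<noteq> 0}"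
  using continuous_open_preimage[OF continuous_on_subset[OF sol_cont strip_sub] open_strip, of "- {0}" T]
  by (simp add: vimage_def Int_def open_Compl)

lemma defect_borel: "(defect T :: ('a::euclidean_space \<times> real) set) \<in> sets borel"
proof -
  have "open {z \<in> (UNIV :: 'a set) \<times> {0<..<T}. cont_flux T z \<noteq> 0}"
    using continuous_open_preimage[OF continuous_on_subset[OF cont_flux_cont strip_sub] open_strip, of "- {0}" T]
    by (simp add: vimage_def Int_def open_Compl)
  moreover have "defect T = {z \<in> (UNIV :: 'a set) \<times> {0<..<T}. cont_flux T z \<noteq> 0}
      - {z \<in> (UNIV :: 'a set) \<times> {0<..<T}. sol T z \<noteq> 0}"
    by (auto simp: defect_def)
  ultimately show ?thesis by (simp add: borel_open sets.Diff sol_nz_open)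
qed

text \<open>
  For fixed \<open>x \<noteq> 0\<close> the times in question lie in the image of the null set of radii under the smooth map
  \<open>y \<mapsto> T - (|x| / y)\<^bsup>1/\<beta>\<^esup>\<close>. Slicing in time instead of space makes polar coordinates unnecessary.
\<close>

lemma defect_null: "AE z in lborel. z \<notin> (defect T :: ('a::euclidean_space \<times> real) set)"
proof -
  define Z where "Z = {y. 0 < y \<and> f y = 0 \<and> J y \<noteq> 0}"
  have slice: "AE t in lborel. (x, t) \<notin> defect T" for x :: 'a
  proof (cases "x = 0")
    case True
    then show ?thesis by (simp add: defect_def cont_flux_def simvar_def)
  next
    case False
    have "negligible ((\<lambda>y. T - (norm x / y) powr (1 / \<beta>)) ` Z)"
    proof (rule negligible_differentiable_image_negligible)
      show "negligible Z" using J_null by (simp add: Z_def)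
      have "(\<lambda>y. T - (norm x / y) powr (1 / \<beta>)) differentiable at y" if "0 < y" for y
      proof -
        have "((\<lambda>y. T - (norm x / y) powr (1 / \<beta>)) has_real_derivative
          (0 - (1 / \<beta>) * (norm x / y) powr (1 / \<beta> - 1) * (- norm x / y\<^sup>2))) (at y)"
          using that False \<beta> by (auto intro!: derivative_eq_intros simp: power2_eq_square)
        then show ?thesis using real_differentiable_def by blast
      qed
      then show "(\<lambda>y. T - (norm x / y) powr (1 / \<beta>)) differentiable_on Z"
        by (intro differentiable_at_imp_differentiable_on) (auto simp: Z_def)
    qed simp
    moreover have "t \<in> (\<lambda>y. T - (norm x / y) powr (1 / \<beta>)) ` Z" if "(x, t) \<in> defect T" for t
    proof
      have t: "0 < t" "t < T" using that by (auto simp: defect_def)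
      define y where "y = (T - t) powr (- \<beta>) * norm x"
      have y: "0 < y" using False t by (simp add: y_def)
      have "norm x / y = (T - t) powr \<beta>" using False t by (simp add: y_def powr_minus field_simps)
      then show "t = T - (norm x / y) powr (1 / \<beta>)" using t \<beta> by (simp add: powr_powr)
      show "y \<in> Z" using that y t
        by (auto simp: defect_def sol_def cont_flux_def simvar_def V_def Z_def y_def H_def)
    qed
    ultimately have ae: "AE t in lborel. t \<notin> (\<lambda>y. T - (norm x / y) powr (1 / \<beta>)) ` Z"
      and sub: "\<And>t. t \<notin> (\<lambda>y. T - (norm x / y) powr (1 / \<beta>)) ` Z \<Longrightarrow> (x, t) \<notin> defect T"
      by (blast intro: AE_negligible)+
    show ?thesis by (rule eventually_mono[OF ae sub])
  qed
  have "AE z in lborel \<Otimes>\<^sub>M lborel. z \<notin> (defect T :: ('a \<times> real) set)"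
  proof (rule lborel_pair.AE_pair_measure)
    show "{z \<in> space (lborel \<Otimes>\<^sub>M lborel). z \<notin> (defect T :: ('a \<times> real) set)} \<in> sets (lborel \<Otimes>\<^sub>M lborel)"
      unfolding lborel_prod using defect_borel[of T, where 'a='a] by (simp flip: Compl_eq)
  qed (use slice in simp)
  then show ?thesis unfolding lborel_prod .
qed

lemma focusing_is_solution:
  fixes w :: "'a::euclidean_space \<Rightarrow> real"
  assumes dim: "DIM('a) = N" and T: "0 < T"
    and cont: "continuous_on (UNIV \<times> {0..T}) (\<lambda>(x::'a, t). if t < T then sol T (x, t) else w x)"
  shows "thin_film_solution n T (\<lambda>x::'a. focusing_solution \<alpha> \<beta> f x (- T))
        (\<lambda>x t. if t < T then focusing_solution \<alpha> \<beta> f x (t - T) else w x)"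
proof -
  have eq: "(\<lambda>x t. if t < T then focusing_solution \<alpha> \<beta> f x (t - T) else w x)
      = (\<lambda>x t. if t < T then sol T (x, t) else w x)"
    by (simp add: fun_eq_iff focusing_solution_sol)
  have W: "C1 (\<lambda>x::'a. sol T (x, t))"
    "sol T (x, t) \<noteq> 0 \<Longrightarrow> partial (\<lambda>z. sol T (z, t)) b differentiable at x"
    "sol T (x, t) \<noteq> 0 \<Longrightarrow> laplacian (\<lambda>z. sol T (z, t)) differentiable at x"
    "sol T (x, t) \<noteq> 0 \<Longrightarrow> grad (laplacian (\<lambda>z. sol T (z, t))) x
      = ((T - t) powr \<alpha> * ((T - t) powr (- \<beta>)) ^ 3) *\<^sub>R
        ((hderiv L (norm (simvar T (x, t))) / norm (simvar T (x, t))) *\<^sub>R simvar T (x, t))"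
    if "t < T" for t b and x :: 'a
  proof -
    have ck: "(T - t) powr \<alpha> \<noteq> 0" "(T - t) powr (- \<beta>) \<noteq> 0" using that by auto
    have s: "simvar T (x, t) = (T - t) powr (- \<beta>) *\<^sub>R x" by (simp add: simvar_def)
    show "C1 (\<lambda>x::'a. sol T (x, t))" unfolding sol_rescaled by (rule rescaled_profile_regularity(1)[OF dim ck])
    show "sol T (x, t) \<noteq> 0 \<Longrightarrow> partial (\<lambda>z. sol T (z, t)) b differentiable at x"
      unfolding sol_rescaled by (rule rescaled_profile_regularity(2)[OF dim ck]) (simp add: fun_cong[OF sol_rescaled])
    show "sol T (x, t) \<noteq> 0 \<Longrightarrow> laplacian (\<lambda>z. sol T (z, t)) differentiable at x"
      unfolding sol_rescaled by (rule rescaled_profile_regularity(3)[OF dim ck]) (simp add: fun_cong[OF sol_rescaled])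
    show "sol T (x, t) \<noteq> 0 \<Longrightarrow> grad (laplacian (\<lambda>z. sol T (z, t))) x
      = ((T - t) powr \<alpha> * ((T - t) powr (- \<beta>)) ^ 3) *\<^sub>R
        ((hderiv L (norm (simvar T (x, t))) / norm (simvar T (x, t))) *\<^sub>R simvar T (x, t))"
      unfolding sol_rescaled s by (rule rescaled_profile_regularity(4)[OF dim ck]) (simp add: fun_cong[OF sol_rescaled])
  qed
  show ?thesis
    unfolding thin_film_solution_def eq
  proof (intro conjI ballI allI impI)
    show "(if 0 < T then sol T (x, 0) else w x) = focusing_solution \<alpha> \<beta> f x (- T)" for x :: 'a
      using focusing_solution_sol[of 0 T x] T by simp
    have c: "continuous_on {(x::'a, t). 0 < t \<and> t < T \<and> sol T (x, t) \<noteq> 0}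
        (\<lambda>z. (hderiv L (norm (simvar T z)) / norm (simvar T z)) *\<^sub>R simvar T z)"
      by (rule continuous_on_compose2[OF L'_radial_cont continuous_on_subset[OF simvar_cont]])
         (auto simp: sol_def)
    have "continuous_on {(x::'a, t). 0 < t \<and> t < T \<and> sol T (x, t) \<noteq> 0}
        (\<lambda>z. ((T - snd z) powr \<alpha> * ((T - snd z) powr (- \<beta>)) ^ 3) *\<^sub>R
        ((hderiv L (norm (simvar T z)) / norm (simvar T z)) *\<^sub>R simvar T z))"
      by (rule continuous_on_scaleR[OF _ c]) (intro continuous_intros, auto)
    then have "continuous_on {(x::'a, t). 0 < t \<and> t < T \<and> sol T (x, t) \<noteq> 0}
       (\<lambda>(x, t). grad (laplacian (\<lambda>z. sol T (z, t))) x)"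
      by (rule continuous_on_eq) (clarsimp simp: W)
    then have "continuous_on {(x::'a, t). 0 < t \<and> t < T \<and> sol T (x, t) \<noteq> 0}
       (\<lambda>(x, t). grad (laplacian (\<lambda>z. if t < T then sol T (z, t) else w z)) x)"
      by (rule continuous_on_eq) clarsimp
    moreover have "{(x::'a, t). 0 < t \<and> t < T \<and> (if t < T then sol T (x, t) else w x) \<noteq> 0}
        = {(x, t). 0 < t \<and> t < T \<and> sol T (x, t) \<noteq> 0}"
      by auto
    ultimately show "continuous_on {(x::'a, t). 0 < t \<and> t < T \<and> (if t < T then sol T (x, t) else w x) \<noteq> 0}
       (\<lambda>(x, t). grad (laplacian (\<lambda>z. if t < T then sol T (z, t) else w z)) x)"
      by simp
  next
    fix K :: "('a \<times> real) set" assume K: "compact K \<and> K \<subseteq> UNIV \<times> {0<..<T}"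
    have "set_integrable lborel K (cont_flux T)"
      unfolding set_integrable_def using K continuous_on_subset[OF cont_flux_cont, of K T]
      by (intro borel_integrable_compact) (auto simp: subset_iff)
    then have "set_integrable lborel (K \<inter> - defect T) (cont_flux T)"
      using K defect_borel[of T, where 'a='a] by (elim set_integrable_subset) (auto simp: borel_compact)
    moreover have "indicator K z *\<^sub>R (case z of (x, t) \<Rightarrow>
          thin_film_flux n (\<lambda>z. if t < T then sol T (z, t) else w z) x)
        = indicator (K \<inter> - defect T) z *\<^sub>R cont_flux T z" for z
    proof (cases "z \<in> K")
      case True
      then obtain x t where "z = (x, t)" "0 < t" "t < T" using K by (cases z) auto
      then show ?thesis using True by (simp add: flux_sol_indicator[OF dim] indicator_def)
    qed simp
    ultimately show "set_integrable lborel K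
        (\<lambda>(x, t). thin_film_flux n (\<lambda>z. if t < T then sol T (z, t) else w z) x)"
      unfolding set_integrable_def by simp
  next
    fix \<phi> :: "'a \<times> real \<Rightarrow> real" assume \<phi>: "test_function_on (UNIV \<times> {0<..<T}) \<phi>"
    obtain K where K: "compact K" "K \<subseteq> UNIV \<times> {0<..<T}" "\<And>z. z \<notin> K \<Longrightarrow> \<phi> z = 0" and C1: "C1 \<phi>"
      using \<phi> unfolding test_function_on_def by blast
    have d0: "partial \<phi> v z = 0" if "z \<notin> UNIV \<times> {0<..<T}" for v z
      by (rule partial_outside_support(1)[where \<phi>=\<phi>, OF compact_imp_closed[OF K(1)] K(3)]) (use that K in auto)
    define A where "A z = sol T z * partial \<phi> (0, 1) z" for z
    define S where "S z = (\<Sum>b\<in>Basis. (cont_flux T z \<bullet> b) * partial \<phi> (b, 0) z)" for z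
    note AS = divergence_free[OF dim \<phi>, folded A_def S_def]
    have eq: "(\<lambda>(x, t). (if t < T then sol T (x, t) else w x) * partial \<phi> (0, 1) (x, t) +
             thin_film_flux n (\<lambda>z. if t < T then sol T (z, t) else w z) x \<bullet> grad (\<lambda>z. \<phi> (z, t)) x)
         = (\<lambda>z. A z + indicator (- defect T) z * S z)"
    proof (rule ext, clarify)
      fix x t
      have g: "grad (\<lambda>z. \<phi> (z, t)) x = (\<Sum>b\<in>Basis. partial \<phi> (b, 0) (x, t) *\<^sub>R b)"
        using C1 by (intro grad_slice) (auto simp: C1_def)
      show "(if t < T then sol T (x, t) else w x) * partial \<phi> (0, 1) (x, t) +
             thin_film_flux n (\<lambda>z. if t < T then sol T (z, t) else w z) x \<bullet> grad (\<lambda>z. \<phi> (z, t)) x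
         = A (x, t) + indicator (- defect T) (x, t) * S (x, t)"
      proof (cases "(x, t) \<in> UNIV \<times> {0<..<T}")
        case True
        then show ?thesis
          by (simp add: g A_def S_def flux_sol_indicator[OF dim] inner_sum_right sum_distrib_left mult_ac)
      next
        case False
        then show ?thesis using d0[OF False] by (simp add: g A_def S_def)
      qed
    qed
    \<comment> \<open>Only here is the flux replaced by its continuous representative.\<close>
    have "(\<integral>z. A z + indicator (- defect T) z * S z \<partial>lborel) = (\<integral>z. A z + S z \<partial>lborel)"
    proof (rule integral_cong_AE)
      have m: "A \<in> borel_measurable lborel" "S \<in> borel_measurable lborel"
        using AS(1,2) by (auto dest: borel_measurable_integrable)
      show "(\<lambda>z. A z + indicator (- defect T) z * S z) \<in> borel_measurable lborel"
        using m defect_borel[of T, where 'a='a]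
        by (intro borel_measurable_add borel_measurable_times borel_measurable_indicator) auto
      show "(\<lambda>z. A z + S z) \<in> borel_measurable lborel" using m by simp
      show "AE z in lborel. A z + indicator (- defect T) z * S z = A z + S z"
        using defect_null[of T, where 'a='a] by eventually_elim (simp add: indicator_def)
    qed
    then show "(\<integral>(x, t). (if t < T then sol T (x, t) else w x) * partial \<phi> (0, 1) (x, t) +
             thin_film_flux n (\<lambda>z. if t < T then sol T (z, t) else w z) x \<bullet> grad (\<lambda>z. \<phi> (z, t)) x \<partial>lborel) = 0"
      unfolding eq using AS(3) by simp
  next
    fix t :: real and x b :: 'a
    assume t: "t \<in> {0<..<T}"
    then have tT: "t < T" by simp
    show "C1 (\<lambda>x::'a. if t < T then sol T (x, t) else w x)" using W(1)[OF tT] tT by simp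
    assume "(if t < T then sol T (x, t) else w x) \<noteq> 0"
    then have nz: "sol T (x, t) \<noteq> 0" using tT by simp
    show "partial (\<lambda>z. if t < T then sol T (z, t) else w z) b differentiable at x"
      "laplacian (\<lambda>z. if t < T then sol T (z, t) else w z) differentiable at x"
      using W(2,3)[OF tT nz] tT by simp_all
  next
    show "0 < T" by (rule T)
    show "continuous_on (UNIV \<times> {0..T}) (\<lambda>(x::'a, t). if t < T then sol T (x, t) else w x)"
      by (rule cont)
  qed
qed

end

section \<open>The focusing trace\<close>

context focusing_profile
begin

text \<open>
  The growth condition in additive form, uniform down to \<open>y = 0\<close>; the compact range not reached by
  the asymptotics goes into the constant \<open>M\<close>.
\<close>

lemma profile_bound:
  assumes \<mu>: "0 < \<mu>" and C: "C \<noteq> 0"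
    and growth: "((\<lambda>y. f y / (C * y powr \<mu>)) \<longlongrightarrow> 1) at_top" and \<eta>: "0 < \<eta>"
  obtains M where "0 \<le> M" "\<And>y. 0 \<le> y \<Longrightarrow> \<bar>f y - C * y powr \<mu>\<bar> \<le> M + \<eta> * y powr \<mu>"
proof -
  have "\<forall>\<^sub>F y in at_top. dist (f y / (C * y powr \<mu>)) 1 < \<eta> / \<bar>C\<bar>"
    using growth C \<eta> by (intro tendstoD) auto
  then obtain Y0 where Y0: "\<And>y. Y0 \<le> y \<Longrightarrow> dist (f y / (C * y powr \<mu>)) 1 < \<eta> / \<bar>C\<bar>"
    by (auto simp: eventually_at_top_linorder)
  define Y where "Y = max Y0 1"
  have far: "\<bar>f y - C * y powr \<mu>\<bar> \<le> \<eta> * y powr \<mu>" if "Y \<le> y" for y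
  proof -
    have y: "0 < y powr \<mu>" "Y0 \<le> y" using that by (auto simp: Y_def)
    have "f y - C * y powr \<mu> = (f y / (C * y powr \<mu>) - 1) * (C * y powr \<mu>)"
      using y C by (simp add: field_simps)
    then have "\<bar>f y - C * y powr \<mu>\<bar> = \<bar>f y / (C * y powr \<mu>) - 1\<bar> * (\<bar>C\<bar> * y powr \<mu>)"
      by (simp add: abs_mult)
    also have "\<dots> \<le> \<eta> / \<bar>C\<bar> * (\<bar>C\<bar> * y powr \<mu>)"
      using Y0[OF y(2)] by (intro mult_right_mono) (auto simp: dist_real_def)
    finally show ?thesis using C by simp
  qed
  have "continuous_on {0..Y} (\<lambda>y. f y - C * y powr \<mu>)"
    using \<mu> by (intro continuous_intros continuous_on_powr' continuous_on_subset[OF f_cont]) auto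
  then have "bounded ((\<lambda>y. f y - C * y powr \<mu>) ` {0..Y})"
    by (intro compact_imp_bounded compact_continuous_image) auto
  then obtain M where "\<forall>z\<in>(\<lambda>y. f y - C * y powr \<mu>) ` {0..Y}. norm z \<le> M"
    unfolding bounded_iff by blast
  then have M: "\<And>y. 0 \<le> y \<Longrightarrow> y \<le> Y \<Longrightarrow> \<bar>f y - C * y powr \<mu>\<bar> \<le> M"
    by auto
  show ?thesis
  proof
    show "0 \<le> \<bar>M\<bar>" by simp
    fix y :: real assume "0 \<le> y"
    then show "\<bar>f y - C * y powr \<mu>\<bar> \<le> \<bar>M\<bar> + \<eta> * y powr \<mu>"
      using far[of y] M[of y] \<eta> by (cases "Y \<le> y") (auto intro: add_increasing2 add_increasing order_trans)
  qed
qed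

lemma sol_bound:
  assumes \<mu>: "\<mu> = \<alpha> / \<beta>" and C: "C \<noteq> 0"
    and growth: "((\<lambda>y. f y / (C * y powr \<mu>)) \<longlongrightarrow> 1) at_top" and \<eta>: "0 < \<eta>"
  obtains M where "0 \<le> M"
    "\<And>T x t. t < T \<Longrightarrow> \<bar>sol T (x::'a::euclidean_space, t) - C * norm x powr \<mu>\<bar>
        \<le> (T - t) powr \<alpha> * M + \<eta> * norm x powr \<mu>"
proof -
  have \<mu>0: "0 < \<mu>" using \<mu> \<alpha> \<beta> by simp
  obtain M where M: "0 \<le> M" "\<And>y. 0 \<le> y \<Longrightarrow> \<bar>f y - C * y powr \<mu>\<bar> \<le> M + \<eta> * y powr \<mu>"
    using profile_bound[OF \<mu>0 C growth \<eta>] by metis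
  show ?thesis
  proof (rule that[OF M(1)])
    fix T t :: real and x :: 'a assume t: "t < T"
    define \<tau> where "\<tau> = T - t"
    define y where "y = \<tau> powr (- \<beta>) * norm x"
    have \<tau>: "0 < \<tau>" using t by (simp add: \<tau>_def)
    have "\<tau> powr \<alpha> * y powr \<mu> = \<tau> powr \<alpha> * (\<tau> powr (- \<beta>)) powr \<mu> * norm x powr \<mu>"
      by (simp add: y_def powr_mult)
    also have "(\<tau> powr (- \<beta>)) powr \<mu> = \<tau> powr (- \<alpha>)" using \<mu> \<beta> by (simp add: powr_powr)
    finally have y: "\<tau> powr \<alpha> * y powr \<mu> = norm x powr \<mu>" using \<tau> by (simp add: powr_minus)
    have "sol T (x, t) = \<tau> powr \<alpha> * f y" by (simp add: sol_def simvar_def V_def y_def \<tau>_def)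
    then have "sol T (x, t) - C * norm x powr \<mu> = \<tau> powr \<alpha> * (f y - C * y powr \<mu>)"
      by (simp add: y[symmetric] algebra_simps)
    then have "\<bar>sol T (x, t) - C * norm x powr \<mu>\<bar> = \<tau> powr \<alpha> * \<bar>f y - C * y powr \<mu>\<bar>"
      by (simp add: abs_mult)
    also have "\<dots> \<le> \<tau> powr \<alpha> * (M + \<eta> * y powr \<mu>)"
      by (intro mult_left_mono M) (auto simp: y_def)
    also have "\<dots> = \<tau> powr \<alpha> * M + \<eta> * norm x powr \<mu>"
      unfolding y[symmetric] by (simp add: algebra_simps)
    finally show "\<bar>sol T (x, t) - C * norm x powr \<mu>\<bar> \<le> (T - t) powr \<alpha> * M + \<eta> * norm x powr \<mu>"
      by (simp add: \<tau>_def)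
  qed
qed

lemma focusing_uniform_limit:
  assumes \<mu>: "\<mu> = \<alpha> / \<beta>" and C: "C \<noteq> 0"
    and growth: "((\<lambda>y. f y / (C * y powr \<mu>)) \<longlongrightarrow> 1) at_top"
  shows "uniform_limit (cball (0::'a::euclidean_space) R) (\<lambda>t x. focusing_solution \<alpha> \<beta> f x t)
        (\<lambda>x. C * norm x powr \<mu>) (at_left 0)"
proof (rule uniform_limitI)
  fix e :: real assume e: "0 < e"
  have \<mu>0: "0 < \<mu>" using \<mu> \<alpha> \<beta> by simp
  define R1 where "R1 = R powr \<mu> + 1"
  define \<eta> where "\<eta> = e / (2 * R1)"
  have Rp: "0 < R1" unfolding R1_def using powr_ge_zero[of R \<mu>] by linarith
  have \<eta>: "0 < \<eta>" using e Rp by (simp add: \<eta>_def)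
  obtain M where M: "0 \<le> M"
    "\<And>T x t. t < T \<Longrightarrow> \<bar>sol T (x::'a, t) - C * norm x powr \<mu>\<bar> \<le> (T - t) powr \<alpha> * M + \<eta> * norm x powr \<mu>"
    using sol_bound[OF \<mu> C growth \<eta>] by metis
  have "((\<lambda>t. (- t) powr \<alpha> * M) \<longlongrightarrow> (- 0) powr \<alpha> * M) (at_left 0)"
    using \<alpha> by (intro tendsto_intros tendsto_powr') (auto simp: eventually_at_filter)
  then have "\<forall>\<^sub>F t in at_left 0. (- t) powr \<alpha> * M < e / 2"
    using e by (intro order_tendstoD(2)) auto
  moreover have "\<forall>\<^sub>F t in at_left 0. t < (0::real)" by (simp add: eventually_at_filter)
  ultimately show "\<forall>\<^sub>F t in at_left 0. \<forall>x\<in>cball (0::'a) R. dist (focusing_solution \<alpha> \<beta> f x t) (C * norm x powr \<mu>) < e"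
  proof eventually_elim
    case (elim t)
    show ?case
    proof
      fix x :: 'a assume "x \<in> cball 0 R"
      then have "norm x powr \<mu> \<le> R powr \<mu>" using \<mu>0 by (intro powr_mono2) auto
      then have "\<eta> * norm x powr \<mu> \<le> \<eta> * R1" using \<eta> by (intro mult_left_mono) (auto simp: R1_def)
      also have "\<dots> = e / 2" using Rp by (simp add: \<eta>_def)
      finally show "dist (focusing_solution \<alpha> \<beta> f x t) (C * norm x powr \<mu>) < e"
        using M(2)[of t 0 x] elim focusing_solution_sol[of t 0 x] by (simp add: dist_real_def)
    qed
  qed
qed

lemma focusing_trace_eq:
  assumes \<mu>: "\<mu> = \<alpha> / \<beta>" and C: "C \<noteq> 0"
    and growth: "((\<lambda>y. f y / (C * y powr \<mu>)) \<longlongrightarrow> 1) at_top"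
  shows "focusing_trace \<alpha> \<beta> f (x::'a::euclidean_space) = C * norm x powr \<mu>"
  unfolding focusing_trace_def
proof (rule tendsto_Lim)
  show "((\<lambda>t. focusing_solution \<alpha> \<beta> f x t) \<longlongrightarrow> C * norm x powr \<mu>) (at_left 0)"
    by (rule tendsto_uniform_limitI[OF focusing_uniform_limit[OF assms, of "norm x"]]) simp
qed simp

text \<open>
  On \<open>t = T\<close> both error terms of \<open>sol_bound\<close> are small near a given point: the first because
  \<open>T - t\<close> tends to \<open>0\<close>, the second by the choice of \<open>\<eta>\<close>.
\<close>

lemma sol_trace_cont:
  assumes \<mu>: "\<mu> = \<alpha> / \<beta>" and C: "C \<noteq> 0"
    and growth: "((\<lambda>y. f y / (C * y powr \<mu>)) \<longlongrightarrow> 1) at_top"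
  shows "continuous_on (UNIV \<times> {0..T})
    (\<lambda>(x::'a::euclidean_space, t). if t < T then sol T (x, t) else C * norm x powr \<mu>)"
    (is "continuous_on ?S ?G")
  unfolding continuous_on_eq_continuous_within
proof
  fix z :: "'a \<times> real" assume z: "z \<in> ?S"
  have \<mu>0: "0 < \<mu>" using \<mu> \<alpha> \<beta> by simp
  have op: "open {z :: 'a \<times> real. snd z < T}" by (intro open_Collect_less continuous_intros)
  show "continuous (at z within ?S) ?G"
  proof (cases "snd z < T")
    case True
    then have "isCont (sol T) z" using sol_cont[of T, where 'a='a] op by (cases z) (auto simp: continuous_on_eq_continuous_at)
    moreover have "\<forall>\<^sub>F w in nhds z. w \<in> {z. snd z < T}" using True op by (intro eventually_nhds_in_open) auto
    then have "\<forall>\<^sub>F w in nhds z. sol T w = ?G w" by eventually_elim auto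
    ultimately have "isCont ?G z" by (simp add: isCont_cong)
    then show ?thesis by (rule continuous_at_imp_continuous_at_within)
  next
    case False
    then have zT: "snd z = T" using z by auto
    define F where "F = at z within ?S"
    have n: "((\<lambda>w. norm (fst w) powr \<mu>) \<longlongrightarrow> norm (fst z) powr \<mu>) F"
      unfolding F_def using \<mu>0 by (intro tendsto_intros tendsto_powr') auto
    have S: "\<forall>\<^sub>F w in F. w \<in> ?S" unfolding F_def by (simp add: eventually_at_filter)
    have "((\<lambda>w. ?G w - C * norm (fst w) powr \<mu>) \<longlongrightarrow> 0) F"
    proof (rule tendstoI)
      fix e :: real assume e: "0 < e"
      define R where "R = norm (fst z) powr \<mu> + 1"
      have R: "0 < R" unfolding R_def using powr_ge_zero[of "norm (fst z)" \<mu>] by linarith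
      define \<eta> where "\<eta> = e / (2 * R)"
      have \<eta>: "0 < \<eta>" using e R by (simp add: \<eta>_def)
      obtain M where M: "0 \<le> M"
        "\<And>T x t. t < T \<Longrightarrow> \<bar>sol T (x::'a, t) - C * norm x powr \<mu>\<bar> \<le> (T - t) powr \<alpha> * M + \<eta> * norm x powr \<mu>"
        using sol_bound[OF \<mu> C growth \<eta>] by metis
      have "((\<lambda>w. (T - snd w) powr \<alpha> * M) \<longlongrightarrow> (T - snd z) powr \<alpha> * M) F"
        using \<alpha> S unfolding F_def
        by (intro tendsto_intros tendsto_powr') (auto elim: eventually_mono)
      then have 1: "\<forall>\<^sub>F w in F. (T - snd w) powr \<alpha> * M < e / 2"
        using e by (intro order_tendstoD(2)) (auto simp: zT)
      have 2: "\<forall>\<^sub>F w in F. norm (fst w) powr \<mu> < R"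
        by (rule order_tendstoD(2)[OF n]) (simp add: R_def)
      show "\<forall>\<^sub>F w in F. dist (?G w - C * norm (fst w) powr \<mu>) 0 < e"
        using 1 2
      proof eventually_elim
        case (elim w)
        obtain x t where w: "w = (x, t)" by (cases w)
        have "\<eta> * norm x powr \<mu> < \<eta> * R" using elim \<eta> by (simp add: w)
        also have "\<eta> * R = e / 2" using R by (simp add: \<eta>_def)
        finally have q: "\<eta> * norm x powr \<mu> < e / 2" .
        show ?case
        proof (cases "t < T")
          case True
          have "(T - t) powr \<alpha> * M < e / 2" using elim by (simp add: w)
          with M(2)[OF True, of x] q have "\<bar>sol T (x, t) - C * norm x powr \<mu>\<bar> < e" by linarith
          then show ?thesis using True by (simp add: w dist_real_def)
        qed (use e in \<open>simp add: w\<close>)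
      qed
    qed
    from tendsto_add[OF this tendsto_mult_left[OF n, of C]]
    have "(?G \<longlongrightarrow> C * norm (fst z) powr \<mu>) F" by simp
    moreover have "?G z = C * norm (fst z) powr \<mu>" using zT by (cases z) simp
    ultimately show ?thesis unfolding F_def continuous_within by simp
  qed
qed

end

section \<open>Powers of the norm and their weak gradients\<close>

lemma cball_volume:
  fixes r :: real assumes "0 \<le> r"
  shows "emeasure lborel (cball (0::'a::euclidean_space) r)
      = ennreal (measure lborel (cball (0::'a) 1) * r ^ DIM('a))"
  using emeasure_cball[OF assms, of "0::'a"] emeasure_cball[of 1 "0::'a"]
  by (simp add: measure_def)

text \<open>
  On the shell \<open>2\<^bsup>-k-1\<^esup> < |x| \<le> 2\<^bsup>-k\<^esup>\<close> the integrand is at most \<open>2\<^bsup>s(k+1)\<^esup>\<close>, and the ball of radius \<open>2\<^bsup>-k\<^esup>\<close>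
  has volume proportional to \<open>2\<^bsup>-Nk\<^esup>\<close>: a geometric series of ratio \<open>2\<^bsup>s-N\<^esup>\<close>.
\<close>

lemma nn_integral_negative_power_ball:
  fixes s :: real
  assumes s: "0 \<le> s" "s < real DIM('a::euclidean_space)"
  shows "(\<integral>\<^sup>+x. ennreal (norm x powr (- s)) * indicator (cball (0::'a) 1) x \<partial>lborel) < \<infinity>"
proof -
  let ?v = "measure lborel (cball (0::'a) 1)"
  define a where "a k = (1 / 2 :: real) ^ k" for k :: nat
  have a: "0 < a k" for k by (simp add: a_def)
  define c where "c = 2 powr s * ?v"
  define q where "q = 2 powr s * (1 / 2) ^ DIM('a)"
  have q: "0 \<le> q" "q < 1"
  proof -
    have "q = 2 powr (s - DIM('a))" by (simp add: q_def powr_diff powr_realpow power_one_over field_simps)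
    also have "\<dots> < 2 powr 0" using s by (intro powr_less_mono) auto
    finally show "q < 1" by simp
  qed (simp add: q_def)
  have cover: "ennreal (norm x powr (- s)) * indicator (cball (0::'a) 1) x
     \<le> (\<Sum>k. ennreal (2 powr s * (2 powr s) ^ k) * indicator (cball (0::'a) (a k)) x)" for x :: 'a
  proof (cases "x = 0 \<or> 1 < norm x")
    case True
    then show ?thesis by (auto simp: indicator_def)
  next
    case False
    then have x: "0 < norm x" "norm x \<le> 1" by auto
    obtain m where m: "a m < norm x" using real_arch_pow_inv[OF x(1), of "1/2"] by (auto simp: a_def)
    \<comment> \<open>The first radius below \<open>norm x\<close>; then \<open>x\<close> lies in the shell between \<open>a k\<close> and its predecessor.\<close>
    define k where "k = (LEAST m. a m < norm x)"
    have k: "a k < norm x" unfolding k_def by (rule LeastI[of "\<lambda>m. a m < norm x", OF m])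
    have "k \<noteq> 0" using k x by (cases "k = 0") (auto simp: a_def)
    then obtain j where j: "k = Suc j" by (cases k) auto
    have nj: "norm x \<le> a j"
      using not_less_Least[of j "\<lambda>m. a m < norm x"] j by (simp add: k_def[symmetric])
    have "norm x powr (- s) \<le> (a k) powr (- s)"
      using k a[of k] s by (intro powr_mono2') auto
    also have "(a k) powr (- s) = 2 powr s * (2 powr s) ^ j"
    proof -
      have "a k = 2 powr (- real k)" by (simp add: a_def powr_minus powr_realpow power_one_over field_simps)
      then have "(a k) powr (- s) = 2 powr (real k * s)" by (simp add: powr_powr)
      also have "\<dots> = (2 powr s) ^ k" by (simp add: powr_power mult.commute)
      finally show ?thesis by (simp add: j)
    qed
    finally have "ennreal (norm x powr (- s)) \<le> ennreal (2 powr s * (2 powr s) ^ j)" by (rule ennreal_leI)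
    also have "\<dots> = (\<Sum>k\<in>{j}. ennreal (2 powr s * (2 powr s) ^ k) * indicator (cball (0::'a) (a k)) x)"
      using nj by (simp add: indicator_def)
    also have "\<dots> \<le> (\<Sum>k. ennreal (2 powr s * (2 powr s) ^ k) * indicator (cball (0::'a) (a k)) x)"
      by (intro sum_le_suminf) auto
    finally show ?thesis using x by (simp add: indicator_def)
  qed
  have "(\<integral>\<^sup>+x. ennreal (norm x powr (- s)) * indicator (cball (0::'a) 1) x \<partial>lborel)
    \<le> (\<integral>\<^sup>+x. (\<Sum>k. ennreal (2 powr s * (2 powr s) ^ k) * indicator (cball (0::'a) (a k)) x) \<partial>lborel)"
    by (intro nn_integral_mono cover)
  also have "\<dots> = (\<Sum>k. ennreal (2 powr s * (2 powr s) ^ k) * emeasure lborel (cball (0::'a) (a k)))"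
  proof (subst nn_integral_suminf)
    show "(\<lambda>x. ennreal (2 powr s * (2 powr s) ^ k) * indicator (cball (0::'a) (a k)) x) \<in> borel_measurable lborel" for k
      by (intro borel_measurable_times_ennreal borel_measurable_const borel_measurable_indicator) simp
  qed (simp only: nn_integral_cmult_indicator sets_lborel borel_closed closed_cball)
  also have "\<dots> = (\<Sum>k. ennreal (c * q ^ k))"
  proof (rule arg_cong[where f=suminf], rule ext)
    fix k
    have "ennreal (2 powr s * (2 powr s) ^ k) * emeasure lborel (cball (0::'a) (a k))
       = ennreal ((2 powr s * (2 powr s) ^ k) * (?v * a k ^ DIM('a)))"
      using a[of k] by (simp add: cball_volume less_imp_le flip: ennreal_mult)
    also have "(2 powr s * (2 powr s) ^ k) * (?v * a k ^ DIM('a)) = c * q ^ k"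
      by (simp add: c_def q_def a_def power_mult_distrib mult_ac flip: power_mult)
    finally show "ennreal (2 powr s * (2 powr s) ^ k) * emeasure lborel (cball (0::'a) (a k)) = ennreal (c * q ^ k)" .
  qed
  also have "\<dots> = ennreal (\<Sum>k. c * q ^ k)"
    using q by (intro suminf_ennreal2 summable_mult summable_geometric) (auto simp: c_def)
  also have "\<dots> < \<infinity>" by simp
  finally show ?thesis .
qed

lemma integrable_negative_power:
  assumes s: "0 \<le> s" "s < real DIM('a::euclidean_space)" and K: "compact (K :: 'a set)"
  shows "set_integrable lborel K (\<lambda>x. norm x powr (- s))"
proof -
  have "integrable lborel (\<lambda>x::'a. indicator (cball 0 1) x *\<^sub>R norm x powr (- s))"
  proof (rule integrableI_bounded)
    show "(\<lambda>x::'a. indicator (cball 0 1) x *\<^sub>R norm x powr (- s)) \<in> borel_measurable lborel"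
      by (intro borel_measurable_scaleR borel_measurable_indicator) auto
  qed (use nn_integral_negative_power_ball[OF s] in \<open>auto simp: ennreal_mult' mult.commute ennreal_indicator\<close>)
  moreover have "integrable lborel (\<lambda>x::'a. indicator K x :: real)"
    using K by (intro integrable_real_indicator emeasure_compact_finite) (auto simp: borel_compact)
  ultimately have "integrable lborel (\<lambda>x::'a. indicator (cball 0 1) x *\<^sub>R norm x powr (- s) + indicator K x)"
    by (rule Bochner_Integration.integrable_add)
  then show ?thesis unfolding set_integrable_def
  proof (rule Bochner_Integration.integrable_bound)
    show "(\<lambda>x::'a. indicator K x *\<^sub>R norm x powr (- s)) \<in> borel_measurable lborel"
      using K by (intro borel_measurable_scaleR borel_measurable_indicator) (auto simp: borel_compact)
    have "norm x powr (- s) \<le> 1" if "1 < norm x" for x :: 'a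
      using that s ge_one_powr_ge_zero[of "norm x" s] by (simp add: powr_minus inverse_le_1_iff)
    then show "AE x::'a in lborel. norm (indicator K x *\<^sub>R norm x powr (- s))
        \<le> norm (indicator (cball 0 1) x *\<^sub>R norm x powr (- s) + (indicator K x :: real))"
      by (intro AE_I2) (auto simp: indicator_def not_le)
  qed
qed

lemma continuous_on_norm_powr:
  "0 < \<mu> \<Longrightarrow> continuous_on UNIV (\<lambda>x::'a::euclidean_space. norm x powr \<mu>)"
  by (intro continuous_on_powr' continuous_intros) auto

lemma regularized_power_line:
  fixes z :: "'a::euclidean_space"
  assumes d: "0 < d"
  shows "((\<lambda>s. ((norm (z + s *\<^sub>R b))\<^sup>2 + d) powr (\<mu> / 2)) has_real_derivative
      \<mu> * (z \<bullet> b) * ((norm z)\<^sup>2 + d) powr (\<mu> / 2 - 1)) (at 0)"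
proof -
  have p: "0 < (norm z)\<^sup>2 + d" using d by (simp add: add_nonneg_pos)
  have "((\<lambda>s. (norm (z + s *\<^sub>R b))\<^sup>2 + d) has_real_derivative 2 * (z \<bullet> b)) (at 0)"
  proof -
    have "((\<lambda>s. z \<bullet> z + 2 * s * (z \<bullet> b) + s * s * (b \<bullet> b) + d) has_real_derivative 2 * (z \<bullet> b)) (at 0)"
      by (auto intro!: derivative_eq_intros)
    moreover have "(\<lambda>s. (norm (z + s *\<^sub>R b))\<^sup>2 + d) = (\<lambda>s. z \<bullet> z + 2 * s * (z \<bullet> b) + s * s * (b \<bullet> b) + d)"
      by (simp add: fun_eq_iff power2_norm_eq_inner inner_add_left inner_add_right inner_commute algebra_simps)
    ultimately show ?thesis by simp
  qed
  from DERIV_fun_powr[OF this, of "\<mu> / 2"] show ?thesis using p by (simp add: mult_ac)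
qed

lemma regularized_power_bound:
  fixes z :: "'a::euclidean_space"
  assumes d: "0 < d" and b: "b \<in> Basis" and \<mu>: "0 < \<mu>" "\<mu> < 1"
  shows "\<bar>\<mu> * (z \<bullet> b) * ((norm z)\<^sup>2 + d) powr (\<mu> / 2 - 1)\<bar> \<le> \<mu> * norm z powr (- (1 - \<mu>))"
proof (cases "z = 0")
  case False
  then have z: "0 < norm z" by simp
  have "((norm z)\<^sup>2 + d) powr (\<mu> / 2 - 1) \<le> ((norm z)\<^sup>2) powr (\<mu> / 2 - 1)"
    using d \<mu> z by (intro powr_mono2') auto
  also have "\<dots> = norm z powr (\<mu> - 2)"
  proof -
    have "((norm z)\<^sup>2) powr (\<mu> / 2 - 1) = (norm z powr 2) powr (\<mu> / 2 - 1)" using z by simp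
    also have "\<dots> = norm z powr (2 * (\<mu> / 2 - 1))" by (rule powr_powr)
    finally show ?thesis by (simp add: algebra_simps)
  qed
  finally have 1: "((norm z)\<^sup>2 + d) powr (\<mu> / 2 - 1) \<le> norm z powr (\<mu> - 2)" .
  have 2: "\<bar>z \<bullet> b\<bar> \<le> norm z" using b Basis_le_norm by blast
  have "\<bar>\<mu> * (z \<bullet> b) * ((norm z)\<^sup>2 + d) powr (\<mu> / 2 - 1)\<bar>
      = \<mu> * (\<bar>z \<bullet> b\<bar> * ((norm z)\<^sup>2 + d) powr (\<mu> / 2 - 1))"
    using \<mu> by (simp add: abs_mult)
  also have "\<dots> \<le> \<mu> * (norm z * norm z powr (\<mu> - 2))"
    using \<mu> 1 2 by (intro mult_left_mono mult_mono) auto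
  also have "norm z * norm z powr (\<mu> - 2) = norm z powr (1 + (\<mu> - 2))"
    using z by (simp only: powr_add) simp
  also have "1 + (\<mu> - 2) = - (1 - \<mu>)" by simp
  finally show ?thesis .
qed simp

text \<open>
  The power is replaced by the smooth \<open>(|x|\<^sup>2 + d)\<^bsup>\<mu>/2\<^esup>\<close>, whose gradients are dominated by the integrable
  \<open>\<mu> |x|\<^bsup>\<mu>-1\<^esup>\<close> uniformly in \<open>d\<close>.
\<close>

lemma weak_gradient_power:
  fixes \<phi> :: "'a::euclidean_space \<Rightarrow> real"
  assumes \<mu>: "0 < \<mu>" "\<mu> < 1" and dim: "2 \<le> DIM('a)"
    and \<phi>: "test_function_on UNIV \<phi>" and b: "b \<in> Basis"
  shows "integrable lborel (\<lambda>x. norm x powr (\<mu> - 2) * (x \<bullet> b) * \<phi> x)"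
    "(\<integral>x. norm x powr \<mu> * partial \<phi> b x \<partial>lborel)
      = - (\<integral>x. \<mu> * norm x powr (\<mu> - 2) * (x \<bullet> b) * \<phi> x \<partial>lborel)"
proof -
  obtain K where K: "compact K" "\<And>x. x \<notin> K \<Longrightarrow> \<phi> x = 0" and C1: "C1 \<phi>"
    using \<phi> unfolding test_function_on_def by blast
  have dK: "\<And>x. x \<notin> K \<Longrightarrow> partial \<phi> b x = 0"
    by (rule partial_outside_support(1)[where \<phi>=\<phi>, OF compact_imp_closed[OF K(1)] K(2)])
  have c\<phi>: "continuous_on UNIV \<phi>" by (rule C1_continuous[OF C1])
  have cd: "continuous_on UNIV (partial \<phi> b)" using C1 b by (simp add: C1_def)
  obtain M where M: "\<And>x. \<bar>\<phi> x\<bar> \<le> M * indicator K x" "0 \<le> M"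
  proof -
    have "bounded (\<phi> ` K)"
      using compact_continuous_image[OF continuous_on_subset[OF c\<phi>] K(1)] compact_imp_bounded by blast
    then obtain B where B: "\<forall>y\<in>\<phi> ` K. norm y \<le> B" unfolding bounded_iff by blast
    have "\<bar>\<phi> x\<bar> \<le> \<bar>B\<bar> * indicator K x" for x using B K(2)[of x] by (cases "x \<in> K") force+
    then show ?thesis using that[of "\<bar>B\<bar>"] by simp
  qed
  define d where "d k = 1 / real (Suc k)" for k
  have d: "0 < d k" "d k \<le> 1" for k by (auto simp: d_def)
  have dlim: "d \<longlonglongrightarrow> 0" unfolding d_def using LIMSEQ_inverse_real_of_nat by (simp add: inverse_eq_divide)
  define g where "g k x = ((norm x)\<^sup>2 + d k) powr (\<mu> / 2)" for k and x :: 'a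
  define Dg where "Dg k x = \<mu> * (x \<bullet> b) * ((norm x)\<^sup>2 + d k) powr (\<mu> / 2 - 1)" for k and x :: 'a
  have p: "0 < (norm x)\<^sup>2 + d k" for x :: 'a and k using d[of k] by (simp add: add_nonneg_pos)
  have pne: "(norm x)\<^sup>2 + d k \<noteq> 0" for x :: 'a and k using p[of x k] by linarith
  have gc: "continuous_on UNIV (g k)" "continuous_on UNIV (Dg k)" for k
    unfolding g_def Dg_def using pne by (auto intro!: continuous_intros)
  have ibp: "(\<integral>x. g k x * partial \<phi> b x \<partial>lborel) = - (\<integral>x. Dg k x * \<phi> x \<partial>lborel)" for k
    by (rule weak_integration_by_parts(3)[OF open_UNIV \<phi> b _ gc])
       (auto simp: g_def Dg_def intro: regularized_power_line d)
  have sq: "((norm x)\<^sup>2) powr a = norm x powr (2 * a)" for x :: 'a and a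
  proof (cases "x = 0")
    case False
    then have "((norm x)\<^sup>2) powr a = (norm x powr 2) powr a" by simp
    then show ?thesis by (simp only: powr_powr)
  qed simp
  have L: "(\<lambda>k. \<integral>x. g k x * partial \<phi> b x \<partial>lborel) \<longlonglongrightarrow> (\<integral>x. norm x powr \<mu> * partial \<phi> b x \<partial>lborel)"
  proof (rule integral_dominated_convergence)
    let ?w = "\<lambda>x::'a. ((norm x)\<^sup>2 + 1) powr (\<mu> / 2) * \<bar>partial \<phi> b x\<bar>"
    have q: "(norm x)\<^sup>2 + 1 \<noteq> 0" for x :: 'a using zero_le_power2[of "norm x"] by linarith
    show "integrable lborel ?w"
      by (rule integrable_compact_support[OF _ K(1)]) (use cd dK q in \<open>auto intro!: continuous_intros\<close>)
    show "(\<lambda>x. norm x powr \<mu> * partial \<phi> b x) \<in> borel_measurable lborel"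
      using cd \<mu> by (auto intro!: borel_measurable_continuous_onI continuous_intros continuous_on_norm_powr)
    show "(\<lambda>x. g k x * partial \<phi> b x) \<in> borel_measurable lborel" for k
      using cd gc(1)[of k] by (auto intro!: borel_measurable_continuous_onI continuous_intros)
    have "(\<lambda>k. g k x) \<longlonglongrightarrow> ((norm x)\<^sup>2 + 0) powr (\<mu> / 2)" for x
      unfolding g_def using \<mu> p[of x]
      by (intro tendsto_intros tendsto_powr' dlim) (auto intro!: always_eventually simp: less_imp_le)
    then have "(\<lambda>k. g k x) \<longlonglongrightarrow> norm x powr \<mu>" for x by (simp add: sq)
    then show "AE x in lborel. (\<lambda>k. g k x * partial \<phi> b x) \<longlonglongrightarrow> norm x powr \<mu> * partial \<phi> b x"
      by (intro AE_I2 tendsto_intros)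
    show "AE x in lborel. norm (g k x * partial \<phi> b x) \<le> ?w x" for k
    proof (rule AE_I2)
      fix x :: 'a
      have "g k x \<le> ((norm x)\<^sup>2 + 1) powr (\<mu> / 2)"
        unfolding g_def using \<mu> d[of k] by (intro powr_mono2) auto
      then show "norm (g k x * partial \<phi> b x) \<le> ?w x"
        by (simp add: abs_mult g_def mult_right_mono)
    qed
  qed
  define w where "w x = M * (\<mu> * (indicator K x *\<^sub>R norm x powr (- (1 - \<mu>))))" for x :: 'a
  have wi: "integrable lborel w"
    unfolding w_def using integrable_negative_power[of "1 - \<mu>" K] K(1) \<mu> dim
    by (auto simp: set_integrable_def intro!: integrable_mult_right)
  have wb: "\<bar>a * \<phi> x\<bar> \<le> w x" if "\<bar>a\<bar> \<le> \<mu> * norm x powr (- (1 - \<mu>))" for a and x :: 'a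
  proof -
    have "\<bar>a * \<phi> x\<bar> \<le> (\<mu> * norm x powr (- (1 - \<mu>))) * (M * indicator K x)"
      unfolding abs_mult using that M \<mu> by (intro mult_mono) auto
    then show ?thesis by (simp add: w_def mult_ac)
  qed
  have R: "(\<lambda>k. \<integral>x. Dg k x * \<phi> x \<partial>lborel) \<longlonglongrightarrow> (\<integral>x. (\<mu> * (x \<bullet> b) * norm x powr (\<mu> - 2)) * \<phi> x \<partial>lborel)"
    and I: "integrable lborel (\<lambda>x. (\<mu> * (x \<bullet> b) * norm x powr (\<mu> - 2)) * \<phi> x)"
  proof -
    have lim: "(\<lambda>k. Dg k x) \<longlonglongrightarrow> \<mu> * (x \<bullet> b) * norm x powr (\<mu> - 2)" for x
    proof (cases "x = 0")
      case False
      have "(\<lambda>k. Dg k x) \<longlonglongrightarrow> \<mu> * (x \<bullet> b) * ((norm x)\<^sup>2 + 0) powr (\<mu> / 2 - 1)"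
        unfolding Dg_def using False by (intro tendsto_intros dlim) auto
      moreover have "2 * (\<mu> / 2 - 1) = \<mu> - 2" by simp
      ultimately show ?thesis by (simp only: add_0_right sq)
    qed (simp add: Dg_def)
    have 1: "(\<lambda>x. (\<mu> * (x \<bullet> b) * norm x powr (\<mu> - 2)) * \<phi> x) \<in> borel_measurable lborel"
      using c\<phi> by (auto intro!: borel_measurable_times borel_measurable_continuous_onI[of \<phi>])
    have 2: "(\<lambda>x. Dg k x * \<phi> x) \<in> borel_measurable lborel" for k
      using c\<phi> gc(2)[of k] by (auto intro!: borel_measurable_continuous_onI continuous_intros)
    have 3: "AE x in lborel. (\<lambda>k. Dg k x * \<phi> x) \<longlonglongrightarrow> (\<mu> * (x \<bullet> b) * norm x powr (\<mu> - 2)) * \<phi> x"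
      by (intro AE_I2 tendsto_intros lim)
    have 4: "AE x in lborel. norm (Dg k x * \<phi> x) \<le> w x" for k
      unfolding real_norm_def
      by (intro AE_I2 wb) (unfold Dg_def, rule regularized_power_bound[OF d(1) b \<mu>])
    show "(\<lambda>k. \<integral>x. Dg k x * \<phi> x \<partial>lborel) \<longlonglongrightarrow> (\<integral>x. (\<mu> * (x \<bullet> b) * norm x powr (\<mu> - 2)) * \<phi> x \<partial>lborel)"
      by (rule integral_dominated_convergence[OF 1 2 wi 3 4])
    show "integrable lborel (\<lambda>x. (\<mu> * (x \<bullet> b) * norm x powr (\<mu> - 2)) * \<phi> x)"
      by (rule integrable_dominated_convergence[OF 1 2 wi 3 4])
  qed
  have "(\<lambda>k. \<integral>x. g k x * partial \<phi> b x \<partial>lborel) \<longlonglongrightarrow> - (\<integral>x. (\<mu> * (x \<bullet> b) * norm x powr (\<mu> - 2)) * \<phi> x \<partial>lborel)"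
    unfolding ibp by (rule tendsto_minus[OF R])
  from LIMSEQ_unique[OF L this]
  show "(\<integral>x. norm x powr \<mu> * partial \<phi> b x \<partial>lborel)
      = - (\<integral>x. \<mu> * norm x powr (\<mu> - 2) * (x \<bullet> b) * \<phi> x \<partial>lborel)"
    by (simp add: mult_ac)
  from integrable_mult_right[OF I, of "1 / \<mu>"] \<mu>
  show "integrable lborel (\<lambda>x. norm x powr (\<mu> - 2) * (x \<bullet> b) * \<phi> x)"
    by (simp add: mult_ac)
qed

lemma power_grad_in_Lp_loc:
  fixes C :: real
  assumes \<mu>: "0 < \<mu>" "\<mu> < 1" and dim: "2 \<le> DIM('a::euclidean_space)"
    and p: "1 \<le> p" "p < real DIM('a) / (1 - \<mu>)"
  shows "grad_in_Lp_loc p (\<lambda>x::'a. C * norm x powr \<mu>)"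
  unfolding grad_in_Lp_loc_def
proof (intro conjI exI[of _ "\<lambda>x::'a. (C * \<mu> * norm x powr (\<mu> - 2)) *\<^sub>R x"] allI impI ballI)
  fix K :: "'a set" assume K: "compact K"
  show "set_integrable lborel K (\<lambda>x::'a. C * norm x powr \<mu>)"
    unfolding set_integrable_def using K \<mu>
    by (intro borel_integrable_compact)
       (auto intro!: continuous_intros continuous_on_subset[OF continuous_on_norm_powr])
  have n: "norm ((C * \<mu> * norm x powr (\<mu> - 2)) *\<^sub>R x) powr p
      = (\<bar>C\<bar> * \<mu>) powr p * norm x powr (- ((1 - \<mu>) * p))" for x :: 'a
  proof (cases "x = 0")
    case False
    then have "norm x powr (\<mu> - 2) * norm x = norm x powr (\<mu> - 2 + 1)"
      by (simp only: powr_add) simp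
    then have "norm ((C * \<mu> * norm x powr (\<mu> - 2)) *\<^sub>R x) = (\<bar>C\<bar> * \<mu>) * norm x powr (\<mu> - 1)"
      using \<mu> by (simp add: abs_mult mult.assoc)
    then show ?thesis using \<mu> by (simp add: powr_mult powr_powr algebra_simps)
  qed simp
  have "set_integrable lborel K (\<lambda>x. norm x powr (- ((1 - \<mu>) * p)))"
    using p \<mu> by (intro integrable_negative_power[OF _ _ K]) (auto simp: field_simps)
  then show "set_integrable lborel K (\<lambda>x. norm ((C * \<mu> * norm x powr (\<mu> - 2)) *\<^sub>R x) powr p)"
    unfolding n by (rule set_integrable_mult_right)
next
  show "(\<lambda>x::'a. (C * \<mu> * norm x powr (\<mu> - 2)) *\<^sub>R x) \<in> borel_measurable lborel"
    by simp
next
  fix \<phi> :: "'a \<Rightarrow> real" and b :: 'a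
  assume \<phi>: "test_function_on UNIV \<phi>" and b: "b \<in> Basis"
  show "(\<integral>x. C * norm x powr \<mu> * partial \<phi> b x \<partial>lborel)
      = - (\<integral>x. ((C * \<mu> * norm x powr (\<mu> - 2)) *\<^sub>R x \<bullet> b) * \<phi> x \<partial>lborel)"
    using weak_gradient_power(2)[OF \<mu> dim \<phi> b] by (simp add: mult.assoc)
qed

section \<open>The critical integrability exponent\<close>

lemma DERIV_max0_square:
  "((\<lambda>t::real. (max 0 t)\<^sup>2) has_real_derivative 2 * max 0 t) (at t)"
proof (cases "t = 0")
  case True
  have "((\<lambda>t::real. (max 0 t)\<^sup>2 / t) \<longlongrightarrow> 0) (at 0)"
  proof (rule Lim_null_comparison)
    show "((\<lambda>t::real. \<bar>t\<bar>) \<longlongrightarrow> 0) (at 0)" by (auto intro!: tendsto_eq_intros)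
    show "\<forall>\<^sub>F t::real in at 0. norm ((max 0 t)\<^sup>2 / t) \<le> \<bar>t\<bar>"
      by (intro always_eventually allI) (auto simp: max_def power2_eq_square)
  qed
  then show ?thesis using True by (simp add: has_field_derivative_iff)
next
  case False
  then consider "0 < t" | "t < 0" by linarith
  then show ?thesis
  proof cases
    case 1
    have "((\<lambda>t::real. t\<^sup>2) has_real_derivative 2 * max 0 t) (at t)"
      using 1 by (auto intro!: derivative_eq_intros)
    then show ?thesis
      by (rule has_field_derivative_transform_within_open[where S="{0<..}"]) (use 1 in auto)
  next
    case 2
    have "((\<lambda>t::real. 0) has_real_derivative 2 * max 0 t) (at t)" using 2 by simp
    then show ?thesis
      by (rule has_field_derivative_transform_within_open[where S="{..<0}"]) (use 2 in auto)
  qed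
qed

text \<open>
  The square makes the truncation at \<open>|x| = r\<close> continuously differentiable.
\<close>

lemma test_function_bump:
  "test_function_on UNIV (\<lambda>x::'a::euclidean_space. (x \<bullet> b) * (max 0 (r\<^sup>2 - (norm x)\<^sup>2))\<^sup>2)"
proof -
  let ?m = "\<lambda>x::'a. max 0 (r\<^sup>2 - (norm x)\<^sup>2)"
  have sq: "((\<lambda>x::'a. r\<^sup>2 - (norm x)\<^sup>2) has_derivative (\<lambda>v. - 2 * (x \<bullet> v))) (at x)" for x
    unfolding power2_norm_eq_inner
    by (auto intro!: derivative_eq_intros simp: inner_commute)
  have m: "((\<lambda>x::'a. (?m x)\<^sup>2) has_derivative (\<lambda>v. 2 * ?m x * (- 2 * (x \<bullet> v)))) (at x)" for x
    using has_derivative_compose[OF sq DERIV_max0_square[unfolded has_field_derivative_def]] .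
  have D: "((\<lambda>x::'a. (x \<bullet> b) * (?m x)\<^sup>2) has_derivative
      (\<lambda>v. (x \<bullet> b) * (2 * ?m x * (- 2 * (x \<bullet> v))) + (v \<bullet> b) * (?m x)\<^sup>2)) (at x)" for x
    by (rule has_derivative_mult[OF _ m]) (auto intro!: derivative_eq_intros)
  have "C1 (\<lambda>x::'a. (x \<bullet> b) * (?m x)\<^sup>2)"
    unfolding C1_def
  proof (intro conjI allI ballI)
    show "(\<lambda>x::'a. (x \<bullet> b) * (?m x)\<^sup>2) differentiable at x" for x
      using D by (auto simp: differentiable_def)
    show "continuous_on UNIV (partial (\<lambda>x::'a. (x \<bullet> b) * (?m x)\<^sup>2) c)" for c
      unfolding partial_eqI[OF D, abs_def] by (intro continuous_intros)
  qed
  moreover have "(x \<bullet> b) * (?m x)\<^sup>2 = 0" if "x \<notin> cball 0 \<bar>r\<bar>" for x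
  proof -
    have "r\<^sup>2 \<le> (norm x)\<^sup>2" using that by (intro power2_le_iff_abs_le[THEN iffD2]) auto
    then show ?thesis by simp
  qed
  ultimately show ?thesis unfolding test_function_on_def
    by (intro conjI exI[of _ "cball 0 \<bar>r\<bar>"]) auto
qed

lemma unit_ball_measure_pos: "0 < measure lborel (cball (0::'a::euclidean_space) 1)"
proof -
  have "unit_ball_vol (real DIM('a)) > 0" by simp
  then show ?thesis using emeasure_cball[of 1 "0::'a"] by (simp add: measure_def)
qed

lemma measure_cball_0:
  "0 \<le> r \<Longrightarrow> measure lborel (cball (0::'a::euclidean_space) r) = measure lborel (cball (0::'a) 1) * r ^ DIM('a)"
  using cball_volume[of r, where 'a='a] by (simp add: measure_def)

text \<open>
  The shell \<open>r/4 < |x| \<le> r/2\<close> alone gives a lower bound with the right scaling in \<open>r\<close>.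
\<close>

lemma power_bump_lower_bound:
  assumes \<mu>: "0 < \<mu>"
  shows "\<exists>k>0. \<forall>r>0. k * r powr \<mu> * r ^ DIM('a) * r ^ 4 \<le>
      (\<integral>x. norm (x::'a::euclidean_space) powr \<mu> * (max 0 (r\<^sup>2 - (norm x)\<^sup>2))\<^sup>2 \<partial>lborel)"
proof -
  let ?v = "measure lborel (cball (0::'a) 1)"
  let ?N = "DIM('a)"
  define k where "k = (1 / 4) powr \<mu> * ?v * ((1 / 2) ^ ?N - (1 / 4) ^ ?N) * (1 / 2)"
  have "(1 / 4 :: real) ^ ?N < (1 / 2) ^ ?N" by (intro power_strict_mono) auto
  then have k: "0 < k" using unit_ball_measure_pos[where 'a='a] by (simp add: k_def)
  show ?thesis
  proof (intro exI conjI allI impI, rule k)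
    fix r :: real assume r: "0 < r"
    define A where "A = cball (0::'a) (r / 2) - cball 0 (r / 4)"
    define a where "a = (r / 4) powr \<mu> * (r ^ 4 / 2)"
    have r2: "0 \<le> r / 2" "0 \<le> r / 4" using r by auto
    have "measure lborel A = measure lborel (cball (0::'a) (r / 2)) - measure lborel (cball (0::'a) (r / 4))"
      unfolding A_def using r by (intro measure_Diff) (auto simp: cball_volume)
    also have "\<dots> = ?v * ((1 / 2) ^ ?N - (1 / 4) ^ ?N) * r ^ ?N"
      unfolding measure_cball_0[OF r2(1)] measure_cball_0[OF r2(2)] by (simp add: power_divide algebra_simps)
    finally have mA: "measure lborel A = ?v * ((1 / 2) ^ ?N - (1 / 4) ^ ?N) * r ^ ?N" .
    have Ai: "integrable lborel (indicator A :: 'a \<Rightarrow> real)"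
    proof (rule integrable_real_indicator)
      have "emeasure lborel A \<le> emeasure lborel (cball (0::'a) (r / 2))"
        by (intro emeasure_mono) (auto simp: A_def)
      also have "\<dots> < \<infinity>" by (rule emeasure_compact_finite) simp
      finally show "emeasure lborel A < \<infinity>" .
    qed (simp add: A_def)
    have "a * measure lborel A = (\<integral>x. a * indicator A x \<partial>lborel)"
      using Ai by (simp add: A_def)
    also have "\<dots> \<le> (\<integral>x. norm (x::'a) powr \<mu> * (max 0 (r\<^sup>2 - (norm x)\<^sup>2))\<^sup>2 \<partial>lborel)"
    proof (rule integral_mono)
      show "integrable lborel (\<lambda>x. a * indicator A x)" using Ai by simp
      show "integrable lborel (\<lambda>x::'a. norm x powr \<mu> * (max 0 (r\<^sup>2 - (norm x)\<^sup>2))\<^sup>2)"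
      proof (rule integrable_compact_support[of _ "cball 0 r"])
        fix x :: 'a assume "x \<notin> cball 0 r"
        then have "r\<^sup>2 \<le> (norm x)\<^sup>2" using r by (intro power_mono) auto
        then show "norm x powr \<mu> * (max 0 (r\<^sup>2 - (norm x)\<^sup>2))\<^sup>2 = 0" by simp
      qed (use \<mu> in \<open>auto intro!: continuous_intros continuous_on_norm_powr\<close>)
      fix x :: 'a
      show "a * indicator A x \<le> norm x powr \<mu> * (max 0 (r\<^sup>2 - (norm x)\<^sup>2))\<^sup>2"
      proof (cases "x \<in> A")
        case True
        then have x: "r / 4 < norm x" "norm x \<le> r / 2" by (auto simp: A_def)
        have "(norm x)\<^sup>2 \<le> (r / 2)\<^sup>2" using x by (intro power_mono) auto
        then have "3 / 4 * r\<^sup>2 \<le> r\<^sup>2 - (norm x)\<^sup>2" by (simp add: power_divide)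
        then have "3 / 4 * r\<^sup>2 \<le> max 0 (r\<^sup>2 - (norm x)\<^sup>2)" by (rule max.coboundedI2)
        then have "(3 / 4 * r\<^sup>2)\<^sup>2 \<le> (max 0 (r\<^sup>2 - (norm x)\<^sup>2))\<^sup>2" by (rule power_mono) auto
        moreover have "r ^ 4 / 2 \<le> (3 / 4 * r\<^sup>2)\<^sup>2" by (simp add: power_mult_distrib power_divide flip: power_mult)
        ultimately have "r ^ 4 / 2 \<le> (max 0 (r\<^sup>2 - (norm x)\<^sup>2))\<^sup>2" by linarith
        moreover have "(r / 4) powr \<mu> \<le> norm x powr \<mu>" using x r \<mu> by (intro powr_mono2) auto
        ultimately have "a \<le> norm x powr \<mu> * (max 0 (r\<^sup>2 - (norm x)\<^sup>2))\<^sup>2"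
          unfolding a_def using r by (intro mult_mono) auto
        then show ?thesis using True by simp
      qed simp
    qed
    finally have "a * measure lborel A \<le> (\<integral>x. norm (x::'a) powr \<mu> * (max 0 (r\<^sup>2 - (norm x)\<^sup>2))\<^sup>2 \<partial>lborel)" .
    moreover have "a * measure lborel A = k * r powr \<mu> * r ^ ?N * r ^ 4"
    proof -
      have "(r / 4) powr \<mu> = r powr \<mu> * (1 / 4) powr \<mu>" by (simp add: powr_divide)
      then show ?thesis unfolding mA a_def k_def by (simp only: mult_ac) simp
    qed
    ultimately show "k * r powr \<mu> * r ^ ?N * r ^ 4
      \<le> (\<integral>x. norm (x::'a) powr \<mu> * (max 0 (r\<^sup>2 - (norm x)\<^sup>2))\<^sup>2 \<partial>lborel)" by simp
  qed
qed

text \<open>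
  Splitting at the height \<open>s\<close> serves instead of the Hoelder inequality: with \<open>s\<close> adapted to the
  radius it has the same scaling.
\<close>

lemma young_cutoff:
  fixes a s p :: real
  assumes "0 \<le> a" "0 < s" "1 \<le> p"
  shows "a \<le> s + a powr p * s powr (1 - p)"
proof (cases "a \<le> s")
  case True
  then show ?thesis by (simp add: add_increasing2)
next
  case False
  then have a: "s < a" "0 < a" using assms by auto
  have "1 = s powr (p - 1) * s powr (1 - p)" using assms by (simp flip: powr_add)
  also have "\<dots> \<le> a powr (p - 1) * s powr (1 - p)"
    using a assms by (intro mult_right_mono powr_mono2) auto
  finally have "a * 1 \<le> a * (a powr (p - 1) * s powr (1 - p))" using a by (intro mult_left_mono) auto
  also have "\<dots> = a powr p * s powr (1 - p)" using a by (simp add: powr_diff)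
  finally show ?thesis using assms by simp
qed

text \<open>
  Test the weak identity with \<open>\<phi>\<^sub>b(x) = x\<^sub>b m(x)\<close>, where \<open>m\<close> is a bump of radius \<open>r\<close>, and sum over \<open>b\<close>. The
  classical gradient shows that the result is \<open>C \<mu>\<close> times the integral of \<open>|x|\<^bsup>\<mu>\<^esup> m\<close>, so the integral
  of \<open>|G|\<close> over the ball of radius \<open>r\<close> is at least \<open>k' r\<^bsup>N-1+\<mu>\<^esup>\<close>. On the other hand, if
  \<open>(1-\<mu>) p \<ge> N\<close>, local integrability of \<open>|G|\<^sup>p\<close> makes that integral \<open>o(r\<^bsup>N-1+\<mu>\<^esup>)\<close>.
\<close>

lemma power_grad_not_in_Lp_loc:
  fixes C :: real
  assumes \<mu>: "0 < \<mu>" "\<mu> < 1" and dim: "2 \<le> DIM('a::euclidean_space)" and C: "C \<noteq> 0"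
    and p: "1 \<le> p" "real DIM('a) \<le> (1 - \<mu>) * p"
  shows "\<not> grad_in_Lp_loc p (\<lambda>x::'a. C * norm x powr \<mu>)"
proof
  assume "grad_in_Lp_loc p (\<lambda>x::'a. C * norm x powr \<mu>)"
  then obtain G :: "'a \<Rightarrow> 'a" where G: "G \<in> borel_measurable lborel \<and>
      (\<forall>K. compact K \<longrightarrow> set_integrable lborel K (\<lambda>x. norm (G x) powr p)) \<and>
      (\<forall>\<phi>. test_function_on UNIV \<phi> \<longrightarrow> (\<forall>b\<in>Basis.
        (\<integral>x. C * norm x powr \<mu> * partial \<phi> b x \<partial>lborel) = - (\<integral>x. (G x \<bullet> b) * \<phi> x \<partial>lborel)))"
    unfolding grad_in_Lp_loc_def by (elim conjE exE) (rule that, intro conjI)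
  note G_meas = G[THEN conjunct1]
    and G_int = G[THEN conjunct2, THEN conjunct1, rule_format]
    and G_weak = G[THEN conjunct2, THEN conjunct2, rule_format]
  let ?N = "DIM('a)"
  define v where "v = measure lborel (cball (0::'a) 1)"
  have v: "0 < v" unfolding v_def by (rule unit_ball_measure_pos)
  define I where "I r = (\<integral>x. indicator (cball (0::'a) r) x * norm (G x) powr p \<partial>lborel)" for r
  have Ii: "integrable lborel (\<lambda>x. indicator (cball (0::'a) r) x * norm (G x) powr p)" for r
    using G_int[of "cball 0 r"] by (simp add: set_integrable_def)
  have Bi: "integrable lborel (\<lambda>x. indicator (cball (0::'a) r) x :: real)" for r
    by (intro integrable_real_indicator emeasure_compact_finite) auto
  have Bv: "(\<integral>x. indicator (cball (0::'a) r) x \<partial>lborel) = v * r ^ ?N" if "0 \<le> r" for r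
    using measure_cball_0[OF that, where 'a='a] by (simp add: v_def)
  have Gm: "(\<lambda>x. indicator (cball (0::'a) r) x * norm (G x)) \<in> borel_measurable lborel" for r
    using G_meas by (intro borel_measurable_times borel_measurable_indicator borel_measurable_norm) auto
  have young: "indicator (cball 0 r) x * norm (G x) \<le> s * indicator (cball 0 r) x
      + s powr (1 - p) * (indicator (cball 0 r) x * norm (G x) powr p)" if "0 < s" for s r x
    using young_cutoff[of "norm (G x)" s p] that p by (simp add: indicator_def mult.commute)
  have Gi: "integrable lborel (\<lambda>x. indicator (cball (0::'a) r) x * norm (G x))" for r
  proof (rule Bochner_Integration.integrable_bound[OF _ Gm])
    show "integrable lborel (\<lambda>x. 1 * indicator (cball 0 r) x
      + 1 powr (1 - p) * (indicator (cball 0 r) x * norm (G x) powr p))"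
      by (intro Bochner_Integration.integrable_add integrable_mult_right Bi Ii)
    show "AE x in lborel. norm (indicator (cball 0 r) x * norm (G x)) \<le> norm (1 * indicator (cball 0 r) x
      + 1 powr (1 - p) * (indicator (cball 0 r) x * norm (G x) powr p))"
      using young[of 1 r] by (intro AE_I2) (simp add: indicator_def)
  qed
  obtain k where k: "0 < k \<and> (\<forall>r>0. k * r powr \<mu> * r ^ ?N * r ^ 4 \<le>
      (\<integral>x. norm (x::'a) powr \<mu> * (max 0 (r\<^sup>2 - (norm x)\<^sup>2))\<^sup>2 \<partial>lborel))"
    using power_bump_lower_bound[OF \<mu>(1), where 'a='a] by (rule exE)
  note k = k[THEN conjunct1] k[THEN conjunct2, rule_format]
  define k' where "k' = \<bar>C\<bar> * \<mu> * k"
  have k': "0 < k'" using C \<mu> k by (simp add: k'_def)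
  have main: "k' \<le> \<eta> * v + \<eta> powr (1 - p) * I r" if r: "0 < r" "r \<le> 1" and \<eta>: "0 < \<eta>" for r \<eta>
  proof -
    define m where "m x = (max 0 (r\<^sup>2 - (norm x)\<^sup>2))\<^sup>2" for x :: 'a
    define \<phi> where "\<phi> b x = (x \<bullet> b) * m x" for b x :: 'a
    have m0: "m x = 0" if "x \<notin> cball 0 r" for x
    proof -
      have "r\<^sup>2 \<le> (norm x)\<^sup>2" using that r by (intro power_mono) auto
      then show ?thesis by (simp add: m_def)
    qed
    have m1: "0 \<le> m x" "m x \<le> r ^ 4" for x
    proof -
      have "max 0 (r\<^sup>2 - (norm x)\<^sup>2) \<le> r\<^sup>2" by simp
      then have "m x \<le> (r\<^sup>2)\<^sup>2" unfolding m_def by (intro power_mono) auto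
      then show "m x \<le> r ^ 4" by simp
    qed (simp add: m_def)
    have \<phi>: "test_function_on UNIV (\<phi> b)" for b
      unfolding \<phi>_def m_def by (rule test_function_bump)
    have m_meas: "m \<in> borel_measurable lborel" unfolding m_def by simp
    have bnd: "\<bar>y \<bullet> x\<bar> * m x \<le> r ^ 5 * (indicator (cball 0 r) x * norm y)" for x y
    proof (cases "x \<in> cball 0 r")
      case True
      have "\<bar>y \<bullet> x\<bar> \<le> norm y * norm x" by (rule Cauchy_Schwarz_ineq2)
      also have "\<dots> \<le> norm y * r" using True by (intro mult_left_mono) auto
      finally have "\<bar>y \<bullet> x\<bar> * m x \<le> (norm y * r) * r ^ 4"
        using m1 r by (intro mult_mono) auto
      then show ?thesis using True by (simp add: power_Suc[symmetric] mult_ac flip: power_add)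
        (simp add: numeral_eq_Suc mult_ac)
    qed (simp add: m0)
    have int1: "integrable lborel (\<lambda>x. (G x \<bullet> b) * \<phi> b x)" if b: "b \<in> Basis" for b
    proof (rule Bochner_Integration.integrable_bound[OF integrable_mult_right[OF Gi[of r], of "r ^ 5"]])
      show "(\<lambda>x. (G x \<bullet> b) * \<phi> b x) \<in> borel_measurable lborel"
        unfolding \<phi>_def using G_meas m_meas by simp
      show "AE x in lborel. norm ((G x \<bullet> b) * \<phi> b x) \<le> norm (r ^ 5 * (indicator (cball 0 r) x * norm (G x)))"
      proof (rule AE_I2)
        fix x
        have "\<bar>G x \<bullet> b\<bar> * (\<bar>x \<bullet> b\<bar> * m x) \<le> norm (G x) * (\<bar>b \<bullet> x\<bar> * m x)"
          using Basis_le_norm[OF b, of "G x"] m1 by (intro mult_mono) (auto simp: inner_commute)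
        also have "\<dots> \<le> norm (G x) * (r ^ 5 * (indicator (cball 0 r) x * norm b))"
          by (intro mult_left_mono bnd) auto
        finally show "norm ((G x \<bullet> b) * \<phi> b x) \<le> norm (r ^ 5 * (indicator (cball 0 r) x * norm (G x)))"
          using b r m1 by (simp add: \<phi>_def abs_mult mult_ac)
      qed
    qed
    have "(\<Sum>b\<in>Basis. \<integral>x. (G x \<bullet> b) * \<phi> b x \<partial>lborel)
        = (\<Sum>b\<in>Basis. C * \<mu> * (\<integral>x. norm x powr (\<mu> - 2) * (x \<bullet> b) * \<phi> b x \<partial>lborel))"
    proof (rule sum.cong[OF refl])
      fix b :: 'a assume b: "b \<in> Basis"
      show "(\<integral>x. (G x \<bullet> b) * \<phi> b x \<partial>lborel) = C * \<mu> * (\<integral>x. norm x powr (\<mu> - 2) * (x \<bullet> b) * \<phi> b x \<partial>lborel)"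
        using G_weak[OF \<phi> b] weak_gradient_power(2)[OF \<mu> dim \<phi> b] by (simp add: mult.assoc)
    qed
    also have "\<dots> = C * \<mu> * (\<integral>x. (\<Sum>b\<in>Basis. norm x powr (\<mu> - 2) * (x \<bullet> b) * \<phi> b x) \<partial>lborel)"
      using weak_gradient_power(1)[OF \<mu> dim \<phi>]
      by (subst Bochner_Integration.integral_sum) (auto simp: sum_distrib_left)
    also have "(\<lambda>x. (\<Sum>b\<in>Basis. norm x powr (\<mu> - 2) * (x \<bullet> b) * \<phi> b x)) = (\<lambda>x. norm x powr \<mu> * m x)"
    proof
      fix x :: 'a
      have "(\<Sum>b\<in>Basis. norm x powr (\<mu> - 2) * (x \<bullet> b) * \<phi> b x)
          = norm x powr (\<mu> - 2) * m x * (\<Sum>b\<in>Basis. (x \<bullet> b)\<^sup>2)"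
        by (simp add: sum_distrib_left \<phi>_def power2_eq_square mult_ac)
      also have "\<dots> = (norm x powr (\<mu> - 2) * (norm x)\<^sup>2) * m x" by (simp add: sum_Basis_square)
      also have "norm x powr (\<mu> - 2) * (norm x)\<^sup>2 = norm x powr \<mu>"
        by (cases "x = 0") (auto simp: powr_diff)
      finally show "(\<Sum>b\<in>Basis. norm x powr (\<mu> - 2) * (x \<bullet> b) * \<phi> b x) = norm x powr \<mu> * m x" .
    qed
    also have "(\<Sum>b\<in>Basis. \<integral>x. (G x \<bullet> b) * \<phi> b x \<partial>lborel) = (\<integral>x. (G x \<bullet> x) * m x \<partial>lborel)"
    proof -
      have "(\<Sum>b\<in>Basis. \<integral>x. (G x \<bullet> b) * \<phi> b x \<partial>lborel) = (\<integral>x. (\<Sum>b\<in>Basis. (G x \<bullet> b) * \<phi> b x) \<partial>lborel)"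
        using int1 by (simp add: Bochner_Integration.integral_sum)
      also have "(\<lambda>x. \<Sum>b\<in>Basis. (G x \<bullet> b) * \<phi> b x) = (\<lambda>x. (G x \<bullet> x) * m x)"
      proof
        fix x
        have "(G x \<bullet> x) * m x = (\<Sum>b\<in>Basis. (G x \<bullet> b) * (x \<bullet> b)) * m x"
          by (subst euclidean_inner) (rule refl)
        then show "(\<Sum>b\<in>Basis. (G x \<bullet> b) * \<phi> b x) = (G x \<bullet> x) * m x"
          by (simp only: \<phi>_def sum_distrib_right mult.assoc)
      qed
      finally show ?thesis .
    qed
    finally have eq: "(\<integral>x. (G x \<bullet> x) * m x \<partial>lborel) = C * \<mu> * (\<integral>x. norm x powr \<mu> * m x \<partial>lborel)" .
    have "k' * (r powr \<mu> * r ^ ?N * r ^ 4) \<le> \<bar>C\<bar> * \<mu> * (\<integral>x. norm x powr \<mu> * m x \<partial>lborel)"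
      using mult_left_mono[OF k(2)[OF r(1)], of "\<bar>C\<bar> * \<mu>"] \<mu> by (simp add: k'_def m_def mult_ac)
    also have "\<dots> \<le> \<bar>C * \<mu> * (\<integral>x. norm x powr \<mu> * m x \<partial>lborel)\<bar>"
      using \<mu> by (simp add: abs_mult mult_left_mono)
    also have "\<dots> \<le> (\<integral>x. \<bar>(G x \<bullet> x) * m x\<bar> \<partial>lborel)"
      unfolding eq[symmetric] by (rule integral_abs_bound)
    also have "\<dots> \<le> (\<integral>x. r ^ 5 * (indicator (cball 0 r) x * norm (G x)) \<partial>lborel)"
    proof (rule integral_mono')
      show "integrable lborel (\<lambda>x. r ^ 5 * (indicator (cball 0 r) x * norm (G x)))"
        by (intro integrable_mult_right Gi)
      show "\<bar>(G x \<bullet> x) * m x\<bar> \<le> r ^ 5 * (indicator (cball 0 r) x * norm (G x))" for x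
        using bnd[of "G x" x] m1[of x] by (simp add: abs_mult)
    qed (use r in auto)
    also have "\<dots> = r ^ 5 * (\<integral>x. indicator (cball 0 r) x * norm (G x) \<partial>lborel)" by simp
    finally have low: "k' * (r powr \<mu> * r ^ ?N * r ^ 4) \<le> r ^ 5 * (\<integral>x. indicator (cball 0 r) x * norm (G x) \<partial>lborel)" .
    \<comment> \<open>The gradient of the power has size \<open>r\<^bsup>\<mu>-1\<^esup>\<close> at radius \<open>r\<close>; heights well below it contribute a small fraction.\<close>
    define s where "s = \<eta> * r powr (\<mu> - 1)"
    have s: "0 < s" using \<eta> r by (simp add: s_def)
    have "(\<integral>x. indicator (cball 0 r) x * norm (G x) \<partial>lborel)
      \<le> (\<integral>x. s * indicator (cball 0 r) x + s powr (1 - p) * (indicator (cball 0 r) x * norm (G x) powr p) \<partial>lborel)"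
      by (intro integral_mono Gi Bochner_Integration.integrable_add integrable_mult_right Bi Ii young s)
    also have "\<dots> = s * (v * r ^ ?N) + s powr (1 - p) * I r"
      using Bi[of r] Ii[of r] Bv[of r] r by (simp add: I_def)
    finally have up: "(\<integral>x. indicator (cball 0 r) x * norm (G x) \<partial>lborel) \<le> s * (v * r ^ ?N) + s powr (1 - p) * I r" .
    define X where "X = r powr (\<mu> - 1) * r ^ ?N"
    have X: "0 < X" using r by (simp add: X_def)
    have "s powr (1 - p) = \<eta> powr (1 - p) * r powr ((\<mu> - 1) * (1 - p))"
      using \<eta> by (simp add: s_def powr_mult powr_powr)
    also have "\<dots> \<le> \<eta> powr (1 - p) * X"
    proof (rule mult_left_mono)
      have "r powr ((\<mu> - 1) * (1 - p)) \<le> r powr (\<mu> - 1 + real ?N)"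
        using r p by (intro powr_mono') (auto simp: algebra_simps)
      then show "r powr ((\<mu> - 1) * (1 - p)) \<le> X" using r by (simp add: X_def powr_add powr_realpow)
    qed simp
    finally have sX: "s powr (1 - p) \<le> \<eta> powr (1 - p) * X" .
    have I0: "0 \<le> I r" unfolding I_def by (intro integral_nonneg_AE) auto
    have "r powr \<mu> * r ^ ?N * r ^ 4 = r ^ 5 * X"
    proof -
      have "r powr \<mu> = r powr (\<mu> - 1) * r" using r by (simp add: powr_diff)
      then show ?thesis by (simp add: X_def numeral_eq_Suc mult_ac)
    qed
    then have "r ^ 5 * (k' * X) \<le> r ^ 5 * (\<integral>x. indicator (cball 0 r) x * norm (G x) \<partial>lborel)"
      using low by (simp add: mult_ac)
    also have "\<dots> \<le> r ^ 5 * (s * (v * r ^ ?N) + s powr (1 - p) * I r)"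
      using up r by (intro mult_left_mono) auto
    also have "\<dots> \<le> r ^ 5 * (\<eta> * v * X + \<eta> powr (1 - p) * X * I r)"
      using mult_right_mono[OF sX I0] r by (intro mult_left_mono) (auto simp: s_def X_def mult_ac)
    finally have "r ^ 5 * (k' * X) \<le> r ^ 5 * ((\<eta> * v + \<eta> powr (1 - p) * I r) * X)"
      by (simp add: algebra_simps)
    then show ?thesis using r X by simp
  qed
  have "(\<lambda>j. I (1 / real (Suc j))) \<longlonglongrightarrow> (\<integral>x. 0 \<partial>(lborel :: 'a measure))"
    unfolding I_def
  proof (rule integral_dominated_convergence[OF _ _ Ii[of 1]])
    show "(\<lambda>x. indicator (cball 0 (1 / real (Suc j))) x * norm (G x) powr p) \<in> borel_measurable lborel" for j
      using Ii[of "1 / real (Suc j)"] by (rule borel_measurable_integrable)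
    show "AE x in lborel. norm (indicator (cball 0 (1 / real (Suc j))) x * norm (G x) powr p)
       \<le> indicator (cball 0 1) x * norm (G x) powr p" for j
      by (intro AE_I2) (auto simp: indicator_def intro: order_trans)
    have lim: "(\<lambda>j. indicator (cball 0 (1 / real (Suc j))) x * norm (G x) powr p) \<longlonglongrightarrow> 0" if "x \<noteq> 0" for x :: 'a
    proof (rule tendsto_eventually)
      have "(\<lambda>j. 1 / real (Suc j)) \<longlonglongrightarrow> 0" using LIMSEQ_inverse_real_of_nat by (simp add: inverse_eq_divide)
      then have "\<forall>\<^sub>F j in sequentially. 1 / real (Suc j) < norm x" using that by (intro order_tendstoD(2)) auto
      then show "\<forall>\<^sub>F j in sequentially. indicator (cball 0 (1 / real (Suc j))) x * norm (G x) powr p = 0"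
        by eventually_elim (simp add: indicator_def)
    qed
    have "AE x in lborel. x \<noteq> (0::'a)" by (rule AE_lborel_singleton)
    then show "AE x in lborel. (\<lambda>j. indicator (cball 0 (1 / real (Suc j))) x * norm (G x) powr p) \<longlonglongrightarrow> 0"
      by (rule eventually_mono) (rule lim)
  qed simp
  then have I_lim: "(\<lambda>j. I (1 / real (Suc j))) \<longlonglongrightarrow> 0" by simp
  \<comment> \<open>With this \<open>\<eta>\<close> the low part accounts for half of \<open>k'\<close>, and the high part tends to zero with the radius.\<close>
  define \<eta> where "\<eta> = k' / (2 * v)"
  have \<eta>: "0 < \<eta>" "\<eta> * v = k' / 2" using k' v by (auto simp: \<eta>_def)
  have "k' \<le> k' / 2"
  proof (rule tendsto_lowerbound)
    show "(\<lambda>j. k' / 2 + \<eta> powr (1 - p) * I (1 / real (Suc j))) \<longlonglongrightarrow> k' / 2"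
      using tendsto_add[OF tendsto_const tendsto_mult_left[OF I_lim]] by simp
    show "\<forall>\<^sub>F j in sequentially. k' \<le> k' / 2 + \<eta> powr (1 - p) * I (1 / real (Suc j))"
      using main[OF _ _ \<eta>(1)] \<eta>(2) by (intro always_eventually allI) auto
  qed simp
  then show False using k' by simp
qed

section \<open>Failure of Hoelder continuity at the focus\<close>

lemma power_not_O_higher_power:
  fixes \<mu> \<gamma> c M :: real
  assumes "\<mu> < \<gamma>" "0 < c" and le: "\<And>s. 0 < s \<Longrightarrow> s \<le> 1 \<Longrightarrow> c * s powr \<mu> \<le> M * s powr \<gamma>"
  shows False
proof -
  have "((\<lambda>s. M * s powr (\<gamma> - \<mu>)) \<longlongrightarrow> M * 0 powr (\<gamma> - \<mu>)) (at_right 0)"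
    using assms(1) by (intro tendsto_intros tendsto_powr') (auto simp: eventually_at_right_less eventually_at_filter)
  then have lim: "((\<lambda>s. M * s powr (\<gamma> - \<mu>)) \<longlongrightarrow> 0) (at_right 0)" by simp
  have "c \<le> M * s powr (\<gamma> - \<mu>)" if "0 < s" "s < 1" for s
  proof -
    have "c * s powr \<mu> \<le> (M * s powr (\<gamma> - \<mu>)) * s powr \<mu>"
      using le[of s] that by (simp add: powr_diff)
    then show ?thesis using that by simp
  qed
  then have "\<forall>\<^sub>F s in at_right 0. c \<le> M * s powr (\<gamma> - \<mu>)"
    unfolding eventually_at_right_field by (intro exI[of _ 1]) auto
  from tendsto_lowerbound[OF lim this] assms(2) show False by simp
qed

text \<open>
  Restrict to a line through the origin. If \<open>\<gamma> > 1\<close>, the restriction would be differentiable and even,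
  hence have derivative zero at the origin, and integrating the Hoelder bound for its derivative
  gives \<open>|C| s\<^bsup>\<mu>\<^esup> \<le> M s\<^bsup>\<gamma>\<^esup>\<close>, exactly as for \<open>\<gamma> \<le> 1\<close>. This also covers \<open>\<mu> = 1\<close>.
\<close>

lemma power_not_holder_loc:
  fixes C \<mu> \<gamma> :: real
  assumes \<mu>: "0 < \<mu>" and C: "C \<noteq> 0" and \<gamma>: "\<mu> < \<gamma>" "\<gamma> \<le> 2"
  shows "\<not> holder_loc \<gamma> (\<lambda>x::'a::euclidean_space. C * norm x powr \<mu>)" (is "\<not> holder_loc \<gamma> ?w")
proof
  assume h: "holder_loc \<gamma> ?w"
  obtain b :: 'a where b: "b \<in> Basis" using nonempty_Basis by blast
  have nb: "norm b = 1" using b by simp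
  show False
  proof (cases "\<gamma> \<le> 1")
    case True
    then have "\<lceil>\<gamma>\<rceil> = 1" using \<mu> \<gamma> by (intro ceiling_unique) auto
    then have "\<forall>K. compact K \<longrightarrow> (\<exists>M. \<forall>x\<in>K. \<forall>y\<in>K. \<bar>?w x - ?w y\<bar> \<le> M * dist x y powr \<gamma>)"
      using h by (simp add: holder_loc_def)
    then obtain M where M: "\<And>x y. x \<in> cball 0 1 \<Longrightarrow> y \<in> cball 0 1 \<Longrightarrow> \<bar>?w x - ?w y\<bar> \<le> M * dist x y powr \<gamma>"
      using compact_cball by meson
    show False
    proof (rule power_not_O_higher_power[OF \<gamma>(1)])
      show "0 < \<bar>C\<bar>" using C by simp
      fix s :: real assume "0 < s" "s \<le> 1"
      then show "\<bar>C\<bar> * s powr \<mu> \<le> M * s powr \<gamma>"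
        using M[of "s *\<^sub>R b" 0] by (simp add: nb abs_mult)
    qed
  next
    case False
    then have "\<lceil>\<gamma>\<rceil> = 2" using \<gamma> by (intro ceiling_unique) auto
    then have "holder_deriv_loc (Suc 0) (\<gamma> - 1) ?w"
      using h by (simp add: holder_loc_def)
    then have diff: "\<And>x. ?w differentiable at x" and
      "\<forall>K. compact K \<longrightarrow> (\<exists>M. \<forall>x\<in>K. \<forall>y\<in>K. \<bar>partial ?w b x - partial ?w b y\<bar> \<le> M * dist x y powr (\<gamma> - 1))"
      using b by auto
    then obtain M where M: "\<And>x y. x \<in> cball 0 1 \<Longrightarrow> y \<in> cball 0 1 \<Longrightarrow>
        \<bar>partial ?w b x - partial ?w b y\<bar> \<le> M * dist x y powr (\<gamma> - 1)"
      using compact_cball by meson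
    define q where "q s = C * \<bar>s\<bar> powr \<mu>" for s
    define q' where "q' s = partial ?w b (s *\<^sub>R b)" for s
    have der: "(q has_real_derivative q' s) (at s)" for s
    proof -
      have "((\<lambda>s. ?w (0 + s *\<^sub>R b)) has_real_derivative partial ?w b (0 + s *\<^sub>R b)) (at s)"
        by (rule line_derivative_at) (rule line_derivative[OF has_derivative_partial[OF diff]])
      then show ?thesis by (simp add: q_def[abs_def] q'_def nb)
    qed
    have "q' 0 = 0"
    proof -
      have "((\<lambda>s. q (- s)) has_real_derivative q' (- 0) * (- 1)) (at 0)"
        by (rule DERIV_chain2[OF der]) (auto intro!: derivative_eq_intros)
      then have "(q has_real_derivative - q' 0) (at 0)" by (simp add: q_def[abs_def])
      from DERIV_unique[OF this der] show ?thesis by simp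
    qed
    show False
    proof (rule power_not_O_higher_power[OF \<gamma>(1)])
      show "0 < \<bar>C\<bar>" using C by simp
      fix s :: real assume s: "0 < s" "s \<le> 1"
      obtain z where z: "0 < z" "z < s" "q s - q 0 = (s - 0) * q' z"
        using MVT2[OF s(1), of q q'] der by blast
      have "\<bar>q' z\<bar> \<le> M * z powr (\<gamma> - 1)"
        using M[of "z *\<^sub>R b" 0] z s \<open>q' 0 = 0\<close> by (simp add: q'_def nb)
      also have "\<dots> \<le> \<bar>M\<bar> * s powr (\<gamma> - 1)"
        using z False by (intro mult_mono powr_mono2) auto
      finally have "s * \<bar>q' z\<bar> \<le> s * (\<bar>M\<bar> * s powr (\<gamma> - 1))" using s by (intro mult_left_mono) auto
      moreover have "\<bar>C\<bar> * s powr \<mu> = s * \<bar>q' z\<bar>"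
        using arg_cong[OF z(3), of abs] s by (simp add: q_def abs_mult)
      moreover have "s * s powr (\<gamma> - 1) = s powr \<gamma>" using s by (simp add: powr_diff)
      ultimately show "\<bar>C\<bar> * s powr \<mu> \<le> \<bar>M\<bar> * s powr \<gamma>"
        by (metis mult.left_commute)
    qed
  qed
qed

lemma DERIV_zero_on_right:
  fixes p :: "real \<Rightarrow> real"
  assumes "(p has_real_derivative D) (at a)" "\<And>s. a \<le> s \<Longrightarrow> p s = 0"
  shows "D = 0"
proof -
  have "((\<lambda>y. (p y - p a) / (y - a)) \<longlongrightarrow> D) (at_right a)"
    using assms(1) unfolding has_field_derivative_iff by (rule tendsto_mono[OF at_le, rotated]) simp
  moreover have "((\<lambda>y. (p y - p a) / (y - a)) \<longlongrightarrow> 0) (at_right a)"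
    by (rule tendsto_eventually) (auto simp: eventually_at_filter assms(2))
  ultimately show ?thesis using tendsto_unique trivial_limit_at_right_real by blast
qed

lemma DERIV_zero_on_left:
  fixes p :: "real \<Rightarrow> real"
  assumes "(p has_real_derivative D) (at a)" "\<And>s. s \<le> a \<Longrightarrow> p s = 0"
  shows "D = 0"
proof -
  have "((\<lambda>y. (p y - p a) / (y - a)) \<longlongrightarrow> D) (at_left a)"
    using assms(1) unfolding has_field_derivative_iff by (rule tendsto_mono[OF at_le, rotated]) simp
  moreover have "((\<lambda>y. (p y - p a) / (y - a)) \<longlongrightarrow> 0) (at_left a)"
    by (rule tendsto_eventually) (auto simp: eventually_at_filter assms(2))
  ultimately show ?thesis using tendsto_unique trivial_limit_at_left_real by blast
qed

section \<open>A radial steady state with a free boundary\<close>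

text \<open>
  A function \<open>w(|x|\<^sup>2)\<close> has constant Laplacian \<open>2 N\<close> iff \<open>4 t w'' + 2 N w' = 2 N\<close>, whose solutions satisfy
  \<open>w' = 1 - c t\<^bsup>-N/2\<^esup>\<close>. The choice \<open>c = 1\<close> lets \<open>w'\<close> vanish at \<open>t = 1\<close>, where it is continued by
  zero.
\<close>

definition steady_slope :: "real \<Rightarrow> real \<Rightarrow> real" where
  "steady_slope N t = 1 - (max t 1) powr (- (N / 2))"

text \<open>
  The lower limit \<open>-1\<close> puts \<open>t = 0\<close> in the interior of the range, so that the derivative at \<open>0\<close> is
  two-sided; the slope vanishes on the additional part.
\<close>

definition steady_profile :: "real \<Rightarrow> real \<Rightarrow> real" where
  "steady_profile N t = integral {-1..t} (steady_slope N)"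

definition steady_state :: "'a::euclidean_space \<Rightarrow> real" where
  "steady_state x = steady_profile (real DIM('a)) ((norm x)\<^sup>2)"

lemma steady_slope_cont: "continuous_on S (steady_slope N)"
  unfolding steady_slope_def[abs_def]
  by (intro continuous_intros) auto

lemma steady_slope_le_1: "t \<le> 1 \<Longrightarrow> steady_slope N t = 0"
  by (simp add: steady_slope_def max_def)

lemma steady_profile_der:
  assumes "- 1 < t"
  shows "(steady_profile N has_real_derivative steady_slope N t) (at t)"
proof -
  have "((\<lambda>u. integral {-1..u} (steady_slope N)) has_real_derivative steady_slope N t) (at t within {-1..t + 1})"
    by (rule integral_has_real_derivative[OF steady_slope_cont]) (use assms in auto)
  moreover have "at t within {-1..t + 1} = at t"
    by (rule at_within_interior) (use assms in auto)
  ultimately show ?thesis by (simp add: steady_profile_def[abs_def])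
qed

lemma steady_profile_le_1: "t \<le> 1 \<Longrightarrow> steady_profile N t = 0"
  unfolding steady_profile_def
  by (subst integral_cong[where g="\<lambda>_. 0"]) (auto simp: steady_slope_le_1)

lemma steady_state_der:
  "(steady_state has_derivative (\<lambda>v. steady_slope (real DIM('a)) ((norm x)\<^sup>2) * (2 * (x \<bullet> v)))) (at (x::'a::euclidean_space))"
proof -
  have sq: "((\<lambda>x::'a. (norm x)\<^sup>2) has_derivative (\<lambda>v. 2 * (x \<bullet> v))) (at x)"
    unfolding power2_norm_eq_inner by (auto intro!: derivative_eq_intros simp: inner_commute)
  have "- 1 < (norm x)\<^sup>2" using zero_le_power2[of "norm x"] by linarith
  from has_derivative_compose[OF sq steady_profile_der[OF this, unfolded has_field_derivative_def]]
  show ?thesis by (simp add: steady_state_def[abs_def])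
qed

lemma steady_state_partial:
  "partial steady_state b (x::'a::euclidean_space) = steady_slope (real DIM('a)) ((norm x)\<^sup>2) * (2 * (x \<bullet> b))"
  by (rule partial_eqI[OF steady_state_der])

lemma steady_state_C1: "C1 (steady_state :: 'a::euclidean_space \<Rightarrow> real)"
  unfolding C1_def steady_state_partial[abs_def]
  using steady_state_der
  by (auto simp: differentiable_def intro!: continuous_intros continuous_on_compose2[OF steady_slope_cont[of UNIV]])

lemma steady_state_support:
  assumes "steady_state (x::'a::euclidean_space) \<noteq> 0"
  shows "1 < norm x"
proof (rule ccontr)
  assume "\<not> 1 < norm x"
  then have "(norm x)\<^sup>2 \<le> 1" by (simp add: power_le_one)
  then show False using assms steady_profile_le_1 by (simp add: steady_state_def)
qed

lemma steady_state_second: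
  fixes x :: "'a::euclidean_space"
  assumes x: "1 < norm x"
  shows "partial steady_state b differentiable at x"
    "partial (partial steady_state b) b x =
      2 * (1 - ((norm x)\<^sup>2) powr (- (real DIM('a) / 2))) * (b \<bullet> b)
      + 2 * real DIM('a) * ((norm x)\<^sup>2) powr (- (real DIM('a) / 2) - 1) * (x \<bullet> b)\<^sup>2"
proof -
  let ?N = "real DIM('a)"
  have sq: "((\<lambda>x::'a. (norm x)\<^sup>2) has_derivative (\<lambda>v. 2 * (x \<bullet> v))) (at x)"
    unfolding power2_norm_eq_inner by (auto intro!: derivative_eq_intros simp: inner_commute)
  have p: "0 < (norm x)\<^sup>2" using x by auto
  have "((\<lambda>t. 1 - t powr (- (?N / 2))) has_real_derivative
     (?N / 2) * ((norm x)\<^sup>2) powr (- (?N / 2) - 1)) (at ((norm x)\<^sup>2))"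
    using p by (auto intro!: derivative_eq_intros)
  from has_derivative_compose[OF sq this[unfolded has_field_derivative_def]]
  have "((\<lambda>x::'a. 1 - ((norm x)\<^sup>2) powr (- (?N / 2))) has_derivative
     (\<lambda>v. (?N / 2) * ((norm x)\<^sup>2) powr (- (?N / 2) - 1) * (2 * (x \<bullet> v)))) (at x)" .
  moreover have "((\<lambda>x. 2 * (x \<bullet> b)) has_derivative (\<lambda>v. 2 * (v \<bullet> b))) (at x)"
    by (auto intro!: derivative_eq_intros)
  ultimately
  have "((\<lambda>x::'a. (1 - ((norm x)\<^sup>2) powr (- (?N / 2))) * (2 * (x \<bullet> b))) has_derivative
     (\<lambda>v. (1 - ((norm x)\<^sup>2) powr (- (?N / 2))) * (2 * (v \<bullet> b)) +
       (?N / 2) * ((norm x)\<^sup>2) powr (- (?N / 2) - 1) * (2 * (x \<bullet> v)) * (2 * (x \<bullet> b)))) (at x)"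
    by (rule has_derivative_mult)
  then have D: "(partial steady_state b has_derivative
     (\<lambda>v. (1 - ((norm x)\<^sup>2) powr (- (?N / 2))) * (2 * (v \<bullet> b)) +
       (?N / 2) * ((norm x)\<^sup>2) powr (- (?N / 2) - 1) * (2 * (x \<bullet> v)) * (2 * (x \<bullet> b)))) (at x)"
  proof (rule has_derivative_transform_within_open[where s="- cball 0 1"])
    fix y :: 'a assume "y \<in> - cball 0 1"
    then have "1 \<le> (norm y)\<^sup>2" by (simp add: one_le_power)
    then have "max ((norm y)\<^sup>2) 1 = (norm y)\<^sup>2" by (rule max_absorb1)
    then show "(1 - ((norm y)\<^sup>2) powr (- (?N / 2))) * (2 * (y \<bullet> b)) = partial steady_state b y"
      by (simp add: steady_state_partial steady_slope_def)
  qed (use x in auto)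
  then show "partial steady_state b differentiable at x" by (auto simp: differentiable_def)
  show "partial (partial steady_state b) b x =
      2 * (1 - ((norm x)\<^sup>2) powr (- (?N / 2))) * (b \<bullet> b)
      + 2 * ?N * ((norm x)\<^sup>2) powr (- (?N / 2) - 1) * (x \<bullet> b)\<^sup>2"
    using partial_eqI[OF D, of b] by (simp add: power2_eq_square)
qed

lemma steady_state_laplacian:
  fixes x :: "'a::euclidean_space"
  assumes x: "1 < norm x"
  shows "laplacian steady_state x = 2 * real DIM('a)"
proof -
  let ?N = "real DIM('a)"
  have "(norm x)\<^sup>2 \<noteq> 0" using x by auto
  then have p: "((norm x)\<^sup>2) powr (- (?N / 2) - 1) * (norm x)\<^sup>2 = ((norm x)\<^sup>2) powr (- (?N / 2))"
    by (simp add: powr_diff)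
  have "laplacian steady_state x = 2 * (1 - ((norm x)\<^sup>2) powr (- (?N / 2))) * ?N
     + 2 * ?N * ((norm x)\<^sup>2) powr (- (?N / 2) - 1) * (\<Sum>b\<in>Basis. (x \<bullet> b)\<^sup>2)"
    by (simp add: laplacian_def steady_state_second[OF x] sum.distrib sum_distrib_left)
  also have "\<dots> = 2 * (1 - ((norm x)\<^sup>2) powr (- (?N / 2))) * ?N
     + 2 * ?N * (((norm x)\<^sup>2) powr (- (?N / 2) - 1) * (norm x)\<^sup>2)"
    by (simp only: sum_Basis_square mult.assoc)
  also have "\<dots> = 2 * ?N" unfolding p by (simp add: algebra_simps)
  finally show ?thesis by simp
qed

lemma steady_state_laplacian_der:
  fixes x :: "'a::euclidean_space"
  assumes x: "1 < norm x"
  shows "(laplacian steady_state has_derivative (\<lambda>_. 0)) (at x)"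
  by (rule has_derivative_transform_within_open[where s="- cball 0 1" and f="\<lambda>_. 2 * real DIM('a)"])
     (use x in \<open>auto simp: steady_state_laplacian\<close>)

lemma steady_state_grad_laplacian:
  "1 < norm (x::'a::euclidean_space) \<Longrightarrow> grad (laplacian steady_state) x = 0"
  by (simp add: grad_def partial_eqI[OF steady_state_laplacian_der])

text \<open>
  Where the steady state is nonzero its Laplacian is constant, so it is stationary with zero flux.
\<close>

lemma steady_state_flux: "thin_film_flux n steady_state (x::'a::euclidean_space) = 0"
  using steady_state_grad_laplacian[OF steady_state_support, of x]
  by (cases "steady_state x = 0") (auto simp: thin_film_flux_def)

lemma steady_state_solution:
  assumes T: "0 < T"
  shows "thin_film_solution n T (steady_state :: 'a::euclidean_space \<Rightarrow> real) (\<lambda>x t. steady_state x)"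
  unfolding thin_film_solution_def
proof (intro conjI ballI allI impI)
  have c: "continuous_on S (\<lambda>z::'a \<times> real. steady_state (fst z))" for S
    by (rule continuous_on_compose2[OF C1_continuous[OF steady_state_C1]]) (auto intro!: continuous_intros)
  show "continuous_on (UNIV \<times> {0..T}) (\<lambda>(x::'a, t::real). steady_state x)"
    using c by (simp add: case_prod_unfold)
  have "continuous_on {(x::'a, t::real). 0 < t \<and> t < T \<and> steady_state x \<noteq> 0} (\<lambda>z. 0 :: 'a)" by simp
  then show "continuous_on {(x::'a, t). 0 < t \<and> t < T \<and> steady_state x \<noteq> 0}
       (\<lambda>(x, t). grad (laplacian steady_state) x)"
    by (rule continuous_on_eq) (auto simp: steady_state_grad_laplacian steady_state_support)
  show "set_integrable lborel K (\<lambda>(x::'a, t::real). thin_film_flux n steady_state x)" for K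
    by (simp add: steady_state_flux set_integrable_def case_prod_unfold)
  fix \<phi> :: "'a \<times> real \<Rightarrow> real" assume \<phi>: "test_function_on (UNIV \<times> {0<..<T}) \<phi>"
  have "(\<integral>z. steady_state (fst z) * partial \<phi> (0, 1) z \<partial>lborel) = - (\<integral>z. 0 * \<phi> z \<partial>lborel)"
    by (rule weak_integration_by_parts(3)[OF _ \<phi> _ _ c])
       (auto simp: open_Times Basis_prod_def)
  then show "(\<integral>(x, t). steady_state x * partial \<phi> (0, 1) (x, t) +
             thin_film_flux n steady_state x \<bullet> grad (\<lambda>z. \<phi> (z, t)) x \<partial>lborel) = 0"
    by (simp add: steady_state_flux case_prod_unfold)
next
  fix t x b assume "steady_state (x::'a) \<noteq> 0"
  then have x: "1 < norm x" by (rule steady_state_support)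
  show "partial steady_state b differentiable at x" by (rule steady_state_second(1)[OF x])
  show "laplacian steady_state differentiable at x"
    using steady_state_laplacian_der[OF x] by (auto simp: differentiable_def)
qed (use T steady_state_C1 in auto)

text \<open>
  Regularity above \<open>C\<^sup>2\<close> requires a differentiable gradient, but along a ray the radial derivative has
  one-sided slopes \<open>0\<close> and \<open>2 N\<close> at the free boundary.
\<close>

lemma steady_state_not_holder_loc:
  assumes \<gamma>: "2 < \<gamma>"
  shows "\<not> holder_loc \<gamma> (steady_state :: 'a::euclidean_space \<Rightarrow> real)"
proof
  assume h: "holder_loc \<gamma> (steady_state :: 'a \<Rightarrow> real)"
  obtain b :: 'a where b: "b \<in> Basis" using nonempty_Basis by blast
  let ?N = "real DIM('a)"
  have "3 \<le> \<lceil>\<gamma>\<rceil>" using \<gamma> by linarith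
  moreover have "nat (c - 1) = Suc (Suc (nat (c - 3)))" if "3 \<le> c" for c :: int using that by auto
  ultimately have "nat (\<lceil>\<gamma>\<rceil> - 1) = Suc (Suc (nat (\<lceil>\<gamma>\<rceil> - 3)))" by blast
  then have "partial (steady_state :: 'a \<Rightarrow> real) b differentiable at b"
    using h b by (auto simp: holder_loc_def)
  from line_derivative[OF has_derivative_partial[OF this], of b]
  obtain D where "((\<lambda>s. partial steady_state b (b + s *\<^sub>R b)) has_real_derivative D) (at (1 - 1))" by auto
  then have "((\<lambda>s. partial steady_state b (b + (s - 1) *\<^sub>R b)) has_real_derivative D) (at 1)"
    using DERIV_shift[of "\<lambda>s. partial steady_state b (b + s *\<^sub>R b)" D 1 "- 1"] by simp
  moreover have "partial steady_state b (b + (s - 1) *\<^sub>R b) = steady_slope ?N (s\<^sup>2) * (2 * s)" for s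
  proof -
    have "b + (s - 1) *\<^sub>R b = s *\<^sub>R b" by (simp add: algebra_simps)
    then show ?thesis using b by (simp add: steady_state_partial)
  qed
  ultimately have der: "((\<lambda>s. steady_slope ?N (s\<^sup>2) * (2 * s)) has_real_derivative D) (at 1)" by simp
  define q where "q s = steady_slope ?N ((max s 0)\<^sup>2) * (2 * s)" for s
  have der: "(q has_real_derivative D) (at 1)"
    by (rule has_field_derivative_transform_within_open[OF der, of "{0<..}"]) (auto simp: q_def)
  have "q s = 0" if "s \<le> 1" for s
  proof -
    have "(max s 0)\<^sup>2 \<le> 1" using that by (intro power_le_one) auto
    then show ?thesis by (simp add: q_def steady_slope_le_1)
  qed
  from DERIV_zero_on_left[OF der this] have D0: "D = 0" .
  have r: "((\<lambda>s. (1 - (s\<^sup>2) powr (- (?N / 2))) * (2 * s)) has_real_derivative 2 * ?N) (at 1)"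
    by (auto intro!: derivative_eq_intros)
  have "q s - (1 - (s\<^sup>2) powr (- (?N / 2))) * (2 * s) = 0" if "1 \<le> s" for s
  proof -
    have "1 \<le> s\<^sup>2" using that by (rule one_le_power)
    then have "max (s\<^sup>2) 1 = s\<^sup>2" "max s 0 = s" using that by auto
    then show ?thesis by (simp add: q_def steady_slope_def)
  qed
  from DERIV_zero_on_right[OF DERIV_diff[OF der r] this] D0 show False by simp
qed

section \<open>Optimal regularity\<close>

lemma focusing_eigenfunction_profile:
  assumes N: "2 \<le> N" and n: "0 < n" and \<alpha>: "0 < \<alpha>" and \<beta>: "\<beta> = (1 + \<alpha> * n) / 4"
    and eigen: "focusing_eigenfunction N n \<alpha> \<beta> f"
  shows "\<exists>J \<delta>. focusing_profile N n \<alpha> \<beta> f J \<delta>"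
proof -
  obtain J where J: "\<forall>y>0. f y \<noteq> 0 \<longrightarrow>
              J y = y ^ (N - 1) * \<bar>f y\<bar> powr n * hderiv (radial_laplacian N f) y"
    "negligible {y. 0 < y \<and> f y = 0 \<and> J y \<noteq> 0}"
    "\<forall>y>0. J differentiable at y \<and>
              - (1 / y ^ (N - 1)) * hderiv J y - \<beta> * y * hderiv f y + \<alpha> * f y = 0"
    using eigen unfolding focusing_eigenfunction_def by blast
  have "C3_near_origin f" using eigen unfolding focusing_eigenfunction_def by blast
  then obtain \<delta> where \<delta>: "0 < \<delta>"
    "\<forall>k<3. \<forall>y\<in>{0..<\<delta>}. (hderiv ^^ k) f differentiable (at y within {0..})"
    "continuous_on {0..<\<delta>} ((hderiv ^^ 3) f)"
    unfolding C3_near_origin_def by (elim exE conjE) (rule that)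
  have e: "f differentiable_on {0..}" "continuous_on {0..} (hderiv f)" "hderiv f 0 = 0"
    "(hderiv ^^ 3) f 0 = 0"
    "\<forall>y>0. f y \<noteq> 0 \<longrightarrow> hderiv f differentiable at y \<and> radial_laplacian N f differentiable at y"
    using eigen unfolding focusing_eigenfunction_def by blast+
  have "focusing_profile N n \<alpha> \<beta> f J \<delta>"
  proof
    show "hderiv f differentiable at y within {0..}" "hderiv (hderiv f) differentiable at y within {0..}"
      if "0 \<le> y" "y < \<delta>" for y
      using \<delta>(2)[rule_format, of 1 y] \<delta>(2)[rule_format, of 2 y] that by (simp_all add: numeral_2_eq_2)
    show "continuous_on {0..<\<delta>} (hderiv (hderiv (hderiv f)))" "hderiv (hderiv (hderiv f)) 0 = 0"
      using \<delta>(3) e(4) by (simp_all add: numeral_3_eq_3)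
  qed (use N n \<alpha> \<beta> J \<delta>(1) e in simp_all)
  then show ?thesis by blast
qed

lemma threshold_exponent:
  fixes n \<alpha> :: real
  assumes "0 < n" "n < 2" "0 < \<alpha>"
  shows "4 * \<alpha> / (1 + n * \<alpha>) < 1 \<longleftrightarrow> \<alpha> < 1 / (4 - n)"
proof -
  have "0 < 1 + n * \<alpha>" using assms by (intro add_pos_pos mult_pos_pos) auto
  then show ?thesis using assms by (simp add: field_simps)
qed

theorem theorem6p1:
  fixes n \<alpha> \<beta> \<mu> C :: real and f :: "real \<Rightarrow> real"
  assumes dim: "DIM('a::euclidean_space) \<ge> 2"
    and n: "0 < n" "n < 2"
    and alpha: "\<alpha> > 0"
    and beta: "\<beta> = (1 + \<alpha> * n) / 4"
    and mu: "\<mu> = \<alpha> / \<beta>"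
    and eigen: "focusing_eigenfunction DIM('a) n \<alpha> \<beta> f"
    and C: "C \<noteq> 0"
    and growth: "((\<lambda>y. f y / (C * y powr (\<alpha> / \<beta>))) \<longlongrightarrow> 1) at_top"
  shows
   "(\<mu> = 4 * \<alpha> / (1 + n * \<alpha>)) \<and>
    (\<forall>T>0. thin_film_solution n T (\<lambda>x::'a. focusing_solution \<alpha> \<beta> f x (- T))
        (\<lambda>x t. if t < T then focusing_solution \<alpha> \<beta> f x (t - T) else focusing_trace \<alpha> \<beta> f x)) \<and>
    (\<forall>R. uniform_limit (cball (0::'a) R) (\<lambda>t x. focusing_solution \<alpha> \<beta> f x t)
        (\<lambda>x. C * norm x powr \<mu>) (at_left 0)) \<and>
    (\<forall>x::'a. focusing_trace \<alpha> \<beta> f x = C * norm x powr \<mu>) \<and>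
    (\<forall>\<gamma>>\<mu>. \<not> (\<forall>T u0 (u :: 'a \<Rightarrow> real \<Rightarrow> real). thin_film_solution n T u0 u \<longrightarrow>
        (\<forall>t\<in>{0<..T}. holder_loc \<gamma> (\<lambda>x. u x t)))) \<and>
    (\<forall>\<gamma>>\<mu>. \<not> (\<forall>T u0 (u :: 'a \<Rightarrow> real \<Rightarrow> real). thin_film_solution n T u0 u \<and> radial_on T u \<longrightarrow>
        (\<forall>t\<in>{0<..T}. holder_loc \<gamma> (\<lambda>x. u x t)))) \<and>
    (\<mu> < 1 \<longleftrightarrow> \<alpha> < 1 / (4 - n)) \<and>
    (\<mu> < 1 \<longrightarrow> (\<forall>p\<ge>1. grad_in_Lp_loc p (focusing_trace \<alpha> \<beta> f :: 'a \<Rightarrow> real) \<longleftrightarrow>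
        p \<in> {1..<real DIM('a) / (1 - \<mu>)})) \<and>
    (\<mu> < 1 \<longrightarrow> (\<forall>t>0. \<not> (\<forall>T u0 (u :: 'a \<Rightarrow> real \<Rightarrow> real).
        thin_film_solution n T u0 u \<and> t \<le> T \<longrightarrow>
        grad_in_Lp_loc (real DIM('a) / (1 - \<mu>)) (\<lambda>x. u x t)))) \<and>
    (\<mu> < 1 \<longrightarrow> (\<forall>t>0. \<not> (\<forall>T u0 (u :: 'a \<Rightarrow> real \<Rightarrow> real).
        thin_film_solution n T u0 u \<and> radial_on T u \<and> t \<le> T \<longrightarrow>
        grad_in_Lp_loc (real DIM('a) / (1 - \<mu>)) (\<lambda>x. u x t))))"
proof -
  obtain J \<delta> where "focusing_profile DIM('a) n \<alpha> \<beta> f J \<delta>"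
    using focusing_eigenfunction_profile[OF dim n(1) alpha beta eigen] by blast
  then interpret focusing_profile "DIM('a)" n \<alpha> \<beta> f J \<delta> .
  note growth' = growth[folded mu]
  have \<beta>0: "0 < \<beta>" by (rule \<beta>)
  have \<mu>0: "0 < \<mu>" using mu alpha \<beta>0 by simp
  have \<mu>_eq: "\<mu> = 4 * \<alpha> / (1 + n * \<alpha>)" unfolding mu beta by (simp add: mult.commute)
  have trace: "focusing_trace \<alpha> \<beta> f x = C * norm x powr \<mu>" for x :: 'a
    by (rule focusing_trace_eq[OF mu C growth'])
  define w where "w T x t = (if t < T then focusing_solution \<alpha> \<beta> f x (t - T) else focusing_trace \<alpha> \<beta> f x)"
    for T t and x :: 'a
  have sol: "thin_film_solution n T (\<lambda>x::'a. focusing_solution \<alpha> \<beta> f x (- T)) (w T)" if "0 < T" for T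
    unfolding w_def[abs_def] trace[abs_def]
    by (rule focusing_is_solution[OF refl that sol_trace_cont[OF mu C growth']])
  have rad: "radial_on T (w T)" for T
    by (auto simp: radial_on_def w_def focusing_solution_def trace)
  have w_end: "w T x T = C * norm x powr \<mu>" for T x by (simp add: w_def trace)
  have holder: "\<exists>T u0 (u :: 'a \<Rightarrow> real \<Rightarrow> real) t. thin_film_solution n T u0 u \<and> radial_on T u \<and>
      t \<in> {0<..T} \<and> \<not> holder_loc \<gamma> (\<lambda>x. u x t)" if \<gamma>: "\<mu> < \<gamma>" for \<gamma>
  proof (cases "\<gamma> \<le> 2")
    case True
    have "\<not> holder_loc \<gamma> (\<lambda>x. w 1 x 1)"
      unfolding w_end by (rule power_not_holder_loc[OF \<mu>0 C \<gamma> True])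
    moreover have "(1::real) \<in> {0<..1}" by simp
    ultimately show ?thesis using sol[OF zero_less_one] rad[of 1] by blast
  next
    case False
    \<comment> \<open>The trace may be smooth here, namely if \<open>\<mu>\<close> is an even integer.\<close>
    have "\<not> holder_loc \<gamma> (steady_state :: 'a \<Rightarrow> real)"
      using False by (intro steady_state_not_holder_loc) simp
    moreover have "radial_on 1 (\<lambda>(x::'a) t. steady_state x)"
      by (simp add: radial_on_def steady_state_def)
    moreover have "(1::real) \<in> {0<..1}" by simp
    ultimately show ?thesis using steady_state_solution[OF zero_less_one, where 'a='a] by blast
  qed
  have integrability: "grad_in_Lp_loc p (focusing_trace \<alpha> \<beta> f :: 'a \<Rightarrow> real) \<longleftrightarrow>
        p \<in> {1..<real DIM('a) / (1 - \<mu>)}" if "\<mu> < 1" "1 \<le> p" for p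
  proof -
    have "grad_in_Lp_loc p (\<lambda>x::'a. C * norm x powr \<mu>)" if "p < real DIM('a) / (1 - \<mu>)"
      by (rule power_grad_in_Lp_loc[OF \<mu>0 \<open>\<mu> < 1\<close> dim \<open>1 \<le> p\<close> that])
    moreover have "\<not> grad_in_Lp_loc p (\<lambda>x::'a. C * norm x powr \<mu>)" if "\<not> p < real DIM('a) / (1 - \<mu>)"
      by (rule power_grad_not_in_Lp_loc[OF \<mu>0 \<open>\<mu> < 1\<close> dim C \<open>1 \<le> p\<close>])
         (use that \<open>\<mu> < 1\<close> in \<open>simp add: field_simps\<close>)
    ultimately show ?thesis using \<open>1 \<le> p\<close> unfolding trace[abs_def] by auto
  qed
  have critical: "\<exists>T u0 (u :: 'a \<Rightarrow> real \<Rightarrow> real). thin_film_solution n T u0 u \<and> radial_on T u \<and> t \<le> T \<and>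
      \<not> grad_in_Lp_loc (real DIM('a) / (1 - \<mu>)) (\<lambda>x. u x t)" if "\<mu> < 1" "0 < t" for t
  proof -
    have "1 \<le> real DIM('a) / (1 - \<mu>)" using that \<mu>0 dim by (simp add: field_simps)
    then have "\<not> grad_in_Lp_loc (real DIM('a) / (1 - \<mu>)) (\<lambda>x. w t x t)"
      using integrability[OF that(1)] unfolding w_end trace[abs_def] by auto
    then show ?thesis using sol[OF that(2)] rad[of t] order_refl[of t] by blast
  qed
  show ?thesis
  proof (intro conjI)
    show "\<mu> = 4 * \<alpha> / (1 + n * \<alpha>)" by (rule \<mu>_eq)
    show "\<forall>T>0. thin_film_solution n T (\<lambda>x::'a. focusing_solution \<alpha> \<beta> f x (- T))
        (\<lambda>x t. if t < T then focusing_solution \<alpha> \<beta> f x (t - T) else focusing_trace \<alpha> \<beta> f x)"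
      using sol unfolding w_def[abs_def] by blast
    show "\<forall>R. uniform_limit (cball (0::'a) R) (\<lambda>t x. focusing_solution \<alpha> \<beta> f x t)
        (\<lambda>x. C * norm x powr \<mu>) (at_left 0)"
      using focusing_uniform_limit[OF mu C growth'] by blast
    show "\<forall>x::'a. focusing_trace \<alpha> \<beta> f x = C * norm x powr \<mu>" using trace by blast
    show "\<forall>\<gamma>>\<mu>. \<not> (\<forall>T u0 (u :: 'a \<Rightarrow> real \<Rightarrow> real). thin_film_solution n T u0 u \<longrightarrow>
        (\<forall>t\<in>{0<..T}. holder_loc \<gamma> (\<lambda>x. u x t)))"
      "\<forall>\<gamma>>\<mu>. \<not> (\<forall>T u0 (u :: 'a \<Rightarrow> real \<Rightarrow> real). thin_film_solution n T u0 u \<and> radial_on T u \<longrightarrow>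
        (\<forall>t\<in>{0<..T}. holder_loc \<gamma> (\<lambda>x. u x t)))"
      using holder by (meson, meson)
    show "\<mu> < 1 \<longrightarrow> (\<forall>t>0. \<not> (\<forall>T u0 (u :: 'a \<Rightarrow> real \<Rightarrow> real).
        thin_film_solution n T u0 u \<and> t \<le> T \<longrightarrow>
        grad_in_Lp_loc (real DIM('a) / (1 - \<mu>)) (\<lambda>x. u x t)))"
      "\<mu> < 1 \<longrightarrow> (\<forall>t>0. \<not> (\<forall>T u0 (u :: 'a \<Rightarrow> real \<Rightarrow> real).
        thin_film_solution n T u0 u \<and> radial_on T u \<and> t \<le> T \<longrightarrow>
        grad_in_Lp_loc (real DIM('a) / (1 - \<mu>)) (\<lambda>x. u x t)))"
      using critical by (meson, meson)
    show "\<mu> < 1 \<longleftrightarrow> \<alpha> < 1 / (4 - n)" unfolding \<mu>_eq by (rule threshold_exponent[OF assms(2,3) alpha])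
    show "\<mu> < 1 \<longrightarrow> (\<forall>p\<ge>1. grad_in_Lp_loc p (focusing_trace \<alpha> \<beta> f :: 'a \<Rightarrow> real) \<longleftrightarrow>
        p \<in> {1..<real DIM('a) / (1 - \<mu>)})"
      using integrability by blast
  qed
qed

end
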